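(* Let $n\in\mathbb{N}$, $t_1,\dots,t_n\in\mathbb{R}$, $s_1,\dots,s_n>0$, and let $\mathbf{W}_Y=[W_Y(t_1,s_1)\ \cdots\ W_Y(t_n,s_n)]^\top$, $\mathbf{W}_f=[W_f(t_1,s_1)\ \cdots\ W_f(t_n,s_n)]^\top$ and $\Theta_Y=[\Theta_Y(t_1,s_1)\ \cdots\ \Theta_Y(t_n,s_n)]^\top\in[0,2\pi)^n$. Suppose the covariance matrix $\Gamma=\mathbb{E}[(\mathbf{W}_Y-\mathbb{E}\mathbf{W}_Y)(\mathbf{W}_Y-\mathbb{E}\mathbf{W}_Y)^*]$ is invertible. Then the following hold. (a) The random vector $\Theta_Y$ has the probability density function $$p(\theta_{1:n};\Theta_Y)=\int_0^\infty\cdots\int_0^\infty\Big(\prod_{\ell=1}^nr_\ell\Big)p(\mathbf{w};\mathbf{W}_Y)\,dr_1\cdots dr_n,\qquad\theta_{1:n}=(\theta_1,\dots,\theta_n)\in[0,2\pi)^n,$$ where $\mathbf{w}=[r_1e^{i\theta_1}\ \cdots\ r_ne^{i\theta_n}]^\top$ and $p(\mathbf{w};\mathbf{W}_Y)=\frac{1}{\pi^n\det(\Gamma)}\exp\left(-(\mathbf{w}-\mathbf{W}_f)^*\Gamma^{-1}(\mathbf{w}-\mathbf{W}_f)\right)$. (b) In the case $n=1$, for any $t\in\mathbb{R}$ and $s>0$ (the invertibility assumption meaning here $\mathbb{E}[|W_\Phi(t,s)|^2]>0$), for $\theta\in[0,2\pi)$, $$p(\theta;\Theta_Y(t,s))=\frac{1}{2\pi}e^{-q}+\frac{\sqrt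 q}{2\sqrt\pi}\cos(\theta-\theta_f)\exp\left\{-q\left[1-\cos^2(\theta-\theta_f)\right]\right\}B_q(\theta-\theta_f),$$ where $\theta_f=\arg(W_f(t,s))$, $q=q(t,s)=|W_f(t,s)|^2/\mathbb{E}[|W_\Phi(t,s)|^2]$, $B_q(u)=1+\operatorname{erf}(\sqrt q\cos u)$ for $u\in\mathbb{R}$, and $\operatorname{erf}(z)=\frac{2}{\sqrt\pi}\int_0^ze^{-v^2}dv$.
   Context: The function $\psi:\mathbb{R}\to\mathbb{C}$ belongs to $L^1(\mathbb{R})\cap L^2(\mathbb{R})$, with Fourier transform $\widehat\psi(\omega)=\int_{\mathbb{R}}e^{-it\omega}\psi(t)\,dt$. It is an analytic mother wavelet: $\widehat\psi(\omega)=0$ for $\omega\le0$; moreover $|\widehat\psi|$ is unimodal with a unique maximum point in $(0,\infty)$. The function $f:\mathbb{R}\to\mathbb{R}$ is bounded and deterministic. The noise $\Phi=\{\Phi(t)\}_{t\in\mathbb{R}}$ is a real-valued stationary Gaussian process with constant mean and covariance function $C_\Phi(t_1-t_2)=\mathrm{Cov}(\Phi(t_1),\Phi(t_2))$, which has the spectral representation $C_\Phi(t)=\int_{\mathbb{R}}e^{i\lambda t}F(d\lambda)$ with $F$ a nonnegative measure, $F(\mathbb{R})=C_\Phi(0)$. The observed signal is $Y=f+\Phi$. For $g\in\{f,\Phi,Y\}$, the analytic wavelet transform is $W_g(t,s)=\int_{\mathbb{R}}g(\tau)\frac{1}{\sqrt s}\overline{\psi\left(\frac{\tau-t}{s}\right)}d\tau$,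 $t\in\mathbb{R}$, $s>0$. The phase $\Theta_Y(t,s)\in[0,2\pi)$ is defined by $W_Y(t,s)=|W_Y(t,s)|e^{i\Theta_Y(t,s)}$. The notation $p(\cdot;X)$ denotes the probability density function of $X$; $*$ is the conjugate transpose. If $W_f(t,s)=0$ then $q=0$ and the choice of $\theta_f$ is immaterial. *)

theory Defs
  imports "HOL-Probability.Probability"
begin

definition fourier :: "(real \<Rightarrow> complex) \<Rightarrow> real \<Rightarrow> complex" where
  "fourier \<psi> \<omega> = (CLINT t|lborel. exp (- \<i> * of_real (t * \<omega>)) * \<psi> t)"

definition unimodal :: "(real \<Rightarrow> real) \<Rightarrow> bool" where
  "unimodal g \<longleftrightarrow> (\<exists>m. mono_on {..m} g \<and> antimono_on {m..} g)"

definition analytic_mother_wavelet :: "(real \<Rightarrow> complex) \<Rightarrow> bool" where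
  "analytic_mother_wavelet \<psi> \<longleftrightarrow>
     integrable lborel \<psi> \<and>
     integrable lborel (\<lambda>t. (cmod (\<psi> t))\<^sup>2) \<and>
     (\<forall>\<omega>\<le>0. fourier \<psi> \<omega> = 0) \<and>
     unimodal (\<lambda>\<omega>. cmod (fourier \<psi> \<omega>)) \<and>
     (\<exists>!\<omega>\<^sub>0. 0 < \<omega>\<^sub>0 \<and> (\<forall>\<omega>. cmod (fourier \<psi> \<omega>) \<le> cmod (fourier \<psi> \<omega>\<^sub>0)))"

definition wavelet_transform ::
    "(real \<Rightarrow> complex) \<Rightarrow> (real \<Rightarrow> real) \<Rightarrow> real \<Rightarrow> real \<Rightarrow> complex" where
  "wavelet_transform \<psi> g t s =
     (CLINT \<tau>|lborel. of_real (g \<tau>) * of_real (1 / sqrt s) * cnj (\<psi> ((\<tau> - t) / s)))"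

text \<open>Constants count as (degenerate) Gaussian variables: the covariance function of a Gaussian
  process need only be positive semidefinite.\<close>

definition gaussian_variable :: "'a measure \<Rightarrow> ('a \<Rightarrow> real) \<Rightarrow> bool" where
  "gaussian_variable M X \<longleftrightarrow>
     X \<in> borel_measurable M \<and>
     ((\<exists>\<mu>. AE \<omega> in M. X \<omega> = \<mu>) \<or>
      (\<exists>\<mu> \<sigma>. 0 < \<sigma> \<and> distributed M lborel X (\<lambda>x. ennreal (normal_density \<mu> \<sigma> x))))"

definition gaussian_process :: "'a measure \<Rightarrow> (real \<Rightarrow> 'a \<Rightarrow> real) \<Rightarrow> bool" where
  "gaussian_process M \<Phi> \<longleftrightarrow>
     (\<forall>T a. finite T \<longrightarrow> gaussian_variable M (\<lambda>\<omega>. \<Sum>t\<in>T. a t * \<Phi> t \<omega>))"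

text \<open>Constant mean and covariance \<open>Cov (\<Phi> t\<^sub>1) (\<Phi> t\<^sub>2) = C (t\<^sub>1 - t\<^sub>2)\<close>; for Gaussian processes
  this is the same as strict stationarity.\<close>

definition stationary_with_covariance ::
    "'a measure \<Rightarrow> (real \<Rightarrow> real) \<Rightarrow> (real \<Rightarrow> 'a \<Rightarrow> real) \<Rightarrow> bool" where
  "stationary_with_covariance M C \<Phi> \<longleftrightarrow>
     (\<exists>\<mu>. (\<forall>t. (LINT \<omega>|M. \<Phi> t \<omega>) = \<mu>) \<and>
          (\<forall>t\<^sub>1 t\<^sub>2. (LINT \<omega>|M. (\<Phi> t\<^sub>1 \<omega> - \<mu>) * (\<Phi> t\<^sub>2 \<omega> - \<mu>)) = C (t\<^sub>1 - t\<^sub>2)))"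

text \<open>\<open>char F t\<close> is the integral of \<open>exp (\<i> t \<lambda>)\<close> against \<open>F\<close>.\<close>

definition spectral_measure :: "real measure \<Rightarrow> (real \<Rightarrow> real) \<Rightarrow> bool" where
  "spectral_measure F C \<longleftrightarrow>
     finite_borel_measure F \<and> (\<forall>t. complex_of_real (C t) = char F t) \<and> measure F UNIV = C 0"

definition covariance_matrix ::
    "'a measure \<Rightarrow> ('a \<Rightarrow> complex ^ 'n) \<Rightarrow> complex ^ 'n ^ 'n" where
  "covariance_matrix M X =
     (\<chi> i j. CLINT \<omega>|M. (X \<omega> $ i - (CLINT \<omega>'|M. X \<omega>' $ i)) *
                      cnj (X \<omega> $ j - (CLINT \<omega>'|M. X \<omega>' $ j)))"

definition hermitian_form :: "complex ^ 'n ^ 'n \<Rightarrow> complex ^ 'n \<Rightarrow> complex" where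
  "hermitian_form A v = (\<Sum>i\<in>UNIV. cnj (v $ i) * (A *v v) $ i)"

definition complex_gaussian_density ::
    "complex ^ 'n \<Rightarrow> complex ^ 'n ^ 'n \<Rightarrow> complex ^ 'n \<Rightarrow> complex" where
  "complex_gaussian_density \<mu> \<Gamma> w =
     1 / (of_real pi ^ CARD('n) * det \<Gamma>) * exp (- hermitian_form (matrix_inv \<Gamma>) (w - \<mu>))"

definition wavelet_vector ::
    "(real \<Rightarrow> complex) \<Rightarrow> (real \<Rightarrow> real) \<Rightarrow> real ^ 'n \<Rightarrow> real ^ 'n \<Rightarrow> complex ^ 'n" where
  "wavelet_vector \<psi> g t s = (\<chi> i. wavelet_transform \<psi> g (t $ i) (s $ i))"

text \<open>\<open>Arg2pi\<close> takes values in \<open>[0, 2\<pi>)\<close>, with value \<open>0\<close> at the origin.\<close>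

definition phase_vector :: "complex ^ 'n \<Rightarrow> real ^ 'n" where
  "phase_vector w = (\<chi> i. Arg2pi (w $ i))"

definition polar_vector :: "real ^ 'n \<Rightarrow> real ^ 'n \<Rightarrow> complex ^ 'n" where
  "polar_vector r \<theta> = (\<chi> i. of_real (r $ i) * exp (\<i> * of_real (\<theta> $ i)))"

text \<open>The interval integral is oriented, so this is the usual odd function also for negative
  arguments.\<close>

definition erf :: "real \<Rightarrow> real" where
  "erf z = 2 / sqrt pi * (LBINT v=ereal 0..ereal z. exp (- v\<^sup>2))"

definition phase_density :: "real \<Rightarrow> real \<Rightarrow> real \<Rightarrow> real" where
  "phase_density q \<theta>\<^sub>f \<theta> =
     1 / (2 * pi) * exp (- q) +
     sqrt q / (2 * sqrt pi) * cos (\<theta> - \<theta>\<^sub>f) * exp (- q * (1 - (cos (\<theta> - \<theta>\<^sub>f))\<^sup>2)) *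
       (1 + erf (sqrt q * cos (\<theta> - \<theta>\<^sub>f)))"

end

theory Submission
  imports Defs
begin

text \<open>
  The argument rests on one fact: the noise part of the wavelet transform is a \<^emph>\<open>circular\<close> complex
  Gaussian vector. For a real integrable \<open>h\<close> the integral of \<open>h \<tau> * \<Phi> \<tau>\<close> over \<open>\<tau>\<close> is a limit of finite
  linear combinations of the process. Hence its characteristic function is that of a Gaussian variable
  whose variance is the spectral integral of \<open>\<bar>h^\<bar>\<^sup>2\<close>, where \<open>h^\<close> is the Fourier transform of \<open>h\<close>
  (\<open>char_path_integral\<close>). A real-linear functional of the coefficients has \<open>h = Re g\<close>, where \<open>g\<close> is a
  combination of conjugated, translated and dilated wavelets, and \<open>g\<close> has no frequencies on the closed
  negative half line. At each frequency \<open>l\<close> one of \<open>g^(l)\<close> and \<open>g^(- l)\<close> vanishes, so no cross term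
  appears in \<open>\<bar>h^(l)\<bar>\<^sup>2\<close>, and the variance does not change when \<open>g\<close> is multiplied by a phase factor
  (\<open>spectral_variance_cmult\<close>). This is circularity; at frequency \<open>0\<close> the same vanishing removes the mean
  of the noise. The characteristic function of the centred coefficients at \<open>u\<close> is therefore
  \<open>exp (- u* \<Gamma> u / 4)\<close>, and \<open>\<Gamma>\<close> alone determines their law.

  To pass to a density, choose \<open>B\<close> with \<open>B \<Gamma> B* = 1\<close> by the Gram-Schmidt process
  (\<open>whitening_matrix\<close>). The characteristic function of the whitened vector is that of the standard
  circular Gaussian density, and characteristic functions determine measures on Euclidean spaces
  (\<open>Levy_uniqueness_euclidean\<close>). Undoing the linear map \<open>B\<close> costs the factor
  \<open>\<bar>det B\<bar>\<^sup>2 = 1 / det \<Gamma>\<close> and gives the density of the coefficients (\<open>circular_gaussian_density\<close>).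
  Polar coordinates in each complex coordinate turn it into the density of the phases
  (\<open>distributed_phase_vector\<close>). For a single coefficient, completing the square in the radius leaves an
  integral of \<open>r\<close> against a shifted Gaussian over the half line, which produces the error function
  (\<open>phase_density_radial\<close>).
\<close>

section \<open>Characteristic functions on Euclidean spaces\<close>

text \<open>Written as a product over coordinates because its integral and its Fourier transform then factor; the
closed form in terms of the norm is \<open>gauss_density_eq\<close>.\<close>

definition gauss_density :: "real \<Rightarrow> 'a::euclidean_space \<Rightarrow> real" where
  "gauss_density \<sigma> x = (\<Prod>b\<in>Basis. normal_density 0 \<sigma> (x \<bullet> b))"

lemma gauss_density_nonneg [simp]: "0 \<le> gauss_density \<sigma> x"
  by (simp add: gauss_density_def prod_nonneg)

lemma borel_measurable_gauss_density [measurable]: "gauss_density \<sigma> \<in> borel_measurable borel"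
  unfolding gauss_density_def[abs_def] by measurable

lemma norm_power2_eq_sum_Basis:
  fixes x :: "'a::euclidean_space"
  shows "(norm x)\<^sup>2 = (\<Sum>b\<in>Basis. (x \<bullet> b)\<^sup>2)"
  unfolding power2_norm_eq_inner by (subst euclidean_inner) (simp add: power2_eq_square)

lemma gauss_density_eq:
  fixes x :: "'a::euclidean_space"
  shows "gauss_density \<sigma> x = (1 / sqrt (2 * pi * \<sigma>\<^sup>2)) ^ DIM('a) * exp (- (norm x)\<^sup>2 / (2 * \<sigma>\<^sup>2))"
  unfolding gauss_density_def normal_density_def prod.distrib norm_power2_eq_sum_Basis
  by (simp add: exp_sum[symmetric] sum_divide_distrib[symmetric] sum_negf)

lemma nn_integral_gauss_density:
  assumes "0 < \<sigma>"
  shows "(\<integral>\<^sup>+x. ennreal (gauss_density \<sigma> x) \<partial>lborel) = 1"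
proof -
  have "(\<integral>\<^sup>+x. ennreal (gauss_density \<sigma> x) \<partial>(lborel::'a measure))
      = (\<integral>\<^sup>+(x::'a). (\<Prod>b\<in>Basis. ennreal (normal_density 0 \<sigma> (x \<bullet> b))) \<partial>lborel)"
    by (simp add: gauss_density_def prod_ennreal)
  also have "\<dots> = (\<Prod>b\<in>(Basis :: 'a set). (\<integral>\<^sup>+x. ennreal (normal_density 0 \<sigma> x) \<partial>lborel))"
    by (rule nn_integral_lborel_prod) auto
  also have "\<dots> = 1"
    using assms by (simp add: nn_integral_eq_integral)
  finally show ?thesis .
qed

lemma integrable_gauss_density:
  assumes "0 < \<sigma>"
  shows "integrable lborel (gauss_density \<sigma>)"
  by (rule integrableI_nonneg) (auto simp: nn_integral_gauss_density[OF assms])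

lemma char_normal_density:
  assumes "0 < \<sigma>"
  shows "(CLINT x|lborel. normal_density 0 \<sigma> x * iexp (t * x)) = complex_of_real (exp (- \<sigma>\<^sup>2 * t\<^sup>2 / 2))"
proof -
  have "(CLINT x|lborel. normal_density 0 \<sigma> x * iexp (t * x))
      = \<bar>\<sigma>\<bar> *\<^sub>R (CLINT x|lborel. normal_density 0 \<sigma> (0 + \<sigma> * x) * iexp (t * (0 + \<sigma> * x)))"
    using assms by (intro lborel_integral_real_affine) auto
  also have "\<dots> = (CLINT x|lborel. \<bar>\<sigma>\<bar> *\<^sub>R (normal_density 0 \<sigma> (0 + \<sigma> * x) * iexp (t * (0 + \<sigma> * x))))"
    by simp
  also have "\<dots> = (CLINT x|lborel. std_normal_density x *\<^sub>R iexp ((t * \<sigma>) * x))"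
    using assms by (intro Bochner_Integration.integral_cong)
      (auto simp: normal_density_def field_simps power_mult_distrib real_sqrt_mult scaleR_conv_of_real)
  also have "\<dots> = char std_normal_distribution (t * \<sigma>)"
    unfolding char_def by (subst integral_density) auto
  also have "\<dots> = complex_of_real (exp (- \<sigma>\<^sup>2 * t\<^sup>2 / 2))"
    by (simp add: char_std_normal_distribution power_mult_distrib mult.commute)
  finally show ?thesis .
qed

lemma char_gauss_density:
  fixes u :: "'a::euclidean_space"
  assumes "0 < \<sigma>"
  shows "(CLINT x|lborel. gauss_density \<sigma> x * iexp (u \<bullet> x)) = complex_of_real (exp (- \<sigma>\<^sup>2 * (norm u)\<^sup>2 / 2))"
proof -
  interpret product_sigma_finite "\<lambda>_::'a. lborel :: real measure"
    by standard
  let ?f = "\<lambda>(b::'a) y. complex_of_real (normal_density 0 \<sigma> y) * iexp ((u \<bullet> b) * y)"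
  have int: "integrable lborel (?f b)" for b
  proof (rule Bochner_Integration.integrable_bound[OF integrable_normal_density[OF assms, of 0]])
    show "?f b \<in> borel_measurable lborel" by measurable
  qed (simp add: norm_mult)
  have eq: "complex_of_real (gauss_density \<sigma> x) * iexp (u \<bullet> x) = (\<Prod>b\<in>Basis. ?f b (x \<bullet> b))"
    for x :: 'a
    unfolding gauss_density_def euclidean_inner[of u x] of_real_sum
    by (simp add: sum_distrib_left exp_sum prod.distrib mult.assoc)
  have "(CLINT x|lborel. gauss_density \<sigma> x * iexp (u \<bullet> x))
      = (CLINT x|lborel. (\<Prod>b\<in>Basis. ?f b (x \<bullet> b)))"
    by (simp only: eq)
  also have "\<dots> = (CLINT y|(\<Pi>\<^sub>M b\<in>(Basis::'a set). lborel).
      (\<Prod>b\<in>Basis. ?f b ((\<Sum>c\<in>Basis. y c *\<^sub>R c) \<bullet> b)))"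
    by (subst lborel_eq, subst integral_distr) auto
  also have "\<dots> = (CLINT y|(\<Pi>\<^sub>M b\<in>(Basis::'a set). lborel). (\<Prod>b\<in>Basis. ?f b (y b)))"
    by (intro Bochner_Integration.integral_cong refl prod.cong) simp_all
  also have "\<dots> = (\<Prod>b\<in>(Basis::'a set). integral\<^sup>L lborel (?f b))"
    using int by (intro product_integral_prod) auto
  also have "\<dots> = (\<Prod>b\<in>(Basis::'a set). complex_of_real (exp (- \<sigma>\<^sup>2 * (u \<bullet> b)\<^sup>2 / 2)))"
    by (simp only: char_normal_density[OF assms])
  also have "\<dots> = exp (\<Sum>b\<in>(Basis::'a set). complex_of_real (- \<sigma>\<^sup>2 * (u \<bullet> b)\<^sup>2 / 2))"
    by (simp only: exp_sum exp_of_real finite_Basis)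
  also have "(\<Sum>b\<in>(Basis::'a set). complex_of_real (- \<sigma>\<^sup>2 * (u \<bullet> b)\<^sup>2 / 2))
      = complex_of_real (- \<sigma>\<^sup>2 * (norm u)\<^sup>2 / 2)"
    unfolding norm_power2_eq_sum_Basis of_real_sum[symmetric]
    by (simp only: sum_distrib_left sum_divide_distrib)
  finally show ?thesis by (simp only: exp_of_real)
qed

text \<open>Up to normalisation the left-hand side is the density at \<open>y\<close> of \<open>P\<close> convolved with a Gaussian of
standard deviation \<open>1 / \<sigma>\<close>. The Gaussian kernel is itself a Fourier integral, so exchanging the
integrals expresses this density through the characteristic function of \<open>P\<close>.\<close>

lemma gauss_smoothing_char:
  fixes P :: "'a::euclidean_space measure"
  assumes P: "prob_space P" "sets P = sets borel" and \<sigma>: "0 < \<sigma>"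
  shows "complex_of_real (LINT x|P. exp (- \<sigma>\<^sup>2 * (norm (x - y))\<^sup>2 / 2))
    = (CLINT u|lborel. gauss_density \<sigma> u * iexp (- (u \<bullet> y)) * (CLINT x|P. iexp (u \<bullet> x)))"
proof -
  interpret P: prob_space P by fact
  note P(2)[measurable_cong]
  interpret pair_sigma_finite P "lborel :: 'a measure" ..
  let ?g = "\<lambda>x u. complex_of_real (gauss_density \<sigma> u) * iexp ((x - y) \<bullet> u)"
  have "integrable (P \<Otimes>\<^sub>M lborel) (\<lambda>(x, u). ?g x u)"
  proof (rule Fubini_integrable)
    show "(\<lambda>(x, u). ?g x u) \<in> borel_measurable (P \<Otimes>\<^sub>M lborel)" by measurable
    show "integrable P (\<lambda>x. LINT u|lborel. norm (case (x, u) of (x, u) \<Rightarrow> ?g x u))"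
      by (simp add: norm_mult)
    show "AE x in P. integrable lborel (\<lambda>u. case (x, u) of (x, u) \<Rightarrow> ?g x u)"
    proof (intro AE_I2, simp)
      fix x
      show "integrable lborel (?g x)"
        by (rule Bochner_Integration.integrable_bound[OF integrable_gauss_density[OF \<sigma>]])
          (auto simp: norm_mult)
    qed
  qed
  from Fubini_integral[OF this]
  have "(CLINT u|lborel. CLINT x|P. ?g x u) = (CLINT x|P. CLINT u|lborel. ?g x u)" .
  also have "\<dots> = (CLINT x|P. complex_of_real (exp (- \<sigma>\<^sup>2 * (norm (x - y))\<^sup>2 / 2)))"
    by (simp only: char_gauss_density[OF \<sigma>])
  also have "\<dots> = complex_of_real (LINT x|P. exp (- \<sigma>\<^sup>2 * (norm (x - y))\<^sup>2 / 2))"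
    by (rule integral_complex_of_real)
  also have "(CLINT u|lborel. CLINT x|P. ?g x u)
     = (CLINT u|lborel. gauss_density \<sigma> u * iexp (- (u \<bullet> y)) * (CLINT x|P. iexp (u \<bullet> x)))"
  proof (intro Bochner_Integration.integral_cong refl)
    fix u :: 'a
    have "(CLINT x|P. ?g x u) = (CLINT x|P. (gauss_density \<sigma> u * iexp (- (u \<bullet> y))) * iexp (u \<bullet> x))"
      by (intro Bochner_Integration.integral_cong refl)
        (simp add: inner_diff_left inner_commute[of u] exp_diff exp_minus field_simps mult_exp_exp)
    also have "\<dots> = (gauss_density \<sigma> u * iexp (- (u \<bullet> y))) * (CLINT x|P. iexp (u \<bullet> x))"
      by (rule integral_mult_right_zero)
    finally show "(CLINT x|P. ?g x u) = \<dots>" .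
  qed
  finally show ?thesis by simp
qed

text \<open>The left-hand side is the expectation of \<open>f\<close> after adding independent Gaussian noise of standard
deviation \<open>1 / \<sigma>\<close> to \<open>P\<close>. Substituting \<open>y = x + z / \<sigma>\<close> and exchanging the integrals moves \<open>P\<close> onto the
kernel that \<open>gauss_smoothing_char\<close> evaluates.\<close>

lemma gauss_smoothing_integral:
  fixes P :: "'a::euclidean_space measure" and f :: "'a \<Rightarrow> ennreal"
  assumes P: "prob_space P" "sets P = sets borel" and \<sigma>: "0 < \<sigma>"
    and [measurable]: "f \<in> borel_measurable borel"
  shows "(\<integral>\<^sup>+x. \<integral>\<^sup>+z. f (x + (1 / \<sigma>) *\<^sub>R z) * gauss_density 1 z \<partial>lborel \<partial>P)
    = ennreal ((\<sigma> / sqrt (2 * pi)) ^ DIM('a)) *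
      (\<integral>\<^sup>+y. f y * ennreal (LINT x|P. exp (- \<sigma>\<^sup>2 * (norm (x - y))\<^sup>2 / 2)) \<partial>lborel)"
proof -
  interpret P: prob_space P by fact
  note P(2)[measurable_cong]
  interpret pair_sigma_finite P "lborel :: 'a measure" ..
  let ?d = "DIM('a)"
  let ?e = "\<lambda>x y. ennreal (exp (- \<sigma>\<^sup>2 * (norm (x - y))\<^sup>2 / 2))"
  have inner: "(\<integral>\<^sup>+z. f (x + (1 / \<sigma>) *\<^sub>R z) * gauss_density 1 z \<partial>lborel)
      = ennreal ((\<sigma> / sqrt (2 * pi)) ^ ?d) * (\<integral>\<^sup>+y. f y * ?e x y \<partial>lborel)" for x
  proof -
    have "(\<integral>\<^sup>+y. f y * ?e x y \<partial>lborel)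
       = (\<integral>\<^sup>+z. ennreal ((1 / \<sigma>) ^ ?d) * (f (x + (1 / \<sigma>) *\<^sub>R z) * ?e x (x + (1 / \<sigma>) *\<^sub>R z)) \<partial>lborel)"
      using \<sigma> by (subst lborel_affine[of "1 / \<sigma>" x])
        (auto simp: nn_integral_density nn_integral_distr power_divide)
    also have "\<dots> = ennreal ((1 / \<sigma>) ^ ?d) * (\<integral>\<^sup>+z. f (x + (1 / \<sigma>) *\<^sub>R z) * ?e x (x + (1 / \<sigma>) *\<^sub>R z) \<partial>lborel)"
      by (rule nn_integral_cmult) measurable
    finally have "ennreal ((\<sigma> / sqrt (2 * pi)) ^ ?d) * (\<integral>\<^sup>+y. f y * ?e x y \<partial>lborel)
       = ennreal ((1 / sqrt (2 * pi)) ^ ?d) * (\<integral>\<^sup>+z. f (x + (1 / \<sigma>) *\<^sub>R z) * ?e x (x + (1 / \<sigma>) *\<^sub>R z) \<partial>lborel)"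
      using \<sigma> by (simp add: mult.assoc[symmetric] ennreal_mult[symmetric] power_mult_distrib[symmetric])
    also have "\<dots> = (\<integral>\<^sup>+z. ennreal ((1 / sqrt (2 * pi)) ^ ?d) * (f (x + (1 / \<sigma>) *\<^sub>R z) * ?e x (x + (1 / \<sigma>) *\<^sub>R z)) \<partial>lborel)"
      by (rule nn_integral_cmult[symmetric]) measurable
    also have "\<dots> = (\<integral>\<^sup>+z. f (x + (1 / \<sigma>) *\<^sub>R z) * gauss_density 1 z \<partial>lborel)"
      using \<sigma> by (intro nn_integral_cong)
        (simp add: gauss_density_eq ennreal_mult'[symmetric] power_divide mult.left_commute)
    finally show ?thesis ..
  qed
  have "(\<integral>\<^sup>+x. \<integral>\<^sup>+z. f (x + (1 / \<sigma>) *\<^sub>R z) * gauss_density 1 z \<partial>lborel \<partial>P)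
    = ennreal ((\<sigma> / sqrt (2 * pi)) ^ ?d) * (\<integral>\<^sup>+x. \<integral>\<^sup>+y. f y * ?e x y \<partial>lborel \<partial>P)"
    unfolding inner by (rule nn_integral_cmult) measurable
  also have "(\<integral>\<^sup>+x. \<integral>\<^sup>+y. f y * ?e x y \<partial>lborel \<partial>P) = (\<integral>\<^sup>+y. \<integral>\<^sup>+x. f y * ?e x y \<partial>P \<partial>lborel)"
    by (rule Fubini'[symmetric]) measurable
  also have "\<dots> = (\<integral>\<^sup>+y. f y * (\<integral>\<^sup>+x. ?e x y \<partial>P) \<partial>lborel)"
    by (intro nn_integral_cong nn_integral_cmult) measurable
  also have "\<dots> = (\<integral>\<^sup>+y. f y * ennreal (LINT x|P. exp (- \<sigma>\<^sup>2 * (norm (x - y))\<^sup>2 / 2)) \<partial>lborel)"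
  proof (intro nn_integral_cong arg_cong2[where f = "(*)"] refl nn_integral_eq_integral)
    show "integrable P (\<lambda>x. exp (- \<sigma>\<^sup>2 * (norm (x - y))\<^sup>2 / 2))" for y
      by (rule P.integrable_const_bound[of _ 1]) auto
  qed auto
  finally show ?thesis .
qed

text \<open>The added noise vanishes in the limit, so dominated convergence recovers the integral of \<open>f\<close>.\<close>

lemma gauss_smoothing_tendsto:
  fixes P :: "'a::euclidean_space measure" and f :: "'a \<Rightarrow> real"
  assumes P: "prob_space P" "sets P = sets borel"
    and f: "continuous_on UNIV f" "\<And>x. 0 \<le> f x" "\<And>x. f x \<le> 1"
  shows "(\<lambda>n. \<integral>\<^sup>+x. \<integral>\<^sup>+z. ennreal (f (x + (1 / real (Suc n)) *\<^sub>R z)) * gauss_density 1 z \<partial>lborel \<partial>P)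
     \<longlonglongrightarrow> (\<integral>\<^sup>+x. ennreal (f x) \<partial>P)"
proof -
  interpret P: prob_space P by fact
  note P(2)[measurable_cong]
  let ?S = "\<lambda>n x. \<integral>\<^sup>+z. ennreal (f (x + (1 / real (Suc n)) *\<^sub>R z)) * gauss_density 1 z \<partial>lborel"
  have [measurable]: "f \<in> borel_measurable borel"
    using f(1) by (rule borel_measurable_continuous_onI)
  have one: "(\<integral>\<^sup>+z. ennreal (gauss_density 1 (z::'a)) \<partial>lborel) = 1"
    by (rule nn_integral_gauss_density) simp
  have le: "ennreal (f y) * ennreal (gauss_density 1 (z::'a)) \<le> ennreal (gauss_density 1 z)" for y z
    using mult_right_mono[of "ennreal (f y)" 1 "ennreal (gauss_density 1 z)"] f(3)[of y]
    by (simp add: ennreal_le_1)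
  have inner: "(\<lambda>n. ?S n x)
     \<longlonglongrightarrow> (\<integral>\<^sup>+z. ennreal (f x) * gauss_density 1 (z::'a) \<partial>lborel)" for x
  proof (rule nn_integral_dominated_convergence[where w = "\<lambda>z. ennreal (gauss_density 1 z)"])
    show "AE z in lborel. (\<lambda>n. ennreal (f (x + (1 / real (Suc n)) *\<^sub>R z)) * gauss_density 1 z)
        \<longlonglongrightarrow> ennreal (f x) * gauss_density 1 z"
    proof (intro AE_I2)
      fix z
      have "(\<lambda>n. x + (1 / real (Suc n)) *\<^sub>R z) \<longlonglongrightarrow> x + 0 *\<^sub>R z"
        by (intro tendsto_intros LIMSEQ_Suc lim_1_over_n)
      then have "(\<lambda>n. f (x + (1 / real (Suc n)) *\<^sub>R z)) \<longlonglongrightarrow> f x"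
        using continuous_on_tendsto_compose[OF f(1), of _ x] by auto
      then have "(\<lambda>n. ennreal (f (x + (1 / real (Suc n)) *\<^sub>R z) * gauss_density 1 z)) \<longlonglongrightarrow> ennreal (f x * gauss_density 1 z)"
        by (intro tendsto_ennrealI tendsto_intros)
      then show "(\<lambda>n. ennreal (f (x + (1 / real (Suc n)) *\<^sub>R z)) * gauss_density 1 z)
        \<longlonglongrightarrow> ennreal (f x) * gauss_density 1 z"
        using f(2) by (simp add: ennreal_mult)
    qed
  qed (use le one in auto)
  have lim: "(\<integral>\<^sup>+z. ennreal (f x) * gauss_density 1 (z::'a) \<partial>lborel) = ennreal (f x)" for x
    by (subst nn_integral_cmult) (simp_all add: one)
  show ?thesis
  proof (rule nn_integral_dominated_convergence[where w = "\<lambda>_. 1"])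
    show "AE x in P. ?S n x \<le> 1" for n
    proof (intro AE_I2)
      fix x
      have "?S n x
         \<le> (\<integral>\<^sup>+z. ennreal (gauss_density 1 (z::'a)) \<partial>lborel)"
        by (intro nn_integral_mono le)
      then show "?S n x \<le> 1"
        by (simp add: one)
    qed
    show "AE x in P. (\<lambda>n. ?S n x)
      \<longlonglongrightarrow> ennreal (f x)"
      using inner unfolding lim by simp
  qed (auto simp: P.emeasure_space_1)
qed

text \<open>By \<open>gauss_smoothing_char\<close> the smoothed densities of \<open>P\<close> and \<open>Q\<close> agree. Letting the smoothing vanish,
\<open>P\<close> and \<open>Q\<close> give the same integral to every continuous function with values in \<open>[0, 1]\<close>. The indicator
of a closed set is a pointwise limit of such functions, and the closed sets are an intersection-stable
generator of the Borel sets.\<close>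

theorem Levy_uniqueness_euclidean:
  fixes P Q :: "'a::euclidean_space measure"
  assumes P: "prob_space P" "sets P = sets borel" and Q: "prob_space Q" "sets Q = sets borel"
    and char: "\<And>u. (CLINT x|P. iexp (u \<bullet> x)) = (CLINT x|Q. iexp (u \<bullet> x))"
  shows "P = Q"
proof -
  interpret P: prob_space P by fact
  interpret Q: prob_space Q by fact
  note P(2)[measurable_cong] Q(2)[measurable_cong]
  have kernel: "(LINT x|P. exp (- \<sigma>\<^sup>2 * (norm (x - y))\<^sup>2 / 2)) = (LINT x|Q. exp (- \<sigma>\<^sup>2 * (norm (x - y))\<^sup>2 / 2))"
    if "0 < \<sigma>" for \<sigma> y
  proof -
    have "complex_of_real (LINT x|P. exp (- \<sigma>\<^sup>2 * (norm (x - y))\<^sup>2 / 2))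
        = complex_of_real (LINT x|Q. exp (- \<sigma>\<^sup>2 * (norm (x - y))\<^sup>2 / 2))"
      unfolding gauss_smoothing_char[OF P that] gauss_smoothing_char[OF Q that] char ..
    then show ?thesis by (simp only: of_real_eq_iff)
  qed
  have cont: "(\<integral>\<^sup>+x. ennreal (f x) \<partial>P) = (\<integral>\<^sup>+x. ennreal (f x) \<partial>Q)"
    if f: "continuous_on UNIV f" "\<And>x. 0 \<le> f x" "\<And>x. f x \<le> 1" for f :: "'a \<Rightarrow> real"
  proof (rule LIMSEQ_unique[OF gauss_smoothing_tendsto[OF P f]])
    have [measurable]: "f \<in> borel_measurable borel"
      using f(1) by (rule borel_measurable_continuous_onI)
    show "(\<lambda>n. \<integral>\<^sup>+x. \<integral>\<^sup>+z. ennreal (f (x + (1 / real (Suc n)) *\<^sub>R z)) * gauss_density 1 z \<partial>lborel \<partial>P)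
      \<longlonglongrightarrow> (\<integral>\<^sup>+x. ennreal (f x) \<partial>Q)"
    proof -
      have "(\<integral>\<^sup>+x. \<integral>\<^sup>+z. ennreal (f (x + (1 / real (Suc n)) *\<^sub>R z)) * gauss_density 1 z \<partial>lborel \<partial>P)
        = (\<integral>\<^sup>+x. \<integral>\<^sup>+z. ennreal (f (x + (1 / real (Suc n)) *\<^sub>R z)) * gauss_density 1 z \<partial>lborel \<partial>Q)" for n
      proof -
        have n: "0 < real (Suc n)" and m: "(\<lambda>x. ennreal (f x)) \<in> borel_measurable borel" by simp_all
        show ?thesis
          unfolding gauss_smoothing_integral[OF P n m] gauss_smoothing_integral[OF Q n m] kernel[OF n] ..
      qed
      then show ?thesis using gauss_smoothing_tendsto[OF Q f] by simp
    qed
  qed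
  have closed: "emeasure P C = emeasure Q C" if C: "closed C" for C
  proof (cases "C = {}")
    case False
    have [measurable]: "C \<in> sets borel" using C by auto
    let ?f = "\<lambda>n x. max 0 (1 - real n * infdist x C)"
    have lim: "(\<lambda>n. \<integral>\<^sup>+x. ennreal (?f n x) \<partial>R) \<longlonglongrightarrow> emeasure R C"
      if R: "prob_space R" "sets R = sets borel" for R
    proof -
      interpret R: prob_space R by fact
      note R(2)[measurable_cong]
      have [measurable]: "(\<lambda>x. infdist x C) \<in> borel_measurable borel"
        by (intro borel_measurable_continuous_onI continuous_intros)
      have "(\<lambda>n. \<integral>\<^sup>+x. ennreal (?f n x) \<partial>R) \<longlonglongrightarrow> (\<integral>\<^sup>+x. indicator C x \<partial>R)"
      proof (rule nn_integral_dominated_convergence[where w = "\<lambda>_. 1"])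
        show "AE x in R. (\<lambda>n. ennreal (?f n x)) \<longlonglongrightarrow> indicator C x"
        proof (intro AE_I2)
          fix x
          show "(\<lambda>n. ennreal (?f n x)) \<longlonglongrightarrow> indicator C x"
          proof (cases "x \<in> C")
            case False
            then have pos: "0 < infdist x C"
              using C \<open>C \<noteq> {}\<close> in_closed_iff_infdist_zero[of C x] infdist_nonneg[of x C] by fastforce
            obtain N where N: "1 < real N * infdist x C"
              using reals_Archimedean3[OF pos] by metis
            have "eventually (\<lambda>n. ennreal (?f n x) = 0) sequentially"
              using eventually_ge_at_top[of N]
            proof eventually_elim
              case (elim n)
              then have "real N * infdist x C \<le> real n * infdist x C"
                using pos by simp
              then show ?case using N by (simp add: max_def)
            qed
            then show ?thesis using False by (simp add: tendsto_eventually)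
          qed (simp)
        qed
      qed (auto simp: R.emeasure_space_1 ennreal_le_1 infdist_nonneg)
      then show ?thesis by simp
    qed
    have "(\<integral>\<^sup>+x. ennreal (?f n x) \<partial>P) = (\<integral>\<^sup>+x. ennreal (?f n x) \<partial>Q)" for n
      by (intro cont) (auto intro!: continuous_intros simp: infdist_nonneg)
    then show ?thesis
      using LIMSEQ_unique[OF lim[OF P]] lim[OF Q] by simp
  qed simp
  show ?thesis
  proof (rule measure_eqI_generator_eq[where E = "Collect closed" and \<Omega> = UNIV and A = "\<lambda>_. UNIV"])
    show "Int_stable (Collect closed)" by (auto simp: Int_stable_def)
    show "sets P = sigma_sets UNIV (Collect closed)" "sets Q = sigma_sets UNIV (Collect closed)"
      unfolding P Q borel_eq_closed by (simp_all add: sets_measure_of)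
  qed (use closed P.emeasure_finite in auto)
qed

section \<open>Lebesgue measure on vectors\<close>

lemma measurable_vec_lambda [measurable]:
  "vec_lambda \<in> (\<Pi>\<^sub>M i\<in>(UNIV::'n::finite set). (lborel :: 'a::euclidean_space measure)) \<rightarrow>\<^sub>M borel"
  unfolding borel_measurable_euclidean_space[where 'c = "'a ^ 'n"]
  by (auto simp: Basis_vec_def inner_axis)

text \<open>Identifies vectors with families of coordinates, so that integrals over vectors can be computed one
coordinate at a time.\<close>

lemma lborel_vec:
  "(lborel :: ('a::euclidean_space ^ 'n) measure) = distr (\<Pi>\<^sub>M i\<in>UNIV. lborel) borel vec_lambda"
proof (rule lborel_eqI)
  interpret product_sigma_finite "\<lambda>_::'n. lborel :: 'a measure" ..
  fix l u :: "'a ^ 'n"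
  assume lu: "\<And>b. b \<in> Basis \<Longrightarrow> l \<bullet> b \<le> u \<bullet> b"
  have lu': "l $ i \<bullet> b \<le> u $ i \<bullet> b" if "b \<in> Basis" for i b
    using lu[of "axis i b"] that by (auto simp: Basis_vec_def inner_axis)
  have eq: "vec_lambda -` box l u \<inter> space (\<Pi>\<^sub>M i\<in>(UNIV::'n set). (lborel :: 'a measure))
      = (\<Pi>\<^sub>E i\<in>UNIV. box (l $ i) (u $ i))"
    by (auto simp: box_def Basis_vec_def inner_axis space_PiM PiE_def Pi_def)
  have "emeasure (distr (\<Pi>\<^sub>M i\<in>UNIV. lborel) borel vec_lambda) (box l u)
      = (\<Prod>i\<in>(UNIV::'n set). emeasure lborel (box (l $ i) (u $ i)))"
    by (subst emeasure_distr, measurable) (simp add: eq emeasure_PiM)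
  also have "\<dots> = ennreal (\<Prod>i\<in>(UNIV::'n set). \<Prod>b\<in>Basis. (u $ i - l $ i) \<bullet> b)"
    using lu' by (simp add: prod_ennreal prod_nonneg inner_diff_left)
  also have "(\<Prod>i\<in>(UNIV::'n set). \<Prod>b\<in>Basis. (u $ i - l $ i) \<bullet> b)
      = (\<Prod>i\<in>(UNIV::'n set). \<Prod>c\<in>(\<Union>b\<in>Basis. {axis i b}). (u - l) \<bullet> c)"
    by (intro prod.cong refl, subst prod.UNION_disjoint)
      (auto simp: axis_eq_axis inner_axis inner_diff_left)
  also have "\<dots> = (\<Prod>c\<in>Basis. (u - l) \<bullet> c)"
    unfolding Basis_vec_def
    by (subst (2) prod.UNION_disjoint) (auto simp: axis_eq_axis)
  finally show "emeasure (distr (\<Pi>\<^sub>M i\<in>UNIV. lborel) borel vec_lambda) (box l u)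
     = ennreal (\<Prod>b\<in>Basis. (u - l) \<bullet> b)" .
qed simp

lemma borel_measurable_vec_nth [measurable]:
  "(\<lambda>x::'a::euclidean_space ^ 'n. x $ i) \<in> borel_measurable borel"
  by (intro borel_measurable_continuous_onI continuous_intros)

lemma nn_integral_lborel_vec:
  fixes f :: "'a::euclidean_space ^ 'n \<Rightarrow> ennreal"
  assumes [measurable]: "f \<in> borel_measurable borel"
  shows "(\<integral>\<^sup>+x. f x \<partial>lborel) = (\<integral>\<^sup>+x. f (vec_lambda x) \<partial>(\<Pi>\<^sub>M i\<in>UNIV. lborel))"
  by (subst lborel_vec, subst nn_integral_distr) auto

text \<open>The identity matrix with row \<open>k\<close> replaced by \<open>e\<close>. Multiplication by it changes one coordinate of a
vector, and it performs one step of the Gram-Schmidt process.\<close>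

definition row_matrix :: "'n::finite \<Rightarrow> ('n \<Rightarrow> complex) \<Rightarrow> complex ^ 'n ^ 'n" where
  "row_matrix k e = (\<chi> i j. if i = k then e j else if i = j then 1 else 0)"

lemma row_matrix_mult_vec:
  "row_matrix k e *v w = (\<chi> i. if i = k then (\<Sum>j\<in>UNIV. e j * w $ j) else w $ i)"
  by (auto simp: row_matrix_def matrix_vector_mult_def vec_eq_iff if_distrib[of "\<lambda>x. x * _"] cong: if_cong)

lemma borel_measurable_matrix_vector_mult [measurable]:
  fixes A :: "complex ^ 'n ^ 'm"
  shows "(\<lambda>w. A *v w) \<in> borel_measurable borel"
proof -
  have "linear (\<lambda>w. A *v w)"
    by (auto intro!: linearI simp: matrix_vector_right_distrib matrix_vector_mult_def vec_eq_iff
        sum_distrib_left sum.distrib algebra_simps scaleR_conv_of_real[where 'a=complex] scaleR_sum_right)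
  then show ?thesis
    by (intro borel_measurable_continuous_onI linear_continuous_on linear_conv_bounded_linear[THEN iffD1])
qed

lemma nn_integral_lborel_affine:
  fixes f :: "'a::euclidean_space \<Rightarrow> ennreal"
  assumes [measurable]: "f \<in> borel_measurable borel" and "a \<noteq> 0"
  shows "(\<integral>\<^sup>+y. f y \<partial>lborel) = ennreal (\<bar>a\<bar> ^ DIM('a)) * (\<integral>\<^sup>+y. f (c + a *\<^sub>R y) \<partial>lborel)"
  using assms(2) by (subst lborel_affine[of a c])
    (auto simp: nn_integral_density nn_integral_distr nn_integral_cmult)

text \<open>With the other coordinates fixed, coordinate \<open>k\<close> undergoes the map \<open>y \<mapsto> c + a * y\<close>. The factor is
\<open>a\<^sup>2\<close> because the complex plane has real dimension two.\<close>

lemma nn_integral_row_matrix: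
  fixes f :: "complex ^ 'n \<Rightarrow> ennreal"
  assumes [measurable]: "f \<in> borel_measurable borel" and a: "0 < a" "e k = of_real a"
  shows "(\<integral>\<^sup>+w. f w \<partial>lborel) = ennreal (a\<^sup>2) * (\<integral>\<^sup>+w. f (row_matrix k e *v w) \<partial>lborel)"
proof -
  interpret product_sigma_finite "\<lambda>_::'n. lborel :: complex measure" ..
  let ?J = "UNIV - {k}" and ?P = "\<lambda>J. (\<Pi>\<^sub>M i\<in>(J::'n set). (lborel :: complex measure))"
  have U: "insert k ?J = UNIV" by auto
  let ?F = "\<lambda>x. f (vec_lambda x)"
  have [measurable]: "?F \<in> borel_measurable (?P (insert k ?J))" unfolding U by measurable
  have [measurable]: "(\<lambda>x. f (row_matrix k e *v vec_lambda x)) \<in> borel_measurable (?P (insert k ?J))"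
    unfolding U by measurable
  have inner: "(\<integral>\<^sup>+y. ?F (x(k := y)) \<partial>lborel)
      = ennreal (a\<^sup>2) * (\<integral>\<^sup>+y. f (row_matrix k e *v vec_lambda (x(k := y))) \<partial>lborel)"
    if x: "x \<in> space (?P ?J)" for x
  proof -
    let ?c = "\<Sum>j\<in>?J. e j * x j"
    have eq: "row_matrix k e *v vec_lambda (x(k := y)) = vec_lambda (x(k := ?c + a *\<^sub>R y))" for y
    proof -
      have "(\<Sum>j\<in>UNIV. e j * (x(k := y)) j) = ?c + a *\<^sub>R y"
        by (subst sum.remove[of _ k]) (auto simp: a scaleR_conv_of_real intro!: sum.cong)
      then show ?thesis
        by (auto simp: row_matrix_mult_vec vec_eq_iff)
    qed
    have [measurable]: "(\<lambda>y. ?F (x(k := y))) \<in> borel_measurable lborel"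
    proof -
      have "(\<lambda>y. x(k := y)) \<in> lborel \<rightarrow>\<^sub>M ?P (insert k ?J)"
        using x by (intro measurable_fun_upd[where J = ?J]) auto
      then show ?thesis by measurable
    qed
    show ?thesis
      unfolding eq using a
      by (subst nn_integral_lborel_affine[of _ a ?c]) auto
  qed
  have "(\<integral>\<^sup>+w. f w \<partial>lborel) = (\<integral>\<^sup>+x. ?F x \<partial>?P (insert k ?J))"
    unfolding U by (rule nn_integral_lborel_vec) measurable
  also have "\<dots> = (\<integral>\<^sup>+x. \<integral>\<^sup>+y. ?F (x(k := y)) \<partial>lborel \<partial>?P ?J)"
    by (rule product_nn_integral_insert) auto
  also have "\<dots> = (\<integral>\<^sup>+x. ennreal (a\<^sup>2) * (\<integral>\<^sup>+y. f (row_matrix k e *v vec_lambda (x(k := y))) \<partial>lborel) \<partial>?P ?J)"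
    by (intro nn_integral_cong inner)
  also have "\<dots> = ennreal (a\<^sup>2) * (\<integral>\<^sup>+x. \<integral>\<^sup>+y. f (row_matrix k e *v vec_lambda (x(k := y))) \<partial>lborel \<partial>?P ?J)"
    by (rule nn_integral_cmult) measurable
  also have "(\<integral>\<^sup>+x. \<integral>\<^sup>+y. f (row_matrix k e *v vec_lambda (x(k := y))) \<partial>lborel \<partial>?P ?J)
      = (\<integral>\<^sup>+x. f (row_matrix k e *v vec_lambda x) \<partial>?P (insert k ?J))"
    by (rule product_nn_integral_insert[symmetric]) auto
  also have "\<dots> = (\<integral>\<^sup>+w. f (row_matrix k e *v w) \<partial>lborel)"
    unfolding U by (rule nn_integral_lborel_vec[symmetric]) measurable
  finally show ?thesis .
qed

section \<open>Polar coordinates\<close>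

lemma nn_integral_lborel_complex:
  assumes [measurable]: "f \<in> borel_measurable borel"
  shows "(\<integral>\<^sup>+z. f z \<partial>lborel) = (\<integral>\<^sup>+x. \<integral>\<^sup>+y. f (Complex x y) \<partial>lborel \<partial>lborel)"
proof -
  have [measurable]: "(\<lambda>(x, y). Complex x y) \<in> borel \<Otimes>\<^sub>M borel \<rightarrow>\<^sub>M borel"
    by (simp add: borel_measurable_complex_iff split_beta')
  have "lborel = distr (lborel \<Otimes>\<^sub>M lborel) borel (\<lambda>(x, y). Complex x y)"
  proof (rule lborel_eqI)
    fix l u :: complex
    assume lu: "\<And>b. b \<in> Basis \<Longrightarrow> l \<bullet> b \<le> u \<bullet> b"
    have "(\<lambda>(x, y). Complex x y) -` box l u \<inter> space (lborel \<Otimes>\<^sub>M lborel)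
        = {Re l <..< Re u} \<times> {Im l <..< Im u}"
      by (auto simp: box_def Basis_complex_def space_pair_measure)
    then show "emeasure (distr (lborel \<Otimes>\<^sub>M lborel) borel (\<lambda>(x, y). Complex x y)) (box l u)
        = (\<Prod>b\<in>Basis. (u - l) \<bullet> b)"
      using lu[of 1] lu[of \<i>]
      by (subst emeasure_distr)
        (auto simp: lborel.emeasure_pair_measure_Times Basis_complex_def ennreal_mult complex_eq_iff)
  qed simp
  then have "(\<integral>\<^sup>+z. f z \<partial>lborel) = (\<integral>\<^sup>+z. f z \<partial>distr (lborel \<Otimes>\<^sub>M lborel) borel (\<lambda>(x, y). Complex x y))"
    by simp
  also have "\<dots> = (\<integral>\<^sup>+p. f (case p of (x, y) \<Rightarrow> Complex x y) \<partial>(lborel \<Otimes>\<^sub>M lborel))"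
    by (rule nn_integral_distr) measurable
  also have "\<dots> = (\<integral>\<^sup>+x. \<integral>\<^sup>+y. f (Complex x y) \<partial>lborel \<partial>lborel)"
    by (subst lborel.nn_integral_fst[symmetric]) auto
  finally show ?thesis .
qed

lemma nn_integral_exhausting_tendsto:
  fixes f :: "'a \<Rightarrow> ennreal"
  assumes [measurable]: "f \<in> borel_measurable M" "\<And>n. A n \<in> sets M"
    and inc: "incseq A" and U: "(\<Union>n. A n) = B"
  shows "(\<lambda>n. \<integral>\<^sup>+x. f x * indicator (A n) x \<partial>M) \<longlonglongrightarrow> (\<integral>\<^sup>+x. f x * indicator B x \<partial>M)"
proof (rule nn_integral_LIMSEQ)
  have le: "indicator (A n) x \<le> (indicator (A (Suc n)) x :: ennreal)" for n x
    using incseq_SucD[OF inc, of n] by (auto split: split_indicator)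
  show "incseq (\<lambda>n x. f x * indicator (A n) x)"
    by (intro incseq_SucI) (auto simp: le_fun_def intro!: mult_left_mono le)
  fix x
  show "(\<lambda>n. f x * indicator (A n) x) \<longlonglongrightarrow> f x * indicator B x"
  proof (cases "x \<in> B")
    case True
    then obtain N where "x \<in> A N" using U by auto
    then have "x \<in> A n" if "N \<le> n" for n
      using inc that by (auto simp: incseq_def)
    then show ?thesis using True
      by (intro tendsto_eventually eventually_sequentiallyI[of N]) auto
  next
    case False
    then have "x \<notin> A n" for n using U by auto
    then show ?thesis using False by simp
  qed
qed measurable

text \<open>The substitution \<open>\<theta> = arctan t\<close> is made on the intervals \<open>[- (n + 1), n + 1]\<close>; both sides are then
monotone limits.\<close>

lemma nn_integral_arctan:
  fixes H :: "real \<Rightarrow> ennreal"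
  assumes [measurable]: "H \<in> borel_measurable borel"
  shows "(\<integral>\<^sup>+t. H (arctan t) * ennreal (1 / (1 + t\<^sup>2)) \<partial>lborel)
    = (\<integral>\<^sup>+\<theta>. H \<theta> * indicator {- (pi / 2) <..< pi / 2} \<theta> \<partial>lborel)"
proof (rule LIMSEQ_unique)
  let ?L = "\<lambda>n. \<integral>\<^sup>+\<theta>. H \<theta> * indicator {arctan (- real (Suc n))..arctan (real (Suc n))} \<theta> \<partial>lborel"
  have step: "?L n = (\<integral>\<^sup>+t. H (arctan t) * ennreal (1 / (1 + t\<^sup>2)) * indicator {- real (Suc n)..real (Suc n)} t \<partial>lborel)" for n
    by (rule nn_integral_substitution_aux)
      (auto intro!: derivative_eq_intros continuous_intros simp: field_simps
        simp: add_nonneg_eq_0_iff)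
  have "(\<Union>n. {- real (Suc n)..real (Suc n)}) = UNIV"
  proof -
    have "\<exists>n. x \<in> {- real (Suc n)..real (Suc n)}" for x :: real
    proof -
      obtain n where "\<bar>x\<bar> \<le> real n" using real_arch_simple by blast
      then have "x \<in> {- real (Suc n)..real (Suc n)}" by (simp, linarith)
      then show ?thesis by blast
    qed
    then show ?thesis by blast
  qed
  then have "(\<lambda>n. \<integral>\<^sup>+t. H (arctan t) * ennreal (1 / (1 + t\<^sup>2)) * indicator {- real (Suc n)..real (Suc n)} t \<partial>lborel)
     \<longlonglongrightarrow> (\<integral>\<^sup>+t. H (arctan t) * ennreal (1 / (1 + t\<^sup>2)) * indicator UNIV t \<partial>lborel)"
    by (intro nn_integral_exhausting_tendsto) (auto simp: incseq_def)
  then show "?L \<longlonglongrightarrow> (\<integral>\<^sup>+t. H (arctan t) * ennreal (1 / (1 + t\<^sup>2)) \<partial>lborel)"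
    unfolding step by simp
  have "(\<Union>n. {arctan (- real (Suc n))..arctan (real (Suc n))}) = {- (pi / 2) <..< pi / 2}" (is "?U = ?I")
  proof
    have "arctan (- real (Suc n)) \<le> x \<Longrightarrow> x \<le> arctan (real (Suc n)) \<Longrightarrow> x \<in> ?I" for n x
      using arctan_bounded[of "- real (Suc n)"] arctan_bounded[of "real (Suc n)"] by auto
    then show "?U \<subseteq> ?I" by auto
    have "\<exists>n. x \<in> {arctan (- real (Suc n))..arctan (real (Suc n))}" if x: "x \<in> ?I" for x
    proof -
      obtain n where "\<bar>tan x\<bar> \<le> real n" using real_arch_simple by blast
      then have "- real (Suc n) \<le> tan x" "tan x \<le> real (Suc n)" by auto
      then have "arctan (- real (Suc n)) \<le> arctan (tan x)" "arctan (tan x) \<le> arctan (real (Suc n))"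
        by (simp_all only: arctan_le_iff)
      then show ?thesis using x by (auto simp: arctan_tan)
    qed
    then show "?I \<subseteq> ?U" by blast
  qed
  then show "?L \<longlonglongrightarrow> (\<integral>\<^sup>+\<theta>. H \<theta> * indicator ?I \<theta> \<partial>lborel)"
    by (intro nn_integral_exhausting_tendsto) (auto simp: incseq_def arctan_le_iff)
qed

lemma nn_integral_shift:
  fixes H :: "real \<Rightarrow> ennreal"
  assumes [measurable]: "H \<in> borel_measurable borel"
  shows "(\<integral>\<^sup>+x. H (c + x) \<partial>lborel) = (\<integral>\<^sup>+x. H x \<partial>lborel)"
  using nn_integral_real_affine[of H 1 c] by simp

text \<open>Only one-dimensional substitutions are used. In the right half plane put \<open>y = x * t\<close>, which contributes
the factor \<open>x\<close>, then \<open>x = c * r\<close> with \<open>c = 1 / sqrt (1 + t\<^sup>2)\<close>, which turns \<open>x dx\<close> into \<open>c\<^sup>2 * r dr\<close>. As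
\<open>c\<^sup>2\<close> is the derivative of \<open>arctan t\<close>, the last substitution \<open>\<theta> = arctan t\<close> leaves the Jacobian \<open>r\<close>.\<close>

lemma nn_integral_lborel_polar:
  fixes f :: "complex \<Rightarrow> ennreal"
  assumes [measurable]: "f \<in> borel_measurable borel"
  shows "(\<integral>\<^sup>+z. f z \<partial>lborel)
    = (\<integral>\<^sup>+\<theta>. \<integral>\<^sup>+r. indicator {0..<2 * pi} \<theta> * (indicator {0<..} r * ennreal r) * f (of_real r * iexp \<theta>) \<partial>lborel \<partial>lborel)"
proof -
  let ?g = "\<lambda>z. f z + f (- z)"
  let ?w = "\<lambda>r. indicator {0<..} r * ennreal r"
  define K where "K \<theta> = (\<integral>\<^sup>+r. ?w r * f (of_real r * iexp \<theta>) \<partial>lborel)" for \<theta>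
  have [measurable]: "K \<in> borel_measurable borel" unfolding K_def[abs_def] by measurable
  have [measurable]: "(\<lambda>(x, y). Complex x y) \<in> borel \<Otimes>\<^sub>M borel \<rightarrow>\<^sub>M borel"
    by (simp add: borel_measurable_complex_iff split_beta')
  have K_shift: "K (\<theta> + pi) = (\<integral>\<^sup>+r. ?w r * f (- (of_real r * iexp \<theta>)) \<partial>lborel)"
    "K (\<theta> + 2 * pi) = K \<theta>" for \<theta>
  proof -
    have "iexp (\<theta> + pi) = - iexp \<theta>" "iexp (\<theta> + 2 * pi) = iexp \<theta>"
      by (simp_all add: complex_eq_iff Re_exp Im_exp)
    then show "K (\<theta> + pi) = (\<integral>\<^sup>+r. ?w r * f (- (of_real r * iexp \<theta>)) \<partial>lborel)" "K (\<theta> + 2 * pi) = K \<theta>"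
      unfolding K_def by simp_all
  qed
  let ?L = "\<lambda>x. \<integral>\<^sup>+y. f (Complex x y) \<partial>lborel"
  \<comment> \<open>The line \<open>x = 0\<close> is a null set and the left half plane is the reflection of the right one.\<close>
  have "(\<integral>\<^sup>+z. f z \<partial>lborel) = (\<integral>\<^sup>+x. \<integral>\<^sup>+y. f (Complex x y) \<partial>lborel \<partial>lborel)"
    by (rule nn_integral_lborel_complex) measurable
  also have "\<dots> = (\<integral>\<^sup>+x. (indicator {0<..} x * ?L x)
       + (indicator {..<0} x * ?L x) \<partial>lborel)"
    by (intro nn_integral_cong_AE) (use AE_lborel_singleton[of 0] in eventually_elim, auto split: split_indicator)
  also have "\<dots> = (\<integral>\<^sup>+x. (indicator {0<..} x * ?L x) \<partial>lborel)
       + (\<integral>\<^sup>+x. (indicator {..<0} x * ?L x) \<partial>lborel)"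
    by (rule nn_integral_add) measurable
  also have "(\<integral>\<^sup>+x. (indicator {..<0} x * ?L x) \<partial>lborel)
      = (\<integral>\<^sup>+x. (indicator {0<..} x * (\<integral>\<^sup>+y. f (- Complex x y) \<partial>lborel)) \<partial>lborel)"
  proof -
    have "(\<integral>\<^sup>+y. f (Complex (- x) y) \<partial>lborel) = (\<integral>\<^sup>+y. f (- Complex x y) \<partial>lborel)" for x
      by (subst nn_integral_real_affine[of _ "-1" 0]) (auto simp: complex_eq_iff intro!: nn_integral_cong arg_cong[of _ _ f])
    then show ?thesis
      by (subst nn_integral_real_affine[of _ "-1" 0]) (auto intro!: nn_integral_cong split: split_indicator)
  qed
  also have "(\<integral>\<^sup>+x. (indicator {0<..} x * ?L x) \<partial>lborel) + \<dots>
      = (\<integral>\<^sup>+x. indicator {0<..} x * (\<integral>\<^sup>+y. ?g (Complex x y) \<partial>lborel) \<partial>lborel)"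
    by (simp add: nn_integral_add[symmetric] distrib_left[symmetric])
  also have "\<dots> = (\<integral>\<^sup>+x. \<integral>\<^sup>+t. ?w x * ?g (Complex x (x * t)) \<partial>lborel \<partial>lborel)"
  proof (intro nn_integral_cong)
    fix x :: real
    show "indicator {0<..} x * (\<integral>\<^sup>+y. ?g (Complex x y) \<partial>lborel) = (\<integral>\<^sup>+t. ?w x * ?g (Complex x (x * t)) \<partial>lborel)"
    proof (cases "0 < x")
      case True
      then show ?thesis
        by (subst nn_integral_real_affine[of _ x 0]) (auto simp: nn_integral_cmult)
    qed simp
  qed
  also have "\<dots> = (\<integral>\<^sup>+t. \<integral>\<^sup>+x. ?w x * ?g (Complex x (x * t)) \<partial>lborel \<partial>lborel)"
    by (rule lborel_pair.Fubini'[symmetric]) measurable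
  also have "\<dots> = (\<integral>\<^sup>+t. (K (arctan t) + K (arctan t + pi)) * ennreal (1 / (1 + t\<^sup>2)) \<partial>lborel)"
  proof (intro nn_integral_cong)
    fix t :: real
    define c where "c = 1 / sqrt (1 + t\<^sup>2)"
    have c: "0 < c" "c\<^sup>2 = 1 / (1 + t\<^sup>2)"
      by (auto simp: c_def power_divide add_pos_nonneg)
    have polar: "Complex (c * r) (c * r * t) = of_real r * iexp (arctan t)" for r
      by (simp add: complex_eq_iff c_def Re_exp Im_exp cos_arctan sin_arctan)
    have "(\<integral>\<^sup>+x. ?w x * ?g (Complex x (x * t)) \<partial>lborel)
        = ennreal c * (\<integral>\<^sup>+r. ?w (c * r) * ?g (Complex (c * r) (c * r * t)) \<partial>lborel)"
      using c(1) by (subst nn_integral_real_affine[of _ c 0]) auto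
    also have "\<dots> = ennreal c * (\<integral>\<^sup>+r. ennreal c * (?w r * ?g (of_real r * iexp (arctan t))) \<partial>lborel)"
    proof -
      have "?w (c * r) = ennreal c * ?w r" for r
        using c(1) by (auto simp: ennreal_mult' zero_less_mult_iff split: split_indicator)
      then show ?thesis unfolding polar by (simp only: mult.assoc)
    qed
    also have "\<dots> = ennreal (c\<^sup>2) * (\<integral>\<^sup>+r. ?w r * ?g (of_real r * iexp (arctan t)) \<partial>lborel)"
    proof -
      have "ennreal (c\<^sup>2) = ennreal c * ennreal c"
        using c(1) by (simp add: power2_eq_square ennreal_mult)
      then show ?thesis by (subst nn_integral_cmult, measurable) (simp only: mult.assoc)
    qed
    also have "(\<integral>\<^sup>+r. ?w r * ?g (of_real r * iexp (arctan t)) \<partial>lborel) = K (arctan t) + K (arctan t + pi)"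
      unfolding K_shift by (simp add: K_def nn_integral_add[symmetric] distrib_left)
    finally show "(\<integral>\<^sup>+x. ?w x * ?g (Complex x (x * t)) \<partial>lborel)
        = (K (arctan t) + K (arctan t + pi)) * ennreal (1 / (1 + t\<^sup>2))"
      by (simp add: c(2) mult.commute)
  qed
  also have "\<dots> = (\<integral>\<^sup>+\<theta>. (K \<theta> + K (\<theta> + pi)) * indicator {- (pi / 2) <..< pi / 2} \<theta> \<partial>lborel)"
    by (rule nn_integral_arctan[where H = "\<lambda>\<theta>. K \<theta> + K (\<theta> + pi)"]) measurable
  \<comment> \<open>The angles now run through \<open>(- \<pi> / 2, 3 * \<pi> / 2)\<close> up to a null set; the part below \<open>0\<close> moves up by a period.\<close>
  also have "\<dots> = (\<integral>\<^sup>+\<theta>. K \<theta> * indicator {0..<pi / 2} \<theta> \<partial>lborel) + (\<integral>\<^sup>+\<theta>. K \<theta> * indicator {- (pi / 2)<..<0} \<theta> \<partial>lborel)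
       + (\<integral>\<^sup>+\<theta>. K (\<theta> + pi) * indicator {- (pi / 2) <..< pi / 2} \<theta> \<partial>lborel)"
    by (subst nn_integral_add[symmetric], measurable, subst nn_integral_add[symmetric], measurable)
      (auto intro!: nn_integral_cong split: split_indicator)
  also have "(\<integral>\<^sup>+\<theta>. K \<theta> * indicator {- (pi / 2)<..<0} \<theta> \<partial>lborel) = (\<integral>\<^sup>+\<theta>. K \<theta> * indicator {3 * pi / 2<..<2 * pi} \<theta> \<partial>lborel)"
    by (subst (2) nn_integral_shift[of _ "2 * pi", symmetric])
      (auto simp: K_shift(2) add.commute[of "2 * pi"] intro!: nn_integral_cong split: split_indicator)
  also have "(\<integral>\<^sup>+\<theta>. K (\<theta> + pi) * indicator {- (pi / 2) <..< pi / 2} \<theta> \<partial>lborel) = (\<integral>\<^sup>+\<theta>. K \<theta> * indicator {pi / 2<..<3 * pi / 2} \<theta> \<partial>lborel)"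
    by (subst (2) nn_integral_shift[of _ pi, symmetric])
      (auto simp: add.commute[of pi] intro!: nn_integral_cong split: split_indicator)
  also have "(\<integral>\<^sup>+\<theta>. K \<theta> * indicator {0..<pi / 2} \<theta> \<partial>lborel) + (\<integral>\<^sup>+\<theta>. K \<theta> * indicator {3 * pi / 2<..<2 * pi} \<theta> \<partial>lborel) + \<dots>
      = (\<integral>\<^sup>+\<theta>. indicator {0..<2 * pi} \<theta> * K \<theta> \<partial>lborel)"
    by (subst nn_integral_add[symmetric], measurable, subst nn_integral_add[symmetric], measurable, intro nn_integral_cong_AE)
      (use AE_lborel_singleton[of "pi / 2"] AE_lborel_singleton[of "3 * pi / 2"] in eventually_elim,
        auto split: split_indicator)
  also have "\<dots> = (\<integral>\<^sup>+\<theta>. \<integral>\<^sup>+r. indicator {0..<2 * pi} \<theta> * ?w r * f (of_real r * iexp \<theta>) \<partial>lborel \<partial>lborel)"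
    by (simp add: K_def nn_integral_cmult[symmetric] mult.assoc)
  finally show ?thesis .
qed

text \<open>The Jacobian \<open>r\<close> restricted to the angles in \<open>[0, 2 * \<pi>)\<close> and the positive radii, on which polar
coordinates are injective.\<close>

definition polar_weight :: "real \<Rightarrow> real \<Rightarrow> ennreal" where
  "polar_weight \<theta> r = indicator {0..<2 * pi} \<theta> * (indicator {0<..} r * ennreal r)"

lemma borel_measurable_polar_weight [measurable]:
  "(\<lambda>x. polar_weight (f x) (g x)) \<in> borel_measurable M"
  if [measurable]: "f \<in> borel_measurable M" "g \<in> borel_measurable M"
  unfolding polar_weight_def by measurable

text \<open>Induction on the set of coordinates: the plane formula is applied to the new coordinate, and its angle
integral is then moved outside the radial integrals of the others.\<close>

lemma nn_integral_PiM_polar: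
  fixes F :: "('i \<Rightarrow> complex) \<Rightarrow> ennreal"
  assumes "finite J" and "F \<in> borel_measurable (\<Pi>\<^sub>M i\<in>J. lborel)"
  shows "(\<integral>\<^sup>+x. F x \<partial>(\<Pi>\<^sub>M i\<in>J. lborel))
    = (\<integral>\<^sup>+\<theta>. \<integral>\<^sup>+r. (\<Prod>i\<in>J. polar_weight (\<theta> i) (r i)) * F (\<lambda>i\<in>J. of_real (r i) * iexp (\<theta> i))
        \<partial>(\<Pi>\<^sub>M i\<in>J. lborel) \<partial>(\<Pi>\<^sub>M i\<in>J. lborel))"
  using assms
proof (induction J arbitrary: F rule: finite_induct)
  case empty
  interpret C: product_sigma_finite "\<lambda>_::'i. lborel :: complex measure" ..
  interpret R: product_sigma_finite "\<lambda>_::'i. lborel :: real measure" ..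
  show ?case by (simp add: C.nn_integral_empty R.nn_integral_empty restrict_def space_PiM_empty)
next
  case (insert k J)
  interpret C: product_sigma_finite "\<lambda>_::'i. lborel :: complex measure" ..
  interpret R: product_sigma_finite "\<lambda>_::'i. lborel :: real measure" ..
  note insert.prems[measurable]
  let ?C = "\<lambda>J. (\<Pi>\<^sub>M i\<in>(J::'i set). (lborel :: complex measure))"
  let ?R = "\<lambda>J. (\<Pi>\<^sub>M i\<in>(J::'i set). (lborel :: real measure))"
  interpret RJ: sigma_finite_measure "?R J" using insert.hyps by (intro R.sigma_finite)
  interpret pair_sigma_finite "?R J" "lborel :: real measure" ..
  let ?p = "\<lambda>J \<theta> r. (\<lambda>i\<in>J. of_real (r i) * iexp (\<theta> i)) :: 'i \<Rightarrow> complex"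
  let ?G = "\<lambda>x. \<integral>\<^sup>+\<theta>. \<integral>\<^sup>+r. polar_weight \<theta> r * F (x(k := of_real r * iexp \<theta>)) \<partial>lborel \<partial>lborel"
  let ?I = "\<lambda>\<theta> r. (\<Prod>i\<in>insert k J. polar_weight (\<theta> i) (r i)) * F (?p (insert k J) \<theta> r)"
  have upd: "(?p J \<theta> r)(k := of_real r' * iexp \<theta>') = ?p (insert k J) (\<theta>(k := \<theta>')) (r(k := r'))"
    for \<theta> r \<theta>' r' using insert.hyps by (auto simp: fun_eq_iff)
  have pw: "(\<Prod>i\<in>insert k J. polar_weight ((\<theta>(k := \<theta>')) i) ((r(k := r')) i))
      = polar_weight \<theta>' r' * (\<Prod>i\<in>J. polar_weight (\<theta> i) (r i))" for \<theta> \<theta>' r r'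
  proof -
    have "(\<Prod>i\<in>J. polar_weight ((\<theta>(k := \<theta>')) i) ((r(k := r')) i)) = (\<Prod>i\<in>J. polar_weight (\<theta> i) (r i))"
      using insert.hyps by (intro prod.cong) auto
    then show ?thesis using insert.hyps by (simp del: fun_upd_apply) simp
  qed
  have [measurable]: "(\<lambda>(\<theta>, r). ?p (insert k J) \<theta> r) \<in> ?R (insert k J) \<Otimes>\<^sub>M ?R (insert k J) \<rightarrow>\<^sub>M ?C (insert k J)"
    unfolding split_beta' by (intro measurable_restrict) measurable
  have F': "(\<integral>\<^sup>+y. F (x(k := y)) \<partial>lborel) = ?G x" if x: "x \<in> space (?C J)" for x
  proof -
    have [measurable]: "(\<lambda>y. x(k := y)) \<in> lborel \<rightarrow>\<^sub>M ?C (insert k J)"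
      using x insert.hyps by (intro measurable_fun_upd[where J = J]) auto
    show ?thesis
      by (subst nn_integral_lborel_polar) (simp_all add: polar_weight_def)
  qed
  have "(\<integral>\<^sup>+x. F x \<partial>?C (insert k J)) = (\<integral>\<^sup>+x. \<integral>\<^sup>+y. F (x(k := y)) \<partial>lborel \<partial>?C J)"
    using insert.hyps by (intro C.product_nn_integral_insert) auto
  also have "\<dots> = (\<integral>\<^sup>+x. ?G x \<partial>?C J)"
    by (intro nn_integral_cong F')
  also have "\<dots> = (\<integral>\<^sup>+\<theta>. \<integral>\<^sup>+r. (\<Prod>i\<in>J. polar_weight (\<theta> i) (r i)) * ?G (?p J \<theta> r) \<partial>?R J \<partial>?R J)"
    by (rule insert.IH) measurable
  also have "\<dots> = (\<integral>\<^sup>+\<theta>. \<integral>\<^sup>+\<theta>'. \<integral>\<^sup>+r. \<integral>\<^sup>+r'.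
      ?I (\<theta>(k := \<theta>')) (r(k := r'))
      \<partial>lborel \<partial>?R J \<partial>lborel \<partial>?R J)"
  proof (intro nn_integral_cong)
    fix \<theta>
    have "(\<integral>\<^sup>+r. (\<Prod>i\<in>J. polar_weight (\<theta> i) (r i)) * ?G (?p J \<theta> r) \<partial>?R J)
      = (\<integral>\<^sup>+r. \<integral>\<^sup>+\<theta>'. \<integral>\<^sup>+r'.
      ?I (\<theta>(k := \<theta>')) (r(k := r'))
      \<partial>lborel \<partial>lborel \<partial>?R J)"
      unfolding pw upd[symmetric]
      by (simp add: nn_integral_cmult[symmetric] mult_ac)
    also have "\<dots> = (\<integral>\<^sup>+\<theta>'. \<integral>\<^sup>+r. \<integral>\<^sup>+r'.
      ?I (\<theta>(k := \<theta>')) (r(k := r'))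
      \<partial>lborel \<partial>?R J \<partial>lborel)"
      unfolding pw upd[symmetric] by (rule Fubini'[symmetric]) measurable
    finally show "(\<integral>\<^sup>+r. (\<Prod>i\<in>J. polar_weight (\<theta> i) (r i)) * ?G (?p J \<theta> r) \<partial>?R J) = \<dots>" .
  qed
  also have "\<dots> = (\<integral>\<^sup>+\<theta>. \<integral>\<^sup>+\<theta>'. \<integral>\<^sup>+r.
      ?I (\<theta>(k := \<theta>')) r
      \<partial>?R (insert k J) \<partial>lborel \<partial>?R J)"
  proof (intro nn_integral_cong)
    fix \<theta> \<theta>' assume [measurable]: "\<theta> \<in> space (?R J)"
    have [measurable]: "\<theta>(k := \<theta>') \<in> space (?R (insert k J))"
      using \<open>\<theta> \<in> space (?R J)\<close> by (auto simp: space_PiM PiE_def extensional_def)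
    show "(\<integral>\<^sup>+r. \<integral>\<^sup>+r'.
      ?I (\<theta>(k := \<theta>')) (r(k := r'))
      \<partial>lborel \<partial>?R J) = (\<integral>\<^sup>+r.
      ?I (\<theta>(k := \<theta>')) r
      \<partial>?R (insert k J))"
      using insert.hyps by (intro R.product_nn_integral_insert[symmetric]) measurable
  qed
  also have "\<dots> = (\<integral>\<^sup>+\<theta>. \<integral>\<^sup>+r. ?I \<theta> r
      \<partial>?R (insert k J) \<partial>?R (insert k J))"
  proof -
    interpret RI: sigma_finite_measure "?R (insert k J)" using insert.hyps by (intro R.sigma_finite) auto
    show ?thesis
      using insert.hyps by (intro R.product_nn_integral_insert[symmetric]) measurable
  qed
  finally show ?case .
qed

section \<open>Whitening a positive definite Hermitian matrix\<close>

text \<open>Conjugate linear in the first argument, so that its real part is the real inner product and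
\<open>hermitian_form A v\<close> is \<open>cdot v (A *v v)\<close>.\<close>

definition cdot :: "complex ^ 'n \<Rightarrow> complex ^ 'n \<Rightarrow> complex" where
  "cdot u v = (\<Sum>i\<in>UNIV. cnj (u $ i) * v $ i)"

definition conj_transpose :: "complex ^ 'n ^ 'm \<Rightarrow> complex ^ 'm ^ 'n" where
  "conj_transpose A = (\<chi> i j. cnj (A $ j $ i))"

lemma hermitian_form_cdot: "hermitian_form A v = cdot v (A *v v)"
  by (simp add: hermitian_form_def cdot_def)

lemma inner_eq_Re_cdot: "u \<bullet> v = Re (cdot u v)"
  by (simp add: inner_vec_def inner_complex_def cdot_def)

lemma cdot_self: "cdot v v = complex_of_real ((norm v)\<^sup>2)"
proof -
  have "cdot v v = (\<Sum>i\<in>UNIV. complex_of_real ((norm (v $ i))\<^sup>2))"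
    unfolding cdot_def by (intro sum.cong refl) (simp add: complex_norm_square mult.commute del: of_real_power)
  also have "\<dots> = complex_of_real ((norm v)\<^sup>2)"
    by (simp add: norm_vec_def L2_set_def sum_nonneg)
  finally show ?thesis .
qed

lemma cnj_cdot: "cnj (cdot u v) = cdot v u"
  by (simp add: cdot_def mult.commute)

lemma cdot_matrix: "cdot u (A *v w) = cdot (conj_transpose A *v u) w"
proof -
  have "cdot u (A *v w) = (\<Sum>i\<in>UNIV. \<Sum>j\<in>UNIV. cnj (u $ i) * (A $ i $ j * w $ j))"
    by (simp add: cdot_def matrix_vector_mult_def sum_distrib_left)
  also have "\<dots> = (\<Sum>j\<in>UNIV. \<Sum>i\<in>UNIV. cnj (u $ i) * (A $ i $ j * w $ j))"
    by (rule sum.swap)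
  also have "\<dots> = cdot (conj_transpose A *v u) w"
    by (simp add: cdot_def conj_transpose_def matrix_vector_mult_def sum_distrib_left sum_distrib_right mult_ac)
  finally show ?thesis .
qed

lemma conj_transpose_mul: "conj_transpose (A ** B) = conj_transpose B ** conj_transpose A"
  by (simp add: conj_transpose_def matrix_matrix_mult_def vec_eq_iff mult.commute)

lemma conj_transpose_conj_transpose [simp]: "conj_transpose (conj_transpose A) = A"
  by (simp add: conj_transpose_def vec_eq_iff)

lemma conj_transpose_nth: "conj_transpose A $ i $ j = cnj (A $ j $ i)"
  by (simp add: conj_transpose_def)

lemma det_conj_transpose: "det (conj_transpose A) = cnj (det A)"
proof -
  have "conj_transpose A = transpose (\<chi> i j. cnj (A $ i $ j))"
    by (simp add: conj_transpose_def transpose_def vec_eq_iff)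
  then have "det (conj_transpose A) = det (\<chi> i j. cnj (A $ i $ j))"
    by (simp add: det_transpose)
  also have "\<dots> = cnj (det A)"
    by (simp add: det_def)
  finally show ?thesis .
qed

text \<open>Every permutation other than the identity moves some index \<open>i \<noteq> k\<close>, and row \<open>i\<close> of the matrix is a
row of the identity matrix.\<close>

lemma det_row_matrix: "det (row_matrix k e) = e k"
proof -
  let ?A = "row_matrix k e"
  have zero: "of_int (sign p) * (\<Prod>i\<in>UNIV. ?A $ i $ p i) = 0"
    if p: "p permutes UNIV" "p \<noteq> id" for p
  proof -
    have "\<exists>i. i \<noteq> k \<and> p i \<noteq> i"
    proof (rule ccontr)
      assume "\<not> (\<exists>i. i \<noteq> k \<and> p i \<noteq> i)"
      then have fixp: "p i = i" if "i \<noteq> k" for i using that by blast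
      have "p k = k"
      proof (rule ccontr)
        assume "p k \<noteq> k"
        then have "p (p k) = p k" by (rule fixp)
        then show False using injD[OF permutes_inj[OF p(1)]] \<open>p k \<noteq> k\<close> by blast
      qed
      then have "p i = i" for i using fixp by (cases "i = k") auto
      then show False using p(2) by (simp add: fun_eq_iff)
    qed
    then obtain i where "i \<noteq> k" "p i \<noteq> i" by blast
    then have "?A $ i $ p i = 0" by (simp add: row_matrix_def)
    then have "(\<Prod>i\<in>UNIV. ?A $ i $ p i) = 0" by (intro prod_zero) auto
    then show ?thesis by simp
  qed
  have "det ?A = (\<Sum>p\<in>{id}. of_int (sign p) * (\<Prod>i\<in>UNIV. ?A $ i $ p i))"
    unfolding det_def
    by (intro sum.mono_neutral_right) (auto simp: permutes_id zero)
  also have "\<dots> = (\<Prod>i\<in>UNIV. if i = k then e k else 1)"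
    by (simp add: row_matrix_def if_distrib cong: prod.cong if_cong)
  also have "\<dots> = e k" by (simp add: prod.delta)
  finally show ?thesis .
qed

text \<open>The determinant of a complex-linear map, viewed as a real-linear map, is the squared modulus of its
complex determinant. The property passes to products, and \<open>nn_integral_row_matrix\<close> provides the
factors.\<close>

definition scales_lborel :: "complex ^ 'n ^ 'n \<Rightarrow> bool" where
  "scales_lborel A \<longleftrightarrow> det A \<noteq> 0 \<and>
     (\<forall>f\<in>borel_measurable borel. (\<integral>\<^sup>+w. f w \<partial>lborel) = ennreal ((cmod (det A))\<^sup>2) * (\<integral>\<^sup>+w. f (A *v w) \<partial>lborel))"

lemma det_scales_lborel: "scales_lborel A \<Longrightarrow> det A \<noteq> 0"
  unfolding scales_lborel_def by blast

lemma nn_integral_scales_lborel: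
  assumes "scales_lborel A" "f \<in> borel_measurable borel"
  shows "(\<integral>\<^sup>+w. f w \<partial>lborel) = ennreal ((cmod (det A))\<^sup>2) * (\<integral>\<^sup>+w. f (A *v w) \<partial>lborel)"
  using assms unfolding scales_lborel_def by blast

lemma scales_lborel_mult:
  fixes A B :: "complex ^ 'n ^ 'n"
  assumes "scales_lborel A" "scales_lborel B"
  shows "scales_lborel (A ** B)"
  unfolding scales_lborel_def
proof (intro conjI ballI)
  show "det (A ** B) \<noteq> 0" using assms[THEN det_scales_lborel] by (simp add: det_mul)
  fix f :: "complex ^ 'n \<Rightarrow> ennreal" assume f [measurable]: "f \<in> borel_measurable borel"
  have m: "(\<lambda>w. f (A *v w)) \<in> borel_measurable borel" by measurable
  have "(\<integral>\<^sup>+w. f w \<partial>lborel) = ennreal ((cmod (det A))\<^sup>2) * (\<integral>\<^sup>+w. f (A *v w) \<partial>lborel)"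
    by (rule nn_integral_scales_lborel[OF assms(1) f])
  also have "(\<integral>\<^sup>+w. f (A *v w) \<partial>lborel) = ennreal ((cmod (det B))\<^sup>2) * (\<integral>\<^sup>+w. f (A *v (B *v w)) \<partial>lborel)"
    by (rule nn_integral_scales_lborel[OF assms(2) m])
  finally show "(\<integral>\<^sup>+w. f w \<partial>lborel) = ennreal ((cmod (det (A ** B)))\<^sup>2) * (\<integral>\<^sup>+w. f ((A ** B) *v w) \<partial>lborel)"
    by (simp add: det_mul norm_mult power_mult_distrib ennreal_mult matrix_vector_mul_assoc mult.assoc)
qed

lemma scales_lborel_row_matrix:
  assumes "0 < a" "e k = complex_of_real a"
  shows "scales_lborel (row_matrix k e)"
  using assms by (auto simp: scales_lborel_def det_row_matrix intro!: nn_integral_row_matrix)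

lemma scales_lborel_1: "scales_lborel (mat 1)"
  by (simp add: scales_lborel_def)

lemma row_matrix_mult_left:
  "(row_matrix k e ** X) $ i $ j = (if i = k then (\<Sum>l\<in>UNIV. e l * X $ l $ j) else X $ i $ j)"
  by (auto simp: row_matrix_def matrix_matrix_mult_def if_distrib[of "\<lambda>x. x * _"] cong: if_cong)

lemma row_matrix_mult_right:
  "(X ** conj_transpose (row_matrix k e)) $ i $ j
    = (if j = k then (\<Sum>l\<in>UNIV. X $ i $ l * cnj (e l)) else X $ i $ j)"
  by (auto simp: row_matrix_def conj_transpose_def matrix_matrix_mult_def if_distrib[of cnj] if_distrib[of "\<lambda>x. _ * x"] cong: if_cong)

text \<open>The Gram-Schmidt process for the form \<open>\<Gamma>\<close>, adding one index at a time. In terms of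
\<open>G = B \<Gamma> B*\<close>, the new row subtracts from row \<open>k\<close> its components along the rows in \<open>S\<close>, which are already
orthonormal, and divides by the length \<open>sqrt g\<close> of what remains. Positive definiteness gives \<open>0 < g\<close>.\<close>

lemma whitening_matrix_on:
  fixes \<Gamma> :: "complex ^ 'n ^ 'n"
  assumes herm: "conj_transpose \<Gamma> = \<Gamma>"
    and pos: "\<And>v. v \<noteq> 0 \<Longrightarrow> 0 < Re (hermitian_form \<Gamma> v)"
    and "finite S"
  shows "\<exists>B. scales_lborel B \<and> (\<forall>i\<in>S. \<forall>j\<in>S. (B ** \<Gamma> ** conj_transpose B) $ i $ j = (if i = j then 1 else 0))"
  using \<open>finite S\<close>
proof (induction S rule: finite_induct)
  case empty
  show ?case using scales_lborel_1 by auto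
next
  case (insert k S)
  then obtain B where B: "scales_lborel B"
    and ortho: "\<And>i j. i \<in> S \<Longrightarrow> j \<in> S \<Longrightarrow> (B ** \<Gamma> ** conj_transpose B) $ i $ j = (if i = j then 1 else 0)"
    by blast
  define G where "G = B ** \<Gamma> ** conj_transpose B"
  have G_herm: "conj_transpose G = G"
    unfolding G_def by (simp add: conj_transpose_mul herm matrix_mul_assoc)
  have G_cnj: "cnj (G $ i $ j) = G $ j $ i" for i j
    using arg_cong[OF G_herm, of "\<lambda>A. A $ j $ i"] by (simp add: conj_transpose_def)
  \<comment> \<open>Row \<open>k\<close> minus its components along the rows in \<open>S\<close>, as coefficients with respect to the rows of \<open>B\<close>.\<close>
  define e where "e j = (if j = k then 1 else if j \<in> S then - G $ k $ j else 0)" for j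
  define x where "x = (\<chi> j. cnj (e j))"
  define g where "g = Re (cdot x (G *v x))"
  have form: "cdot x (G *v x) = hermitian_form \<Gamma> (conj_transpose B *v x)"
    unfolding G_def hermitian_form_cdot
    by (simp add: matrix_vector_mul_assoc[symmetric] cdot_matrix[of _ B])
  have "x $ k \<noteq> 0" by (simp add: x_def e_def)
  then have "x \<noteq> 0" by auto
  have "det (conj_transpose B) \<noteq> 0"
    using det_scales_lborel[OF B] by (simp add: det_conj_transpose)
  then have "\<exists>B'. B' ** conj_transpose B = mat 1"
    by (simp add: invertible_left_inverse[symmetric] invertible_det_nz)
  then have "\<forall>x. conj_transpose B *v x = 0 \<longrightarrow> x = 0"
    by (simp only: matrix_left_invertible_ker)
  then have "conj_transpose B *v x \<noteq> 0" using \<open>x \<noteq> 0\<close> by blast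
  then have g: "0 < g" unfolding g_def form by (rule pos)
  have "cnj (cdot x (G *v x)) = cdot x (G *v x)"
    by (subst cdot_matrix) (simp add: G_herm cnj_cdot)
  moreover have real: "z = complex_of_real (Re z)" if "cnj z = z" for z
    using that by (simp add: complex_eq_iff)
  ultimately have g_eq: "cdot x (G *v x) = complex_of_real g"
    unfolding g_def using real by simp
  have g_sum: "cdot x (G *v x) = (\<Sum>l\<in>UNIV. (\<Sum>m\<in>UNIV. e m * G $ m $ l) * cnj (e l))"
  proof -
    have "cdot x (G *v x) = cdot (G *v x) x" by (subst cdot_matrix) (simp add: G_herm)
    also have "\<dots> = (\<Sum>l\<in>UNIV. (\<Sum>m\<in>UNIV. e m * G $ m $ l) * cnj (e l))"
      by (simp add: cdot_def x_def matrix_vector_mult_def G_cnj mult.commute)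
    finally show ?thesis .
  qed
  have orth_k: "(\<Sum>m\<in>UNIV. e m * G $ m $ j) = 0" if j: "j \<in> S" for j
  proof -
    have "(\<Sum>m\<in>UNIV. e m * G $ m $ j) = (\<Sum>m\<in>insert k S. e m * G $ m $ j)"
      by (rule sum.mono_neutral_right) (auto simp: e_def)
    also have "\<dots> = G $ k $ j + (\<Sum>m\<in>S. e m * G $ m $ j)"
      using insert.hyps by (simp add: e_def)
    also have "(\<Sum>m\<in>S. e m * G $ m $ j) = (\<Sum>m\<in>S. if m = j then - G $ k $ j else 0)"
      using insert.hyps ortho j unfolding G_def[symmetric] by (intro sum.cong refl) (auto simp: e_def)
    also have "\<dots> = - G $ k $ j" using j insert.hyps by (simp add: sum.delta)
    finally show ?thesis by simp
  qed
  define a where "a = 1 / sqrt g"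
  have a: "0 < a" "complex_of_real a * complex_of_real a * complex_of_real g = 1"
  proof -
    have "a * a * g = 1" using g by (simp add: a_def field_simps)
    then show "complex_of_real a * complex_of_real a * complex_of_real g = 1"
      by (simp only: of_real_mult[symmetric] of_real_1)
  qed (use g in \<open>simp add: a_def\<close>)
  define E where "E = row_matrix k (\<lambda>j. of_real a * e j)"
  have scal: "scales_lborel (E ** B)"
    unfolding E_def using a by (intro scales_lborel_mult scales_lborel_row_matrix[of a] B) (auto simp: e_def)
  have conj: "E ** B ** \<Gamma> ** conj_transpose (E ** B) = E ** G ** conj_transpose E"
    by (simp add: G_def conj_transpose_mul matrix_mul_assoc)
  have EG: "(E ** G) $ i $ j = (if i = k then of_real a * (\<Sum>l\<in>UNIV. e l * G $ l $ j) else G $ i $ j)" for i j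
    by (simp add: E_def row_matrix_mult_left sum_distrib_left mult.assoc)
  have EGE: "(E ** G ** conj_transpose E) $ i $ j
     = (if j = k then of_real a * (\<Sum>l\<in>UNIV. (E ** G) $ i $ l * cnj (e l)) else (E ** G) $ i $ j)" for i j
    by (simp add: E_def row_matrix_mult_right sum_distrib_left mult_ac)
  have kk: "(E ** G ** conj_transpose E) $ k $ k = 1"
  proof -
    have "(E ** G ** conj_transpose E) $ k $ k = of_real a * (\<Sum>l\<in>UNIV. (of_real a * (\<Sum>m\<in>UNIV. e m * G $ m $ l)) * cnj (e l))"
      by (simp add: EGE EG)
    also have "\<dots> = of_real a * of_real a * cdot x (G *v x)"
      by (simp add: g_sum sum_distrib_left[symmetric] mult.assoc)
    finally show ?thesis using a by (simp add: g_eq)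
  qed
  have kj: "(E ** G ** conj_transpose E) $ k $ j = 0" "(E ** G ** conj_transpose E) $ j $ k = 0"
    if j: "j \<in> S" for j
  proof -
    have "j \<noteq> k" using j insert.hyps by auto
    then show *: "(E ** G ** conj_transpose E) $ k $ j = 0"
      using orth_k[OF j] by (simp add: EGE EG)
    have "E ** G ** conj_transpose E = conj_transpose (E ** G ** conj_transpose E)"
      by (simp add: conj_transpose_mul G_herm matrix_mul_assoc)
    from arg_cong[OF this, of "\<lambda>A. A $ j $ k"]
    have "(E ** G ** conj_transpose E) $ j $ k = cnj ((E ** G ** conj_transpose E) $ k $ j)"
      by (simp only: conj_transpose_nth)
    then show "(E ** G ** conj_transpose E) $ j $ k = 0" by (simp add: *)
  qed
  have ij: "(E ** G ** conj_transpose E) $ i $ j = (if i = j then 1 else 0)" if "i \<in> S" "j \<in> S" for i j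
  proof -
    have "i \<noteq> k" "j \<noteq> k" using that insert.hyps by auto
    then show ?thesis using ortho[OF that] unfolding G_def[symmetric] by (simp add: EGE EG)
  qed
  show ?case
  proof (intro exI[of _ "E ** B"] conjI ballI scal)
    fix i j assume "i \<in> insert k S" "j \<in> insert k S"
    then consider "i = k" "j = k" | "i = k" "j \<in> S" "j \<noteq> k" | "i \<in> S" "j = k" "i \<noteq> k" | "i \<in> S" "j \<in> S"
      using insert.hyps by auto
    then show "(E ** B ** \<Gamma> ** conj_transpose (E ** B)) $ i $ j = (if i = j then 1 else 0)"
      unfolding conj by cases (simp_all add: kk kj ij)
  qed
qed

lemma whitening_matrix:
  fixes \<Gamma> :: "complex ^ 'n ^ 'n"
  assumes "conj_transpose \<Gamma> = \<Gamma>" "\<And>v. v \<noteq> 0 \<Longrightarrow> 0 < Re (hermitian_form \<Gamma> v)"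
  obtains B where "scales_lborel B" "B ** \<Gamma> ** conj_transpose B = mat 1"
proof -
  have "\<exists>B. scales_lborel B \<and> (\<forall>i\<in>UNIV. \<forall>j\<in>UNIV. (B ** \<Gamma> ** conj_transpose B) $ i $ j = (if i = j then 1 else 0))"
    by (rule whitening_matrix_on[OF assms(1)]) (simp_all add: assms(2))
  then obtain B where B: "scales_lborel B"
    and "\<forall>i\<in>UNIV. \<forall>j\<in>UNIV. (B ** \<Gamma> ** conj_transpose B) $ i $ j = (if i = j then 1 else 0)"
    by (elim exE conjE)
  then have *: "(B ** \<Gamma> ** conj_transpose B) $ i $ j = (if i = j then 1 else 0)" for i j
    by (elim ballE) simp_all
  have "B ** \<Gamma> ** conj_transpose B = mat 1"
    unfolding vec_eq_iff * by (simp add: mat_def)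
  with B show ?thesis by (rule that)
qed

text \<open>The second claim rests on \<open>\<Gamma>\<^sup>-\<^sup>1 = B* B\<close>: by \<open>B \<Gamma> B* = 1\<close> the matrix \<open>\<Gamma> B*\<close> is the inverse of
\<open>B\<close>.\<close>

lemma hermitian_form_whitened:
  fixes \<Gamma> :: "complex ^ 'n ^ 'n"
  assumes B: "B ** \<Gamma> ** conj_transpose B = mat 1"
  shows "hermitian_form \<Gamma> (conj_transpose B *v v) = complex_of_real ((norm v)\<^sup>2)"
    and "hermitian_form (matrix_inv \<Gamma>) v = complex_of_real ((norm (B *v v))\<^sup>2)"
    and "(cmod (det B))\<^sup>2 * det \<Gamma> = 1"
proof -
  show "hermitian_form \<Gamma> (conj_transpose B *v v) = complex_of_real ((norm v)\<^sup>2)"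
  proof -
    have "hermitian_form \<Gamma> (conj_transpose B *v v) = cdot v ((B ** \<Gamma> ** conj_transpose B) *v v)"
      unfolding hermitian_form_cdot by (simp add: matrix_vector_mul_assoc[symmetric] cdot_matrix[of v B])
    then show ?thesis by (simp add: B cdot_self)
  qed
  have "B ** (\<Gamma> ** conj_transpose B) = mat 1" using B by (simp add: matrix_mul_assoc)
  from matrix_left_right_inverse1[OF this]
  have r: "\<Gamma> ** (conj_transpose B ** B) = mat 1"
    by (simp add: matrix_mul_assoc)
  then have l: "(conj_transpose B ** B) ** \<Gamma> = mat 1"
    by (rule matrix_left_right_inverse1)
  have "matrix_inv \<Gamma> ** \<Gamma> = mat 1"
    unfolding matrix_inv_def
    by (rule someI2[where a = "conj_transpose B ** B"]) (use l r in simp_all)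
  then have "matrix_inv \<Gamma> ** (\<Gamma> ** (conj_transpose B ** B)) = conj_transpose B ** B"
    by (simp add: matrix_mul_assoc)
  then have "matrix_inv \<Gamma> = conj_transpose B ** B" by (simp add: r)
  then have "hermitian_form (matrix_inv \<Gamma>) v = cdot v (conj_transpose B *v (B *v v))"
    unfolding hermitian_form_cdot by (simp add: matrix_vector_mul_assoc)
  then show "hermitian_form (matrix_inv \<Gamma>) v = complex_of_real ((norm (B *v v))\<^sup>2)"
    by (simp add: cdot_matrix[of v] cdot_self)
  have "det B * det \<Gamma> * cnj (det B) = 1"
    using arg_cong[OF B, of det] by (simp add: det_mul det_conj_transpose)
  then show "(cmod (det B))\<^sup>2 * det \<Gamma> = 1"
    by (simp add: complex_norm_square mult_ac del: of_real_power)
qed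

section \<open>Circular Gaussian vectors and their phases\<close>

text \<open>Expresses the density through the product density with variance \<open>1 / 2\<close> for each of the real and
imaginary parts, the law of the whitened vector.\<close>

lemma complex_gaussian_density_whitened:
  fixes \<Gamma> :: "complex ^ 'n ^ 'n"
  assumes B: "B ** \<Gamma> ** conj_transpose B = mat 1"
  shows "complex_gaussian_density m \<Gamma> w
    = complex_of_real ((cmod (det B))\<^sup>2 * gauss_density (1 / sqrt 2) (B *v (w - m)))"
proof -
  have h: "(cmod (det B))\<^sup>2 * det \<Gamma> = 1" by (rule hermitian_form_whitened(3)[OF B])
  then have "det \<Gamma> \<noteq> 0" by auto
  then have d: "1 / det \<Gamma> = (cmod (det B))\<^sup>2"
    using h by (simp add: divide_eq_eq)
  have s: "2 * pi * (1 / sqrt 2)\<^sup>2 = pi" "2 * (1 / sqrt 2)\<^sup>2 = (1::real)" by (simp_all add: power_divide)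
  have g: "gauss_density (1 / sqrt 2) v = 1 / pi ^ CARD('n) * exp (- (norm v)\<^sup>2)" for v :: "complex ^ 'n"
    unfolding gauss_density_eq s by (simp add: power_mult power_divide power2_eq_square[symmetric] mult.commute[of _ 2])
  have "complex_gaussian_density m \<Gamma> w
      = 1 / complex_of_real (pi ^ CARD('n)) * (1 / det \<Gamma>) * exp (complex_of_real (- (norm (B *v (w - m)))\<^sup>2))"
    unfolding complex_gaussian_density_def hermitian_form_whitened(2)[OF B] by simp
  then show ?thesis
    unfolding d g exp_of_real by simp
qed

text \<open>The vector \<open>B W\<close> has the characteristic function \<open>exp (- \<bar>u\<bar>\<^sup>2 / 4)\<close> of the product density with variance
\<open>1 / 2\<close>, so uniqueness identifies its law. Inverting \<open>B\<close> and translating by \<open>m\<close> gives the density of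
\<open>m + W\<close>.\<close>

lemma circular_gaussian_density:
  fixes W :: "'a \<Rightarrow> complex ^ 'n" and \<Gamma> :: "complex ^ 'n ^ 'n"
  assumes M: "prob_space M" and W [measurable]: "W \<in> borel_measurable M"
    and herm: "conj_transpose \<Gamma> = \<Gamma>" and pos: "\<And>v. v \<noteq> 0 \<Longrightarrow> 0 < Re (hermitian_form \<Gamma> v)"
    and char: "\<And>u. (CLINT \<omega>|M. iexp (u \<bullet> W \<omega>)) = complex_of_real (exp (- Re (hermitian_form \<Gamma> u) / 4))"
  shows "complex_gaussian_density m \<Gamma> w \<in> \<real>\<^sub>\<ge>\<^sub>0"
    and "distributed M lborel (\<lambda>\<omega>. m + W \<omega>) (\<lambda>w. ennreal (Re (complex_gaussian_density m \<Gamma> w)))"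
proof -
  interpret prob_space M by fact
  obtain B where B: "scales_lborel B" "B ** \<Gamma> ** conj_transpose B = mat 1"
    using whitening_matrix[OF herm pos] by blast
  let ?p = "\<lambda>w. Re (complex_gaussian_density m \<Gamma> w)"
  let ?g = "gauss_density (1 / sqrt 2) :: complex ^ 'n \<Rightarrow> real"
  note dens = complex_gaussian_density_whitened[OF B(2), of m]
  show "complex_gaussian_density m \<Gamma> w \<in> \<real>\<^sub>\<ge>\<^sub>0"
    unfolding dens nonneg_Reals_of_real_iff by (intro mult_nonneg_nonneg) auto
  have eq: "distr M borel (\<lambda>\<omega>. B *v W \<omega>) = density lborel (\<lambda>z. ennreal (?g z))"
  proof (rule Levy_uniqueness_euclidean)
    show "prob_space (distr M borel (\<lambda>\<omega>. B *v W \<omega>))" by (rule prob_space_distr) measurable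
    show "prob_space (density lborel (\<lambda>z. ennreal (?g z)))"
      by (rule prob_spaceI) (simp add: emeasure_density nn_integral_gauss_density)
    fix u :: "complex ^ 'n"
    have "(CLINT z|distr M borel (\<lambda>\<omega>. B *v W \<omega>). iexp (u \<bullet> z)) = (CLINT \<omega>|M. iexp (u \<bullet> (B *v W \<omega>)))"
      by (rule integral_distr) measurable
    also have "\<dots> = (CLINT \<omega>|M. iexp ((conj_transpose B *v u) \<bullet> W \<omega>))"
      unfolding inner_eq_Re_cdot cdot_matrix[of u B] ..
    also have "\<dots> = complex_of_real (exp (- (norm u)\<^sup>2 / 4))"
      unfolding char hermitian_form_whitened(1)[OF B(2)] by simp
    also have "\<dots> = (CLINT z|lborel. ?g z * iexp (u \<bullet> z))"
      by (subst char_gauss_density) (simp_all add: power_divide)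
    also have "\<dots> = (CLINT z|density lborel (\<lambda>z. ennreal (?g z)). iexp (u \<bullet> z))"
      by (subst integral_density) (simp_all add: scaleR_conv_of_real)
    finally show "(CLINT z|distr M borel (\<lambda>\<omega>. B *v W \<omega>). iexp (u \<bullet> z)) = \<dots>" .
  qed simp_all
  have det: "det B \<noteq> 0" using B(1) by (rule det_scales_lborel)
  then obtain B' where B': "B' ** B = mat 1"
    using invertible_det_nz[of B] by (auto simp: invertible_def)
  have BB: "B' *v (B *v v) = v" for v by (simp add: matrix_vector_mul_assoc B')
  show "distributed M lborel (\<lambda>\<omega>. m + W \<omega>) (\<lambda>w. ennreal (?p w))"
    unfolding distributed_def
  proof (intro conjI measure_eqI)
    show "(\<lambda>w. ennreal (?p w)) \<in> borel_measurable lborel"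
      unfolding dens by simp
    fix A :: "(complex ^ 'n) set" assume "A \<in> sets (distr M lborel (\<lambda>\<omega>. m + W \<omega>))"
    then have [measurable]: "A \<in> sets borel" by simp
    have "emeasure (distr M lborel (\<lambda>\<omega>. m + W \<omega>)) A = (\<integral>\<^sup>+\<omega>. indicator A (m + W \<omega>) \<partial>M)"
      by (subst nn_integral_indicator[symmetric], simp, subst nn_integral_distr) auto
    also have "\<dots> = (\<integral>\<^sup>+\<omega>. indicator A (m + B' *v (B *v W \<omega>)) \<partial>M)"
      unfolding BB ..
    also have "\<dots> = (\<integral>\<^sup>+z. indicator A (m + B' *v z) \<partial>distr M borel (\<lambda>\<omega>. B *v W \<omega>))"
      by (subst nn_integral_distr) auto
    also have "\<dots> = (\<integral>\<^sup>+z. ennreal (?g z) * indicator A (m + B' *v z) \<partial>lborel)"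
      unfolding eq by (subst nn_integral_density) auto
    also have "\<dots> = ennreal ((cmod (det B))\<^sup>2) * (\<integral>\<^sup>+v. ennreal (?g (B *v v)) * indicator A (m + B' *v (B *v v)) \<partial>lborel)"
      by (rule nn_integral_scales_lborel[OF B(1)]) measurable
    also have "\<dots> = (\<integral>\<^sup>+v. ennreal ((cmod (det B))\<^sup>2) * (ennreal (?g (B *v v)) * indicator A (m + v)) \<partial>lborel)"
      unfolding BB by (rule nn_integral_cmult[symmetric]) measurable
    also have "\<dots> = (\<integral>\<^sup>+v. ennreal (?p (m + 1 *\<^sub>R v)) * indicator A (m + 1 *\<^sub>R v) \<partial>lborel)"
      unfolding dens by (simp add: ennreal_mult mult.assoc)
    also have "\<dots> = (\<integral>\<^sup>+w. ennreal (?p w) * indicator A w \<partial>lborel)"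
      by (subst (2) nn_integral_lborel_affine[of _ 1 m]) (auto simp: dens)
    also have "\<dots> = emeasure (density lborel (\<lambda>w. ennreal (?p w))) A"
      by (subst emeasure_density) (auto simp: dens)
    finally show "emeasure (distr M lborel (\<lambda>\<omega>. m + W \<omega>)) A = \<dots>" .
  qed simp_all
qed

lemma borel_measurable_polar_vector [measurable]:
  "(\<lambda>(\<theta>, r). polar_vector r \<theta>) \<in> borel \<Otimes>\<^sub>M borel \<rightarrow>\<^sub>M (borel :: (complex ^ 'n) measure)"
  unfolding borel_measurable_euclidean_space[where 'c = "complex ^ 'n"]
  by (auto simp: Basis_vec_def inner_axis polar_vector_def split_beta')

lemma nn_integral_lborel_vec_polar:
  fixes f :: "complex ^ 'n \<Rightarrow> ennreal"
  assumes [measurable]: "f \<in> borel_measurable borel"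
  shows "(\<integral>\<^sup>+w. f w \<partial>lborel) = (\<integral>\<^sup>+\<theta>. \<integral>\<^sup>+r. (\<Prod>i\<in>UNIV. polar_weight (\<theta> $ i) (r $ i)) * f (polar_vector r \<theta>) \<partial>lborel \<partial>lborel)"
proof -
  have p: "vec_lambda (\<lambda>i\<in>UNIV. of_real (r i) * iexp (\<theta> i)) = polar_vector (vec_lambda r) (vec_lambda \<theta>)"
    for r \<theta> :: "'n \<Rightarrow> real"
    by (simp add: polar_vector_def restrict_UNIV)
  let ?g = "\<lambda>\<theta> r. (\<Prod>i\<in>UNIV. polar_weight (\<theta> $ i) (r $ i)) * f (polar_vector r \<theta>)"
  have "(\<integral>\<^sup>+\<theta>. \<integral>\<^sup>+r. ?g \<theta> r \<partial>lborel \<partial>lborel)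
      = (\<integral>\<^sup>+\<theta>. \<integral>\<^sup>+r. ?g (vec_lambda \<theta>) r \<partial>lborel \<partial>(\<Pi>\<^sub>M i\<in>UNIV. lborel))"
    by (rule nn_integral_lborel_vec) measurable
  also have "\<dots> = (\<integral>\<^sup>+\<theta>. \<integral>\<^sup>+r. ?g (vec_lambda \<theta>) (vec_lambda r) \<partial>(\<Pi>\<^sub>M i\<in>UNIV. lborel) \<partial>(\<Pi>\<^sub>M i\<in>UNIV. lborel))"
    by (intro nn_integral_cong nn_integral_lborel_vec) measurable
  also have "\<dots> = (\<integral>\<^sup>+w. f w \<partial>lborel)"
    by (simp add: nn_integral_lborel_vec nn_integral_PiM_polar p)
  finally show ?thesis ..
qed

lemma phase_polar_vector:
  assumes "(\<Prod>i\<in>UNIV. polar_weight (\<theta> $ i) (r $ i)) \<noteq> 0"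
  shows "phase_vector (polar_vector r \<theta>) = \<theta>"
proof -
  have "polar_weight (\<theta> $ i) (r $ i) \<noteq> 0" for i
    using assms by auto
  then have "0 < r $ i" "0 \<le> \<theta> $ i" "\<theta> $ i < 2 * pi" for i
    by (auto simp: polar_weight_def indicator_def split: if_splits)
  then show ?thesis
    by (auto simp: phase_vector_def polar_vector_def vec_eq_iff intro!: Arg2pi_unique)
qed

lemma borel_measurable_Arg2pi [measurable]: "Arg2pi \<in> borel_measurable borel"
  unfolding borel_measurable_iff_le by (auto intro: borel_closed closed_Arg2pi2pi_le)

lemma borel_measurable_phase_vector [measurable]:
  "(phase_vector :: complex ^ 'n \<Rightarrow> real ^ 'n) \<in> borel_measurable borel"
  unfolding borel_measurable_euclidean_space[where 'c = "real ^ 'n"]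
  by (auto simp: Basis_vec_def inner_axis phase_vector_def)

text \<open>Polar coordinates are substituted in the probability that the phases lie in a given set. Where the
weight does not vanish, the phases of a polar vector are its angles (\<open>phase_polar_vector\<close>); this excludes
the origin, where the argument is a convention.\<close>

lemma distributed_phase_vector:
  fixes W :: "'a \<Rightarrow> complex ^ 'n"
  assumes "distributed M lborel W p"
  shows "distributed M lborel (\<lambda>\<omega>. phase_vector (W \<omega>))
    (\<lambda>\<theta>. \<integral>\<^sup>+r. (\<Prod>i\<in>UNIV. polar_weight (\<theta> $ i) (r $ i)) * p (polar_vector r \<theta>) \<partial>lborel)"
proof -
  have p [measurable]: "p \<in> borel_measurable borel" and W [measurable]: "W \<in> borel_measurable M"
    and WM: "W \<in> measurable M lborel"
    using distributed_borel_measurable[OF assms] distributed_measurable[OF assms] by simp_all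
  let ?w = "\<lambda>\<theta> r :: real ^ 'n. \<Prod>i\<in>UNIV. polar_weight (\<theta> $ i) (r $ i)"
  let ?q = "\<lambda>\<theta>. \<integral>\<^sup>+r. ?w \<theta> r * p (polar_vector r \<theta>) \<partial>lborel"
  show ?thesis
    unfolding distributed_def
  proof (intro conjI measure_eqI)
    show q: "?q \<in> borel_measurable lborel" by measurable
    show "(\<lambda>\<omega>. phase_vector (W \<omega>)) \<in> M \<rightarrow>\<^sub>M lborel" by measurable
    fix A :: "(real ^ 'n) set" assume "A \<in> sets (distr M lborel (\<lambda>\<omega>. phase_vector (W \<omega>)))"
    then have [measurable]: "A \<in> sets borel" by simp
    have "emeasure (distr M lborel (\<lambda>\<omega>. phase_vector (W \<omega>))) A = (\<integral>\<^sup>+\<omega>. indicator A (phase_vector (W \<omega>)) \<partial>M)"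
      by (subst nn_integral_indicator[symmetric], simp, subst nn_integral_distr) auto
    also have "\<dots> = (\<integral>\<^sup>+w. p w * indicator A (phase_vector w) \<partial>lborel)"
      using distributed_nn_integral[OF assms, of "\<lambda>w. indicator A (phase_vector w)"] by simp
    also have "\<dots> = (\<integral>\<^sup>+\<theta>. \<integral>\<^sup>+r. ?w \<theta> r * (p (polar_vector r \<theta>) * indicator A (phase_vector (polar_vector r \<theta>))) \<partial>lborel \<partial>lborel)"
      by (rule nn_integral_lborel_vec_polar) measurable
    also have "\<dots> = (\<integral>\<^sup>+\<theta>. \<integral>\<^sup>+r. ?w \<theta> r * p (polar_vector r \<theta>) * indicator A \<theta> \<partial>lborel \<partial>lborel)"
    proof (intro nn_integral_cong)
      fix \<theta> r
      show "?w \<theta> r * (p (polar_vector r \<theta>) * indicator A (phase_vector (polar_vector r \<theta>))) = ?w \<theta> r * p (polar_vector r \<theta>) * indicator A \<theta>"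
      proof (cases "?w \<theta> r = 0")
        case False
        show ?thesis unfolding phase_polar_vector[OF False] mult.assoc ..
      qed (simp only: mult_zero_left)
    qed
    also have "\<dots> = (\<integral>\<^sup>+\<theta>. ?q \<theta> * indicator A \<theta> \<partial>lborel)"
      by (intro nn_integral_cong nn_integral_multc) measurable
    also have "\<dots> = emeasure (density lborel ?q) A"
      using q by (subst emeasure_density) auto
    finally show "emeasure (distr M lborel (\<lambda>\<omega>. phase_vector (W \<omega>))) A = \<dots>" .
  qed simp
qed

section \<open>The phase density of a single coefficient\<close>

lemma interval_integral_0_eq:
  assumes "0 \<le> z"
  shows "(LBINT v=ereal 0..ereal z. exp (- v\<^sup>2)) = (LINT v:{0..z}|lborel. exp (- v\<^sup>2) :: real)"
  using assms by (simp add: interval_integral_Icc)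

lemma erf_minus: "erf (- z) = - erf z"
proof -
  have "(LBINT v=ereal 0..ereal (- z). exp (- v\<^sup>2)) = (LBINT v=-ereal (-z)..-ereal 0. exp (- (- v)\<^sup>2) :: real)"
    by (rule interval_integral_reflect)
  also have "\<dots> = - (LBINT v=ereal 0..ereal z. exp (- v\<^sup>2))"
    by (subst interval_integral_endpoints_reverse) (simp add: zero_ereal_def)
  finally show ?thesis by (simp add: erf_def)
qed

lemma has_real_derivative_erf: "(erf has_real_derivative 2 / sqrt pi * exp (- x\<^sup>2)) (at x)"
proof -
  let ?b = "\<bar>x\<bar> + 1"
  have "((\<lambda>u. LBINT v=ereal 0..ereal u. exp (- v\<^sup>2) :: real) has_vector_derivative exp (- x\<^sup>2)) (at x within {-?b..?b})"
    by (rule interval_integral_FTC2) (auto intro!: continuous_intros)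
  then have "((\<lambda>u. LBINT v=ereal 0..ereal u. exp (- v\<^sup>2) :: real) has_real_derivative exp (- x\<^sup>2)) (at x within {-?b..?b})"
    by (simp add: has_real_derivative_iff_has_vector_derivative)
  moreover have "at x within {-?b..?b} = at x"
    by (rule at_within_interior) (auto simp: abs_if)
  ultimately show ?thesis
    unfolding erf_def[abs_def] by (intro DERIV_cmult) (simp only:)
qed

lemma tendsto_erf_at_top: "(erf \<longlongrightarrow> 1) at_top"
proof -
  have int: "set_integrable lborel {0..} (\<lambda>v. exp (- v\<^sup>2) :: real)"
    and val: "(LINT v:{0..}|lborel. exp (- v\<^sup>2) :: real) = sqrt pi / 2"
    using gaussian_moment_0 unfolding set_integrable_def set_lebesgue_integral_def
    by (auto simp: has_bochner_integral_iff)
  have "((\<lambda>z. LINT v:{0..z}|lborel. exp (- v\<^sup>2) :: real) \<longlongrightarrow> sqrt pi / 2) at_top"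
    using tendsto_set_lebesgue_integral_at_top[OF _ int] unfolding val by simp
  then have "((\<lambda>z. 2 / sqrt pi * (LINT v:{0..z}|lborel. exp (- v\<^sup>2) :: real)) \<longlongrightarrow> 2 / sqrt pi * (sqrt pi / 2)) at_top"
    by (intro tendsto_intros)
  moreover have "\<forall>\<^sub>F z in at_top. 2 / sqrt pi * (LINT v:{0..z}|lborel. exp (- v\<^sup>2) :: real) = erf z"
    using eventually_ge_at_top[of 0] by eventually_elim (simp add: erf_def interval_integral_0_eq)
  ultimately show ?thesis using Lim_transform_eventually by fastforce
qed

text \<open>In the variable \<open>x = r / s\<close> write the factor \<open>x\<close> as \<open>(x - a) + a\<close>. Against \<open>exp (- (x - a)\<^sup>2)\<close> the
first summand integrates to an exponential and the second to an error function. The lower limit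
contributes \<open>erf (- a) = - erf a\<close>.\<close>

lemma nn_integral_radial_gaussian:
  fixes s a c :: real
  assumes s: "0 < s"
  defines "I \<equiv> exp (- c) / (2 * pi) + a / (2 * sqrt pi) * exp (- (c - a\<^sup>2)) * (1 + erf a)"
  shows "0 \<le> I"
    and "(\<integral>\<^sup>+r. ennreal (r / (pi * s\<^sup>2) * exp (- ((r / s - a)\<^sup>2 + c - a\<^sup>2))) * indicator {0..} r \<partial>lborel) = ennreal I"
proof -
  let ?f = "\<lambda>r. r / (pi * s\<^sup>2) * exp (- ((r / s - a)\<^sup>2 + c - a\<^sup>2))"
  \<comment> \<open>An antiderivative of the integrand, and its limit at infinity.\<close>
  define F where "F r = exp (- (c - a\<^sup>2)) / pi * (a * sqrt pi / 2 * erf (r / s - a) - exp (- (r / s - a)\<^sup>2) / 2)" for r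
  define T where "T = exp (- (c - a\<^sup>2)) / pi * (a * sqrt pi / 2 * 1 - 0 / 2)"
  have deriv: "(F has_real_derivative ?f r) (at r)" for r
  proof -
    let ?E = "exp (- (r / s - a)\<^sup>2)"
    have e: "((\<lambda>r. erf (r / s - a)) has_real_derivative 2 / sqrt pi * ?E * (1 / s)) (at r)"
      by (rule DERIV_chain2[OF has_real_derivative_erf]) (use s in \<open>auto intro!: derivative_eq_intros\<close>)
    have x: "((\<lambda>r. exp (- (r / s - a)\<^sup>2)) has_real_derivative ?E * (- (2 * (r / s - a) * (1 / s)))) (at r)"
      using s by (auto intro!: derivative_eq_intros)
    have "(F has_real_derivative exp (- (c - a\<^sup>2)) / pi *
        (a * sqrt pi / 2 * (2 / sqrt pi * ?E * (1 / s)) - ?E * (- (2 * (r / s - a) * (1 / s))) / 2)) (at r)"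
      unfolding F_def by (intro DERIV_cmult DERIV_diff DERIV_cdivide e x)
    also have "exp (- (c - a\<^sup>2)) / pi *
        (a * sqrt pi / 2 * (2 / sqrt pi * ?E * (1 / s)) - ?E * (- (2 * (r / s - a) * (1 / s))) / 2)
      = exp (- (c - a\<^sup>2)) / pi * (?E * (r / s\<^sup>2))"
      using s by (simp add: field_simps power2_eq_square)
    also have "\<dots> = ?f r"
      by (simp add: exp_add[symmetric])
    finally show ?thesis .
  qed
  have lin: "filterlim (\<lambda>r. r / s - a) at_top at_top"
  proof -
    have "filterlim (\<lambda>r. - a + 1 / s * r) at_top at_top"
      using s by (intro filterlim_tendsto_add_at_top[OF tendsto_const]
        filterlim_tendsto_pos_mult_at_top[OF tendsto_const] filterlim_ident) auto
    then show ?thesis by (simp add: algebra_simps)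
  qed
  have lim: "(F \<longlongrightarrow> T) at_top"
    unfolding F_def T_def
  proof (intro tendsto_intros)
    show "((\<lambda>r. erf (r / s - a)) \<longlongrightarrow> 1) at_top"
      by (rule filterlim_compose[OF tendsto_erf_at_top lin])
    have "((\<lambda>x::real. exp (- x\<^sup>2)) \<longlongrightarrow> 0) at_top"
    proof (rule filterlim_compose[OF exp_at_bot])
      have "filterlim (\<lambda>x::real. x\<^sup>2) at_top at_top"
        by (rule filterlim_pow_at_top[OF _ filterlim_ident]) simp
      then show "filterlim (\<lambda>x::real. - x\<^sup>2) at_bot at_top"
        by (simp only: filterlim_uminus_at_top)
    qed
    from filterlim_compose[OF this lin]
    show "((\<lambda>r. exp (- (r / s - a)\<^sup>2)) \<longlongrightarrow> 0) at_top" .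
  qed simp
  have nonneg: "0 \<le> ?f r" if "0 \<le> r" for r using that s by simp
  have "\<forall>\<^sub>F x in at_top. F 0 \<le> F x"
    using eventually_ge_at_top[of 0]
  proof eventually_elim
    case (elim x)
    show ?case
    proof (rule DERIV_nonneg_imp_nondecreasing[OF elim])
      fix y :: real assume "0 \<le> y"
      then show "\<exists>d. (F has_real_derivative d) (at y) \<and> 0 \<le> d"
        using deriv[of y] nonneg[of y] by blast
    qed
  qed
  from tendsto_lowerbound[OF lim this] have "F 0 \<le> T" by simp
  have I: "I = T - F 0"
  proof -
    have "sqrt pi * sqrt pi = pi" by simp
    then have "a / (2 * sqrt pi) = a * sqrt pi / (2 * pi)" by (simp add: field_simps)
    moreover have "exp (- c) = exp (- (c - a\<^sup>2)) * exp (- a\<^sup>2)" by (simp add: exp_add[symmetric])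
    ultimately show ?thesis
      unfolding I_def T_def F_def
      by (simp add: erf_minus algebra_simps add_divide_distrib diff_divide_distrib)
  qed
  show "0 \<le> I" unfolding I using \<open>F 0 \<le> T\<close> by simp
  have "(\<integral>\<^sup>+r. ennreal (?f r) * indicator {0..} r \<partial>lborel) = ennreal (T - F 0)"
    by (rule nn_integral_FTC_atLeast[OF _ deriv nonneg lim]) measurable
  then show "(\<integral>\<^sup>+r. ennreal (?f r) * indicator {0..} r \<partial>lborel) = ennreal I"
    unfolding I .
qed

lemma norm_polar_diff:
  assumes "is_Arg m \<theta>\<^sub>f"
  shows "(cmod (of_real r * iexp \<theta> - m))\<^sup>2 = r\<^sup>2 - 2 * r * cmod m * cos (\<theta> - \<theta>\<^sub>f) + (cmod m)\<^sup>2"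
proof -
  have m: "Re m = cmod m * cos \<theta>\<^sub>f" "Im m = cmod m * sin \<theta>\<^sub>f"
    using arg_cong[OF assms[unfolded is_Arg_def], of Re] arg_cong[OF assms[unfolded is_Arg_def], of Im]
    by (simp_all add: Re_exp Im_exp)
  have c: "(cos x)\<^sup>2 = 1 - (sin x)\<^sup>2" for x :: real by (simp add: cos_squared_eq)
  show ?thesis
    unfolding cmod_power2[of "of_real r * iexp \<theta> - m"]
    by (simp add: Re_exp Im_exp m cos_diff power2_diff power_mult_distrib c algebra_simps)
qed

text \<open>With \<open>a = sqrt q * cos (\<theta> - \<theta>\<^sub>f)\<close>, completing the square in the radius turns the exponent into
\<open>(r / sqrt v - a)\<^sup>2 + q - a\<^sup>2\<close>. Nonnegativity of the density holds because it is an integral of a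
nonnegative function.\<close>

lemma phase_density_radial:
  assumes v: "0 < v" and m: "is_Arg m \<theta>\<^sub>f"
  defines "q \<equiv> (cmod m)\<^sup>2 / v"
  shows "0 \<le> phase_density q \<theta>\<^sub>f \<theta>"
    and "(\<integral>\<^sup>+r. polar_weight \<theta> r * ennreal (1 / (pi * v) * exp (- (cmod (of_real r * iexp \<theta> - m))\<^sup>2 / v)) \<partial>lborel)
      = indicator {0..<2 * pi} \<theta> * ennreal (phase_density q \<theta>\<^sub>f \<theta>)"
proof -
  let ?d = "\<lambda>r. 1 / (pi * v) * exp (- (cmod (of_real r * iexp \<theta> - m))\<^sup>2 / v)"
  define a where "a = sqrt q * cos (\<theta> - \<theta>\<^sub>f)"
  have q: "0 \<le> q" using v by (simp add: q_def)
  have sq: "sqrt q = cmod m / sqrt v" by (simp add: q_def real_sqrt_divide)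
  have dens: "phase_density q \<theta>\<^sub>f \<theta> = exp (- q) / (2 * pi) + a / (2 * sqrt pi) * exp (- (q - a\<^sup>2)) * (1 + erf a)"
  proof -
    have "- q * (1 - (cos (\<theta> - \<theta>\<^sub>f))\<^sup>2) = - (q - a\<^sup>2)"
      using q by (simp add: a_def power_mult_distrib right_diff_distrib)
    then show ?thesis
      unfolding phase_density_def by (simp add: a_def)
  qed
  have ex: "(cmod (of_real r * iexp \<theta> - m))\<^sup>2 / v = (r / sqrt v - a)\<^sup>2 + q - a\<^sup>2" for r
  proof -
    have alg: "(r\<^sup>2 - 2 * r * x * k + x\<^sup>2) / S\<^sup>2 = (r / S - x / S * k)\<^sup>2 + x\<^sup>2 / S\<^sup>2 - (x / S * k)\<^sup>2"
      if "0 < S" for S x k :: real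
      using that by (simp add: field_simps power2_eq_square)
    show ?thesis
      unfolding norm_polar_diff[OF m] a_def sq
      using alg[of "sqrt v" "cmod m" "cos (\<theta> - \<theta>\<^sub>f)"] v by (simp add: q_def)
  qed
  have sv: "0 < sqrt v" using v by simp
  note rad = nn_integral_radial_gaussian[OF sv, where a = a and c = q, folded dens]
  show "0 \<le> phase_density q \<theta>\<^sub>f \<theta>" by (rule rad(1))
  have "(\<integral>\<^sup>+r. polar_weight \<theta> r * ennreal (?d r) \<partial>lborel)
     = (\<integral>\<^sup>+r. indicator {0..<2 * pi} \<theta> * (ennreal (r / (pi * (sqrt v)\<^sup>2) * exp (- ((r / sqrt v - a)\<^sup>2 + q - a\<^sup>2))) * indicator {0..} r) \<partial>lborel)"
  proof (intro nn_integral_cong)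
    fix r :: real
    show "polar_weight \<theta> r * ennreal (?d r)
     = indicator {0..<2 * pi} \<theta> * (ennreal (r / (pi * (sqrt v)\<^sup>2) * exp (- ((r / sqrt v - a)\<^sup>2 + q - a\<^sup>2))) * indicator {0..} r)"
    proof (cases "0 < r")
      case True
      then have "ennreal r * ennreal (1 / (pi * v) * exp (- ((r / sqrt v - a)\<^sup>2 + q - a\<^sup>2)))
         = ennreal (r / (pi * (sqrt v)\<^sup>2) * exp (- ((r / sqrt v - a)\<^sup>2 + q - a\<^sup>2)))"
        using v by (subst ennreal_mult[symmetric]) auto
      then show ?thesis
        using True by (simp add: polar_weight_def minus_divide_left[symmetric] ex mult.assoc)
    next
      case False
      then show ?thesis by (cases "r = 0") (simp_all add: polar_weight_def)
    qed
  qed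
  also have "\<dots> = indicator {0..<2 * pi} \<theta> * ennreal (phase_density q \<theta>\<^sub>f \<theta>)"
    by (subst nn_integral_cmult) (simp_all only: rad(2), measurable)
  finally show "(\<integral>\<^sup>+r. polar_weight \<theta> r * ennreal (?d r) \<partial>lborel)
      = indicator {0..<2 * pi} \<theta> * ennreal (phase_density q \<theta>\<^sub>f \<theta>)" .
qed

lemma borel_measurable_vec_1 [measurable]:
  "(vec :: 'a::euclidean_space \<Rightarrow> 'a ^ 1) \<in> borel \<rightarrow>\<^sub>M borel"
  unfolding borel_measurable_euclidean_space[where 'c = "'a ^ 1"]
  by (auto simp: Basis_vec_def inner_axis)

text \<open>Connects the scalar case with vectors that have one coordinate.\<close>

lemma nn_integral_lborel_vec_1:
  fixes f :: "'a::euclidean_space ^ 1 \<Rightarrow> ennreal"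
  assumes [measurable]: "f \<in> borel_measurable borel"
  shows "(\<integral>\<^sup>+x. f x \<partial>lborel) = (\<integral>\<^sup>+y. f (vec y) \<partial>lborel)"
proof -
  interpret product_sigma_finite "\<lambda>_::1. lborel :: 'a measure" ..
  have v: "vec_lambda x = (vec (x 1) :: 'a ^ 1)" for x
    by (simp add: vec_eq_iff)
  have "(\<integral>\<^sup>+x. f x \<partial>lborel) = (\<integral>\<^sup>+x. f (vec (x 1)) \<partial>(\<Pi>\<^sub>M i\<in>{1::1}. lborel))"
    unfolding nn_integral_lborel_vec[OF assms] UNIV_1 v ..
  also have "\<dots> = (\<integral>\<^sup>+y. f (vec y) \<partial>lborel)"
    by (rule product_nn_integral_singleton) measurable
  finally show ?thesis .
qed

lemma distributed_Arg2pi: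
  fixes W :: "'a \<Rightarrow> complex ^ 1"
  assumes "distributed M lborel W p"
  shows "distributed M lborel (\<lambda>\<omega>. Arg2pi (W \<omega> $ 1))
    (\<lambda>\<theta>. \<integral>\<^sup>+r. polar_weight \<theta> r * p (vec (of_real r * iexp \<theta>)) \<partial>lborel)"
proof -
  define q where "q = (\<lambda>\<theta>::real ^ 1. \<integral>\<^sup>+r. (\<Prod>i\<in>UNIV. polar_weight (\<theta> $ i) (r $ i)) * p (polar_vector r \<theta>) \<partial>lborel)"
  have D: "distributed M lborel (\<lambda>\<omega>. phase_vector (W \<omega>)) q"
    unfolding q_def by (rule distributed_phase_vector[OF assms])
  have [measurable]: "p \<in> borel_measurable borel" and W [measurable]: "W \<in> borel_measurable M"
    and q [measurable]: "q \<in> borel_measurable borel"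
    using distributed_borel_measurable[OF assms] distributed_measurable[OF assms] distributed_borel_measurable[OF D] by simp_all
  have pv: "polar_vector (vec r) (vec \<theta>) = (vec (of_real r * iexp \<theta>) :: complex ^ 1)" for r \<theta>
    by (simp add: polar_vector_def vec_eq_iff)
  have pm: "(\<lambda>r. (\<Prod>i\<in>UNIV. polar_weight (\<theta> $ i) (r $ i)) * p (polar_vector r \<theta>)) \<in> borel_measurable borel" for \<theta> :: "real ^ 1"
    by measurable
  have q_vec: "q (vec \<theta>) = (\<integral>\<^sup>+r. polar_weight \<theta> r * p (vec (of_real r * iexp \<theta>)) \<partial>lborel)" for \<theta>
    unfolding q_def nn_integral_lborel_vec_1[OF pm] by (simp add: pv)
  have "distributed M lborel (\<lambda>\<omega>. Arg2pi (W \<omega> $ 1)) (\<lambda>\<theta>. q (vec \<theta>))"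
    unfolding distributed_def
  proof (intro conjI measure_eqI)
    show "(\<lambda>\<theta>. q (vec \<theta>)) \<in> borel_measurable lborel" by measurable
    show "(\<lambda>\<omega>. Arg2pi (W \<omega> $ 1)) \<in> M \<rightarrow>\<^sub>M lborel" by measurable
    fix A :: "real set" assume "A \<in> sets (distr M lborel (\<lambda>\<omega>. Arg2pi (W \<omega> $ 1)))"
    then have [measurable]: "A \<in> sets borel" by simp
    have "emeasure (distr M lborel (\<lambda>\<omega>. Arg2pi (W \<omega> $ 1))) A = (\<integral>\<^sup>+\<omega>. indicator A (phase_vector (W \<omega>) $ 1) \<partial>M)"
      by (subst nn_integral_indicator[symmetric], simp, subst nn_integral_distr) (auto simp: phase_vector_def)
    also have "\<dots> = (\<integral>\<^sup>+\<theta>. q \<theta> * indicator A (\<theta> $ 1) \<partial>lborel)"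
      using distributed_nn_integral[OF D, of "\<lambda>\<theta>. indicator A (\<theta> $ 1)"] by simp
    also have "\<dots> = (\<integral>\<^sup>+\<theta>. q (vec \<theta>) * indicator A \<theta> \<partial>lborel)"
      by (subst nn_integral_lborel_vec_1) simp_all
    also have "\<dots> = emeasure (density lborel (\<lambda>\<theta>. q (vec \<theta>))) A"
      by (subst emeasure_density) auto
    finally show "emeasure (distr M lborel (\<lambda>\<omega>. Arg2pi (W \<omega> $ 1))) A = \<dots>" .
  qed simp
  then show ?thesis unfolding q_vec .
qed

text \<open>The whitening matrix is the scalar \<open>1 / sqrt v\<close>.\<close>

lemma complex_gaussian_density_1:
  fixes \<Gamma> :: "complex ^ 1 ^ 1"
  assumes v: "0 < v" and \<Gamma>: "\<Gamma> $ 1 $ 1 = complex_of_real v"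
  shows "complex_gaussian_density m \<Gamma> w
    = complex_of_real (1 / (pi * v) * exp (- (cmod (w $ 1 - m $ 1))\<^sup>2 / v))"
proof -
  let ?B = "mat (complex_of_real (1 / sqrt v)) :: complex ^ 1 ^ 1"
  have vv: "complex_of_real (sqrt v) * complex_of_real (sqrt v) = complex_of_real v"
    using v by (simp add: of_real_mult[symmetric] del: of_real_mult)
  have B: "?B ** \<Gamma> ** conj_transpose ?B = mat 1"
    using v by (simp add: matrix_matrix_mult_def conj_transpose_def mat_def vec_eq_iff \<Gamma> vv[symmetric])
  have n: "(norm (?B *v (w - m)))\<^sup>2 = (cmod (w $ 1 - m $ 1))\<^sup>2 / v"
    using v by (simp add: norm_vec_def L2_set_def matrix_vector_mult_def mat_def norm_mult norm_divide power_divide)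
  have s: "2 * pi * (1 / sqrt 2)\<^sup>2 = pi" "2 * (1 / sqrt 2)\<^sup>2 = (1::real)" by (simp_all add: power_divide)
  show ?thesis
    unfolding complex_gaussian_density_whitened[OF B] gauss_density_eq s n
    using v by (simp add: det_1 mat_def norm_divide power_divide)
qed

section \<open>Path integrals of a stationary Gaussian process\<close>

text \<open>A degenerate variable satisfies the same formulas with variance \<open>0\<close>.\<close>

lemma (in prob_space) gaussian_variable_moments:
  assumes "gaussian_variable M X"
  shows "integrable M X" "integrable M (\<lambda>\<omega>. (X \<omega>)\<^sup>2)"
    "(CLINT \<omega>|M. iexp (X \<omega>)) = iexp (expectation X) * complex_of_real (exp (- variance X / 2))"
proof -
  have [measurable]: "X \<in> borel_measurable M" using assms by (simp add: gaussian_variable_def)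
  consider c where "AE \<omega> in M. X \<omega> = c"
    | c s where "0 < s" "distributed M lborel X (\<lambda>x. ennreal (normal_density c s x))"
    using assms unfolding gaussian_variable_def by blast
  then have "integrable M X \<and> integrable M (\<lambda>\<omega>. (X \<omega>)\<^sup>2) \<and>
    (CLINT \<omega>|M. iexp (X \<omega>)) = iexp (expectation X) * complex_of_real (exp (- variance X / 2))"
  proof cases
    case 1
    have i: "integrable M X"
      using 1 by (subst integrable_cong_AE[where g = "\<lambda>_. c"]) auto
    have i2: "integrable M (\<lambda>\<omega>. (X \<omega>)\<^sup>2)"
      using 1 by (subst integrable_cong_AE[where g = "\<lambda>_. c\<^sup>2"]) auto
    have e: "expectation X = c"
      using 1 by (subst integral_cong_AE[where g = "\<lambda>_. c"]) (auto simp: prob_space)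
    have v: "variance X = 0"
      unfolding e using 1 by (subst integral_cong_AE[where g = "\<lambda>_. 0"]) auto
    have "(CLINT \<omega>|M. iexp (X \<omega>)) = iexp c"
      using 1 by (subst integral_cong_AE[where g = "\<lambda>_. iexp c"]) (auto simp: prob_space)
    then show ?thesis using i i2 unfolding v unfolding e by simp
  next
    case 2
    let ?n = "normal_density c s"
    have n1: "integrable lborel (\<lambda>x. ?n x * x)"
      by (rule integrable_normal_moment_nz_1[OF 2(1)])
    \<comment> \<open>The moments about the mean are known; they are combined to the second moment about \<open>0\<close>.\<close>
    have "integrable lborel (\<lambda>x. ?n x * (x - c)\<^sup>2 + 2 * c * (?n x * x) - c\<^sup>2 * ?n x)"
      by (intro Bochner_Integration.integrable_add Bochner_Integration.integrable_diff
        integrable_mult_right integrable_normal_moment integrable_normal_density n1 2(1))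
    then have n2: "integrable lborel (\<lambda>x. ?n x * x\<^sup>2)"
      by (simp add: power2_eq_square algebra_simps)
    have i: "integrable M X"
      using distributed_integrable[OF 2(2), of "\<lambda>x. x"] n1 by simp
    have i2: "integrable M (\<lambda>\<omega>. (X \<omega>)\<^sup>2)"
      using distributed_integrable[OF 2(2), of "\<lambda>x. x\<^sup>2"] n2 by simp
    have e: "expectation X = c" by (rule normal_distributed_expectation[OF 2])
    have v: "variance X = s\<^sup>2" by (rule normal_distributed_variance[OF 2])
    have "(CLINT \<omega>|M. iexp (X \<omega>)) = (CLINT x|distr M lborel X. iexp x)"
      by (subst integral_distr) auto
    also have "\<dots> = (CLINT x|lborel. ?n x *\<^sub>R iexp x)"
      unfolding distributed_distr_eq_density[OF 2(2)] by (subst integral_density) auto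
    also have "\<dots> = (CLINT x|lborel. ?n (c + 1 * x) *\<^sub>R iexp (c + 1 * x))"
      by (subst lborel_integral_real_affine[of 1 _ c]) auto
    also have "\<dots> = (CLINT x|lborel. iexp c * (normal_density 0 s x * iexp (1 * x)))"
      by (intro Bochner_Integration.integral_cong refl)
        (simp add: normal_density_def exp_add distrib_left scaleR_conv_of_real mult_ac)
    also have "\<dots> = iexp c * (CLINT x|lborel. normal_density 0 s x * iexp (1 * x))"
      by (rule integral_mult_right_zero)
    also have "\<dots> = iexp c * complex_of_real (exp (- s\<^sup>2 / 2))"
      unfolding char_normal_density[OF 2(1)] by simp
    finally show ?thesis using i i2 unfolding v unfolding e by simp
  qed
  then show "integrable M X" "integrable M (\<lambda>\<omega>. (X \<omega>)\<^sup>2)"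
    "(CLINT \<omega>|M. iexp (X \<omega>)) = iexp (expectation X) * complex_of_real (exp (- variance X / 2))"
    by blast+
qed

lemma norm_iexp_diff: "cmod (iexp x - iexp y) \<le> \<bar>x - y\<bar>"
proof -
  have "iexp x - iexp y = iexp y * (iexp (x - y) - 1)"
    by (simp add: right_diff_distrib exp_diff)
  then have "cmod (iexp x - iexp y) = cmod (iexp (x - y) - 1)"
    by (simp add: norm_mult)
  also have "\<dots> \<le> \<bar>x - y\<bar>"
    using iexp_approx1[of "x - y" 0] by simp
  finally show ?thesis .
qed

text \<open>The sign of the exponent is the one of characteristic functions, hence of the spectral representation
of the covariance. It is opposite to \<open>fourier\<close>, which matches the conjugate on the wavelet in the
transform.\<close>

definition fourier_plus :: "(real \<Rightarrow> complex) \<Rightarrow> real \<Rightarrow> complex" where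
  "fourier_plus g l = (CLINT \<tau>|lborel. iexp (l * \<tau>) * g \<tau>)"

text \<open>The mesh \<open>1 / (n + 1)\<close> shrinks while the covered interval \<open>[- (n + 1), n + 1]\<close> grows to the whole line.\<close>

definition grid :: "nat \<Rightarrow> real set" where
  "grid n = (\<lambda>k. of_int k / real (Suc n)) ` {- int ((Suc n)\<^sup>2)..int ((Suc n)\<^sup>2)}"

definition grid_round :: "nat \<Rightarrow> real \<Rightarrow> real" where
  "grid_round n \<tau> = of_int \<lfloor>real (Suc n) * \<tau>\<rfloor> / real (Suc n)"

lemma finite_grid [simp]: "finite (grid n)"
  by (simp add: grid_def)

lemma borel_measurable_grid_round [measurable]: "grid_round n \<in> borel_measurable borel"
  unfolding grid_round_def[abs_def] by measurable

lemma grid_round_tendsto: "(\<lambda>n. grid_round n \<tau>) \<longlonglongrightarrow> \<tau>"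
proof (rule LIMSEQ_I)
  fix e :: real assume "0 < e"
  then obtain N where N: "1 / real (Suc N) < e" by (metis nat_approx_posE)
  have "norm (grid_round n \<tau> - \<tau>) < e" if "N \<le> n" for n
  proof -
    have "\<bar>of_int \<lfloor>real (Suc n) * \<tau>\<rfloor> - real (Suc n) * \<tau>\<bar> \<le> 1" by linarith
    moreover have "grid_round n \<tau> - \<tau> = (of_int \<lfloor>real (Suc n) * \<tau>\<rfloor> - real (Suc n) * \<tau>) / real (Suc n)"
      by (simp add: grid_round_def diff_divide_distrib)
    ultimately have "\<bar>grid_round n \<tau> - \<tau>\<bar> \<le> 1 / real (Suc n)"
      by (simp only: abs_divide abs_of_nat divide_right_mono of_nat_0_le_iff)
    also have "\<dots> \<le> 1 / real (Suc N)" using that by (simp add: field_simps)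
    finally show ?thesis using N by simp
  qed
  then show "\<exists>N. \<forall>n\<ge>N. norm (grid_round n \<tau> - \<tau>) < e" by blast
qed

lemma eventually_grid_round_in_grid: "\<forall>\<^sub>F n in sequentially. grid_round n \<tau> \<in> grid n"
proof -
  obtain N where N: "\<bar>\<tau>\<bar> \<le> real N" using real_arch_simple by blast
  show ?thesis
  proof (rule eventually_sequentiallyI[of N])
    fix n assume "N \<le> n"
    then have t: "- real n \<le> \<tau>" "\<tau> \<le> real n" using N by auto
    have "real (Suc n) * \<tau> \<le> real (Suc n) * real n" "real (Suc n) * (- real n) \<le> real (Suc n) * \<tau>"
      using t by (intro mult_left_mono; simp)+
    then have "real (Suc n) * \<tau> < real (Suc n) * real n + 1" "- (real (Suc n) * real n) \<le> real (Suc n) * \<tau>"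
      by linarith+
    then have "\<lfloor>real (Suc n) * \<tau>\<rfloor> \<le> int (Suc n * n)" "- int (Suc n * n) \<le> \<lfloor>real (Suc n) * \<tau>\<rfloor>"
      by (simp_all only: le_floor_iff floor_le_iff of_int_minus of_int_mult of_int_of_nat_eq of_nat_mult)
    moreover have "Suc n * n \<le> (Suc n)\<^sup>2" by (simp add: power2_eq_square)
    then have "int (Suc n * n) \<le> int ((Suc n)\<^sup>2)" by (simp only: of_nat_le_iff)
    ultimately have "\<lfloor>real (Suc n) * \<tau>\<rfloor> \<in> {- int ((Suc n)\<^sup>2)..int ((Suc n)\<^sup>2)}" by auto
    then show "grid_round n \<tau> \<in> grid n"
      unfolding grid_def grid_round_def by blast
  qed
qed

definition grid_weight :: "(real \<Rightarrow> real) \<Rightarrow> nat \<Rightarrow> real \<Rightarrow> real" where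
  "grid_weight h n \<sigma> = (LINT \<tau>|lborel. indicator {\<tau>. grid_round n \<tau> = \<sigma>} \<tau> * h \<tau>)"

text \<open>The value \<open>0\<close> outside the covered interval keeps the number of sample points finite.\<close>

definition grid_step :: "nat \<Rightarrow> (real \<Rightarrow> 'b::real_vector) \<Rightarrow> real \<Rightarrow> 'b" where
  "grid_step n G \<tau> = (if grid_round n \<tau> \<in> grid n then G (grid_round n \<tau>) else 0)"

lemma grid_step_tendsto:
  fixes G :: "real \<Rightarrow> 'b::real_normed_vector"
  assumes "continuous_on UNIV G"
  shows "(\<lambda>n. grid_step n G \<tau>) \<longlonglongrightarrow> G \<tau>"
proof -
  have "(\<lambda>n. G (grid_round n \<tau>)) \<longlonglongrightarrow> G \<tau>"
    using continuous_on_tendsto_compose[OF assms grid_round_tendsto] by simp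
  moreover have "\<forall>\<^sub>F n in sequentially. G (grid_round n \<tau>) = grid_step n G \<tau>"
    using eventually_grid_round_in_grid[of \<tau>] by eventually_elim (simp add: grid_step_def)
  ultimately show ?thesis by (rule Lim_transform_eventually)
qed

lemma scaleR_grid_step:
  "h \<tau> *\<^sub>R grid_step n G \<tau> = (\<Sum>\<sigma>\<in>grid n. (indicator {\<tau>. grid_round n \<tau> = \<sigma>} \<tau> * h \<tau>) *\<^sub>R G \<sigma>)"
proof -
  have "(\<Sum>\<sigma>\<in>grid n. (indicator {\<tau>. grid_round n \<tau> = \<sigma>} \<tau> * h \<tau>) *\<^sub>R G \<sigma>)
      = (\<Sum>\<sigma>\<in>grid n. if \<sigma> = grid_round n \<tau> then h \<tau> *\<^sub>R G \<sigma> else 0)"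
    by (intro sum.cong refl) (auto simp: indicator_def)
  then show ?thesis by (simp add: grid_step_def)
qed

text \<open>Since the weights are exact integrals of \<open>h\<close> over the cells, the sum equals an integral of a step
function, and its limit is a matter of dominated convergence.\<close>

lemma sum_grid_weight:
  fixes G :: "real \<Rightarrow> 'b::{banach, second_countable_topology}"
  assumes h: "integrable lborel h"
  shows "integrable lborel (\<lambda>\<tau>. h \<tau> *\<^sub>R grid_step n G \<tau>)"
    and "(\<Sum>\<sigma>\<in>grid n. grid_weight h n \<sigma> *\<^sub>R G \<sigma>) = (LINT \<tau>|lborel. h \<tau> *\<^sub>R grid_step n G \<tau>)"
proof -
  have i: "integrable lborel (\<lambda>\<tau>. indicator {\<tau>. grid_round n \<tau> = \<sigma>} \<tau> * h \<tau>)" for \<sigma>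
    using integrable_mult_indicator[OF _ h, of "{\<tau>. grid_round n \<tau> = \<sigma>}"] by simp
  show "integrable lborel (\<lambda>\<tau>. h \<tau> *\<^sub>R grid_step n G \<tau>)"
    unfolding scaleR_grid_step using i by simp
  show "(\<Sum>\<sigma>\<in>grid n. grid_weight h n \<sigma> *\<^sub>R G \<sigma>) = (LINT \<tau>|lborel. h \<tau> *\<^sub>R grid_step n G \<tau>)"
    unfolding scaleR_grid_step grid_weight_def using i by simp
qed

lemma borel_measurable_grid_step [measurable]:
  fixes G :: "real \<Rightarrow> 'b::real_normed_vector"
  assumes [measurable]: "G \<in> borel_measurable borel"
  shows "grid_step n G \<in> borel_measurable borel"
proof -
  have [measurable]: "grid n \<in> sets borel"
    by (intro borel_closed finite_imp_closed finite_grid)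
  show ?thesis unfolding grid_step_def[abs_def] by measurable
qed

lemma sum_grid_weight_tendsto:
  fixes G :: "real \<Rightarrow> 'b::{banach, second_countable_topology}"
  assumes h: "integrable lborel h" and G: "continuous_on UNIV G" and b: "\<And>x. norm (G x) \<le> 1"
  shows "(\<lambda>n. \<Sum>\<sigma>\<in>grid n. grid_weight h n \<sigma> *\<^sub>R G \<sigma>) \<longlonglongrightarrow> (LINT \<tau>|lborel. h \<tau> *\<^sub>R G \<tau>)"
    and "norm (\<Sum>\<sigma>\<in>grid n. grid_weight h n \<sigma> *\<^sub>R G \<sigma>) \<le> (LINT \<tau>|lborel. \<bar>h \<tau>\<bar>)"
proof -
  have [measurable]: "h \<in> borel_measurable borel" using h by auto
  have [measurable]: "G \<in> borel_measurable borel" using G by (rule borel_measurable_continuous_onI)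
  have b': "norm (h \<tau> *\<^sub>R grid_step n G \<tau>) \<le> \<bar>h \<tau>\<bar>" for n \<tau>
    using mult_left_mono[OF b, of "\<bar>h \<tau>\<bar>" "grid_round n \<tau>"] by (simp add: grid_step_def)
  show "(\<lambda>n. \<Sum>\<sigma>\<in>grid n. grid_weight h n \<sigma> *\<^sub>R G \<sigma>) \<longlonglongrightarrow> (LINT \<tau>|lborel. h \<tau> *\<^sub>R G \<tau>)"
    unfolding sum_grid_weight(2)[OF h]
  proof (rule integral_dominated_convergence[where w = "\<lambda>\<tau>. \<bar>h \<tau>\<bar>"])
    show "AE \<tau> in lborel. (\<lambda>n. h \<tau> *\<^sub>R grid_step n G \<tau>) \<longlonglongrightarrow> h \<tau> *\<^sub>R G \<tau>"
      by (intro AE_I2 tendsto_intros grid_step_tendsto[OF G])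
  qed (use h b' in auto)
  show "norm (\<Sum>\<sigma>\<in>grid n. grid_weight h n \<sigma> *\<^sub>R G \<sigma>) \<le> (LINT \<tau>|lborel. \<bar>h \<tau>\<bar>)"
    unfolding sum_grid_weight(2)[OF h]
  proof (rule Bochner_Integration.integral_norm_bound_integral)
    show "integrable lborel (\<lambda>\<tau>. h \<tau> *\<^sub>R grid_step n G \<tau>)"
      by (rule Bochner_Integration.integrable_bound[OF integrable_abs[OF h]]) (use b' in auto)
  qed (use h b' in auto)
qed

locale stationary_gaussian = prob_space M for M :: "'a measure" +
  fixes \<Phi> :: "real \<Rightarrow> 'a \<Rightarrow> real" and C :: "real \<Rightarrow> real" and F :: "real measure"
  assumes \<Phi>_measurable: "(\<lambda>(\<tau>, \<omega>). \<Phi> \<tau> \<omega>) \<in> borel_measurable (borel \<Otimes>\<^sub>M M)"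
    and gaussian: "gaussian_process M \<Phi>"
    and stationary: "stationary_with_covariance M C \<Phi>"
    and spectral: "spectral_measure F C"
begin

sublocale F: finite_borel_measure F
  using spectral by (simp add: spectral_measure_def)

lemma sets_F [measurable_cong]: "sets F = sets borel"
  by (rule F.M_is_borel)

lemma C_char: "complex_of_real (C t) = char F t"
  using spectral by (simp add: spectral_measure_def)

lemma \<Phi>_measurable' [measurable (raw)]:
  "f \<in> N \<rightarrow>\<^sub>M borel \<Longrightarrow> g \<in> N \<rightarrow>\<^sub>M M \<Longrightarrow> (\<lambda>x. \<Phi> (f x) (g x)) \<in> borel_measurable N"
  using measurable_compose[OF measurable_Pair \<Phi>_measurable] by simp

definition mean :: real where "mean = expectation (\<Phi> 0)"

lemma expectation_\<Phi>: "expectation (\<Phi> t) = mean"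
  using stationary unfolding stationary_with_covariance_def mean_def by metis

lemma covariance_\<Phi>: "expectation (\<lambda>\<omega>. (\<Phi> s \<omega> - mean) * (\<Phi> t \<omega> - mean)) = C (s - t)"
proof -
  obtain \<mu> where \<mu>: "\<forall>t. expectation (\<Phi> t) = \<mu>"
    "\<forall>t\<^sub>1 t\<^sub>2. expectation (\<lambda>\<omega>. (\<Phi> t\<^sub>1 \<omega> - \<mu>) * (\<Phi> t\<^sub>2 \<omega> - \<mu>)) = C (t\<^sub>1 - t\<^sub>2)"
    using stationary unfolding stationary_with_covariance_def by blast
  then have "\<mu> = mean" by (simp add: mean_def)
  with \<mu> show ?thesis by simp
qed

lemma gaussian_sum: "finite T \<Longrightarrow> gaussian_variable M (\<lambda>\<omega>. \<Sum>t\<in>T. a t * \<Phi> t \<omega>)"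
  using gaussian by (simp add: gaussian_process_def)

lemma integrable_\<Phi> [simp]: "integrable M (\<Phi> t)"
  and integrable_\<Phi>_sq [simp]: "integrable M (\<lambda>\<omega>. (\<Phi> t \<omega>)\<^sup>2)"
  using gaussian_variable_moments(1,2)[OF gaussian_sum[of "{t}" "\<lambda>_. 1"]] by simp_all

lemma integrable_\<Phi>_prod: "integrable M (\<lambda>\<omega>. (\<Phi> s \<omega> - mean) * (\<Phi> t \<omega> - mean))"
proof (rule Bochner_Integration.integrable_bound)
  show "integrable M (\<lambda>\<omega>. (\<Phi> s \<omega> - mean)\<^sup>2 + (\<Phi> t \<omega> - mean)\<^sup>2)"
    by (simp add: power2_diff)
  have "\<bar>x * y\<bar> \<le> x\<^sup>2 + y\<^sup>2" for x y :: real
  proof -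
    have "0 \<le> \<bar>x\<bar> * \<bar>y\<bar>" by simp
    then show ?thesis
      using sum_squares_bound[of "\<bar>x\<bar>" "\<bar>y\<bar>"] unfolding abs_mult power2_abs by linarith
  qed
  then show "AE \<omega> in M. norm ((\<Phi> s \<omega> - mean) * (\<Phi> t \<omega> - mean)) \<le> norm ((\<Phi> s \<omega> - mean)\<^sup>2 + (\<Phi> t \<omega> - mean)\<^sup>2)"
    by (intro AE_I2) (simp only: real_norm_def abs_of_nonneg sum_power2_ge_zero)
qed measurable

text \<open>The spectral representation turns the double sum of covariances into the integral of a squared modulus,
which makes the limit over finer grids accessible.\<close>

lemma char_sum_\<Phi>:
  assumes "finite T"
  shows "(CLINT \<omega>|M. iexp (\<Sum>t\<in>T. a t * \<Phi> t \<omega>))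
    = iexp (mean * (\<Sum>t\<in>T. a t)) * complex_of_real (exp (- (LINT l|F. (cmod (\<Sum>t\<in>T. a t *\<^sub>R iexp (l * t)))\<^sup>2) / 2))"
proof -
  let ?h = "\<lambda>l. (cmod (\<Sum>t\<in>T. a t *\<^sub>R iexp (l * t)))\<^sup>2"
  let ?c = "\<lambda>l. \<Sum>s\<in>T. \<Sum>t\<in>T. complex_of_real (a s * a t) * iexp ((s - t) * l)"
  have e: "expectation (\<lambda>\<omega>. \<Sum>t\<in>T. a t * \<Phi> t \<omega>) = mean * (\<Sum>t\<in>T. a t)"
    by (simp add: expectation_\<Phi> mult.commute) (rule sum_distrib_right[symmetric])
  have "(\<Sum>t\<in>T. a t * \<Phi> t \<omega>) - mean * (\<Sum>t\<in>T. a t) = (\<Sum>t\<in>T. a t * (\<Phi> t \<omega> - mean))" for \<omega>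
    by (simp add: right_diff_distrib sum_subtractf sum_distrib_right mult.commute[of mean])
  then have "((\<Sum>t\<in>T. a t * \<Phi> t \<omega>) - mean * (\<Sum>t\<in>T. a t))\<^sup>2
      = (\<Sum>s\<in>T. \<Sum>t\<in>T. a s * a t * ((\<Phi> s \<omega> - mean) * (\<Phi> t \<omega> - mean)))" for \<omega>
    by (simp add: power2_eq_square sum_product mult_ac)
  then have v: "variance (\<lambda>\<omega>. \<Sum>t\<in>T. a t * \<Phi> t \<omega>) = (\<Sum>s\<in>T. \<Sum>t\<in>T. a s * a t * C (s - t))"
    unfolding e by (simp add: integrable_\<Phi>_prod covariance_\<Phi>)
  have int: "integrable F (\<lambda>l. iexp (r * l))" for r
    by (rule F.integrable_const_bound[of _ 1]) auto
  have "complex_of_real (\<Sum>s\<in>T. \<Sum>t\<in>T. a s * a t * C (s - t))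
      = (\<Sum>s\<in>T. \<Sum>t\<in>T. complex_of_real (a s * a t) * (CLINT l|F. iexp ((s - t) * l)))"
    by (simp add: C_char char_def)
  also have "\<dots> = (CLINT l|F. ?c l)"
    by (simp only: Bochner_Integration.integral_sum Bochner_Integration.integrable_sum
        integrable_mult_right int integral_mult_right_zero)
  also have "\<dots> = (CLINT l|F. complex_of_real (?h l))"
  proof (intro Bochner_Integration.integral_cong refl)
    fix l
    have "complex_of_real (?h l)
      = (\<Sum>s\<in>T. a s *\<^sub>R iexp (l * s)) * cnj (\<Sum>t\<in>T. a t *\<^sub>R iexp (l * t))"
      by (rule complex_norm_square)
    also have "\<dots> = ?c l"
      by (simp add: sum_product exp_cnj scaleR_conv_of_real exp_diff left_diff_distrib right_diff_distrib
          exp_minus field_simps)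
    finally show "?c l
      = complex_of_real (?h l)" by simp
  qed
  also have "\<dots> = complex_of_real (LINT l|F. ?h l)"
    by (rule integral_complex_of_real)
  finally have v': "(\<Sum>s\<in>T. \<Sum>t\<in>T. a s * a t * C (s - t)) = (LINT l|F. ?h l)"
    by (simp only: of_real_eq_iff)
  show ?thesis
    using gaussian_variable_moments(3)[OF gaussian_sum[OF assms, of a]] unfolding v unfolding v' e .
qed

lemma C_tendsto_0:
  assumes "x \<longlonglongrightarrow> 0"
  shows "(\<lambda>n. C (x n)) \<longlonglongrightarrow> C 0"
proof -
  have "(\<lambda>n. char F (x n)) \<longlonglongrightarrow> char F 0"
    unfolding char_def
  proof (rule integral_dominated_convergence[where w = "\<lambda>_. 1"])
    show "AE l in F. (\<lambda>n. iexp (x n * l)) \<longlonglongrightarrow> iexp (0 * l)"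
      by (intro AE_I2 tendsto_intros assms)
  qed auto
  then show ?thesis
    unfolding C_char[symmetric] by (simp only: tendsto_of_real_iff)
qed

text \<open>The second moment of \<open>\<Phi> s - \<Phi> t\<close> is \<open>2 * (C 0 - C (s - t))\<close>, and it bounds the squared first
absolute moment because a variance is nonnegative. With continuity of \<open>C\<close> at \<open>0\<close> this makes the process
continuous in mean.\<close>

lemma expectation_abs_\<Phi>_diff:
  "expectation (\<lambda>\<omega>. \<bar>\<Phi> s \<omega> - \<Phi> t \<omega>\<bar>) \<le> sqrt (2 * (C 0 - C (s - t)))"
proof -
  have "(\<Phi> s \<omega> - \<Phi> t \<omega>)\<^sup>2 = (\<Phi> s \<omega> - mean) * (\<Phi> s \<omega> - mean) + (\<Phi> t \<omega> - mean) * (\<Phi> t \<omega> - mean)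
      - 2 * ((\<Phi> s \<omega> - mean) * (\<Phi> t \<omega> - mean))" for \<omega>
    by (simp add: power2_eq_square algebra_simps)
  then have sq: "integrable M (\<lambda>\<omega>. (\<Phi> s \<omega> - \<Phi> t \<omega>)\<^sup>2)"
    "expectation (\<lambda>\<omega>. (\<Phi> s \<omega> - \<Phi> t \<omega>)\<^sup>2) = 2 * (C 0 - C (s - t))"
    by (simp_all add: integrable_\<Phi>_prod covariance_\<Phi>)
  have "0 \<le> variance (\<lambda>\<omega>. \<bar>\<Phi> s \<omega> - \<Phi> t \<omega>\<bar>)" by (rule variance_positive)
  also have "\<dots> = 2 * (C 0 - C (s - t)) - (expectation (\<lambda>\<omega>. \<bar>\<Phi> s \<omega> - \<Phi> t \<omega>\<bar>))\<^sup>2"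
    using sq by (subst variance_eq) auto
  finally show ?thesis by (intro real_le_rsqrt) simp
qed

lemma nn_expectation_abs_\<Phi>: "(\<integral>\<^sup>+\<omega>. ennreal \<bar>\<Phi> t \<omega>\<bar> \<partial>M) \<le> ennreal (C 0 + mean\<^sup>2 + 1)"
proof -
  have eq: "(\<Phi> t \<omega>)\<^sup>2 = (\<Phi> t \<omega> - mean) * (\<Phi> t \<omega> - mean) + 2 * mean * \<Phi> t \<omega> - mean\<^sup>2" for \<omega>
    by (simp add: power2_eq_square algebra_simps)
  have "expectation (\<lambda>\<omega>. (\<Phi> t \<omega>)\<^sup>2) = C 0 + mean\<^sup>2"
    unfolding eq using integrable_\<Phi>_prod[of t t] covariance_\<Phi>[of t t]
    by (simp add: expectation_\<Phi> prob_space power2_eq_square)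
  then have i: "integrable M (\<lambda>\<omega>. (\<Phi> t \<omega>)\<^sup>2 + 1)" "expectation (\<lambda>\<omega>. (\<Phi> t \<omega>)\<^sup>2 + 1) = C 0 + mean\<^sup>2 + 1"
    by (simp_all add: prob_space)
  have "\<bar>x\<bar> \<le> x\<^sup>2 + 1" for x :: real
    using sum_squares_bound[of "\<bar>x\<bar>" 1] abs_ge_zero[of x] unfolding power2_abs power_one by linarith
  then have "(\<integral>\<^sup>+\<omega>. ennreal \<bar>\<Phi> t \<omega>\<bar> \<partial>M) \<le> (\<integral>\<^sup>+\<omega>. ennreal ((\<Phi> t \<omega>)\<^sup>2 + 1) \<partial>M)"
    by (intro nn_integral_mono ennreal_leI)
  also have "\<dots> = ennreal (C 0 + mean\<^sup>2 + 1)"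
    using i by (subst nn_integral_eq_integral) auto
  finally show ?thesis .
qed

lemma nn_integral_weighted_path:
  fixes h :: "real \<Rightarrow> real"
  assumes [measurable]: "h \<in> borel_measurable borel"
    and [measurable]: "(\<lambda>(\<tau>, \<omega>). X \<tau> \<omega>) \<in> borel_measurable (borel \<Otimes>\<^sub>M M)"
  shows "(\<integral>\<^sup>+\<omega>. \<integral>\<^sup>+\<tau>. ennreal \<bar>h \<tau> * X \<tau> \<omega>\<bar> \<partial>lborel \<partial>M)
    = (\<integral>\<^sup>+\<tau>. ennreal \<bar>h \<tau>\<bar> * (\<integral>\<^sup>+\<omega>. ennreal \<bar>X \<tau> \<omega>\<bar> \<partial>M) \<partial>lborel)"
proof -
  interpret P: pair_sigma_finite "lborel :: real measure" M ..
  have [measurable]: "(\<lambda>x. X (fst x) (snd x)) \<in> borel_measurable (borel \<Otimes>\<^sub>M M)"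
    using assms(2) by (simp add: split_beta')
  have [measurable]: "(\<lambda>\<omega>. X \<tau> \<omega>) \<in> borel_measurable M" for \<tau>
    using measurable_compose[OF measurable_Pair1' assms(2)] by simp
  have "(\<integral>\<^sup>+\<omega>. \<integral>\<^sup>+\<tau>. ennreal \<bar>h \<tau> * X \<tau> \<omega>\<bar> \<partial>lborel \<partial>M) = (\<integral>\<^sup>+\<tau>. \<integral>\<^sup>+\<omega>. ennreal \<bar>h \<tau> * X \<tau> \<omega>\<bar> \<partial>M \<partial>lborel)"
    by (rule P.Fubini'[of "\<lambda>\<tau> \<omega>. ennreal \<bar>h \<tau> * X \<tau> \<omega>\<bar>"]) measurable
  also have "\<dots> = (\<integral>\<^sup>+\<tau>. ennreal \<bar>h \<tau>\<bar> * (\<integral>\<^sup>+\<omega>. ennreal \<bar>X \<tau> \<omega>\<bar> \<partial>M) \<partial>lborel)"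
    by (simp add: abs_mult ennreal_mult nn_integral_cmult)
  finally show ?thesis .
qed

text \<open>The absolute first moments of the process are bounded uniformly in time, so by Tonelli the integral of
\<open>\<bar>h \<tau> * \<Phi> \<tau>\<bar>\<close> has finite expectation.\<close>

lemma AE_integrable_path:
  assumes h: "integrable lborel h"
  shows "AE \<omega> in M. integrable lborel (\<lambda>\<tau>. h \<tau> * \<Phi> \<tau> \<omega>)"
proof -
  have [measurable]: "h \<in> borel_measurable borel" using h by auto
  have "(\<integral>\<^sup>+\<omega>. \<integral>\<^sup>+\<tau>. ennreal \<bar>h \<tau> * \<Phi> \<tau> \<omega>\<bar> \<partial>lborel \<partial>M)
    = (\<integral>\<^sup>+\<tau>. ennreal \<bar>h \<tau>\<bar> * (\<integral>\<^sup>+\<omega>. ennreal \<bar>\<Phi> \<tau> \<omega>\<bar> \<partial>M) \<partial>lborel)"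
    by (rule nn_integral_weighted_path) measurable
  also have "\<dots> \<le> (\<integral>\<^sup>+\<tau>. ennreal \<bar>h \<tau>\<bar> * ennreal (C 0 + mean\<^sup>2 + 1) \<partial>lborel)"
    by (intro nn_integral_mono mult_left_mono nn_expectation_abs_\<Phi>) simp
  also have "\<dots> = (\<integral>\<^sup>+\<tau>. ennreal \<bar>h \<tau>\<bar> \<partial>lborel) * ennreal (C 0 + mean\<^sup>2 + 1)"
    by (rule nn_integral_multc) measurable
  also have "\<dots> < \<infinity>"
    using h by (simp add: integrable_iff_bounded ennreal_mult_less_top)
  finally have "AE \<omega> in M. (\<integral>\<^sup>+\<tau>. ennreal \<bar>h \<tau> * \<Phi> \<tau> \<omega>\<bar> \<partial>lborel) \<noteq> \<infinity>"
    by (intro nn_integral_PInf_AE) auto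
  then show ?thesis
    using AE_space
  proof eventually_elim
    case (elim \<omega>)
    show ?case
    proof (rule integrableI_bounded)
      show "(\<lambda>\<tau>. h \<tau> * \<Phi> \<tau> \<omega>) \<in> borel_measurable lborel"
        using elim(2) by measurable
    qed (use elim(1) in \<open>simp add: less_top\<close>)
  qed
qed

text \<open>The error is at most the integral over \<open>\<tau>\<close> of \<open>\<bar>h \<tau>\<bar>\<close> times the mean distance of \<open>\<Phi> \<tau>\<close> from the
sampled process. That distance tends to \<open>0\<close> by continuity in mean and is bounded uniformly, so dominated
convergence applies.\<close>

lemma path_step_tendsto:
  assumes h: "integrable lborel h"
  shows "(\<lambda>n. \<integral>\<^sup>+\<omega>. ennreal \<bar>(LINT \<tau>|lborel. h \<tau> * \<Phi> \<tau> \<omega>) - (\<Sum>\<sigma>\<in>grid n. grid_weight h n \<sigma> * \<Phi> \<sigma> \<omega>)\<bar> \<partial>M) \<longlonglongrightarrow> 0"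
proof (rule tendsto_sandwich[OF _ _ tendsto_const])
  have [measurable]: "h \<in> borel_measurable borel" using h by auto
  let ?K = "C 0 + mean\<^sup>2 + 1"
  let ?err = "\<lambda>n \<omega>. \<bar>(LINT \<tau>|lborel. h \<tau> * \<Phi> \<tau> \<omega>) - (\<Sum>\<sigma>\<in>grid n. grid_weight h n \<sigma> * \<Phi> \<sigma> \<omega>)\<bar>"
  define D where "D n \<tau> \<omega> = \<Phi> \<tau> \<omega> - grid_step n (\<lambda>\<sigma>. \<Phi> \<sigma> \<omega>) \<tau>" for n \<tau> \<omega>
  have [measurable]: "grid n \<in> sets borel" for n
    by (intro borel_closed finite_imp_closed finite_grid)
  have D_meas: "(\<lambda>(\<tau>, \<omega>). D n \<tau> \<omega>) \<in> borel_measurable (borel \<Otimes>\<^sub>M M)" for n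
    unfolding D_def grid_step_def by measurable
  have [measurable]: "D n \<tau> \<in> borel_measurable M" for n \<tau>
    unfolding D_def[abs_def] grid_step_def by measurable
  have [measurable]: "(\<lambda>x. D n (fst x) (snd x)) \<in> borel_measurable (borel \<Otimes>\<^sub>M M)" for n
    using D_meas by (simp add: split_beta')
  show "\<forall>\<^sub>F n in sequentially. 0 \<le> (\<integral>\<^sup>+\<omega>. ennreal (?err n \<omega>) \<partial>M)"
    by simp
  show "\<forall>\<^sub>F n in sequentially. (\<integral>\<^sup>+\<omega>. ennreal (?err n \<omega>) \<partial>M)
     \<le> (\<integral>\<^sup>+\<tau>. ennreal \<bar>h \<tau>\<bar> * (\<integral>\<^sup>+\<omega>. ennreal \<bar>D n \<tau> \<omega>\<bar> \<partial>M) \<partial>lborel)"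
  proof (intro always_eventually allI)
    fix n
    have "(\<integral>\<^sup>+\<omega>. ennreal (?err n \<omega>) \<partial>M)
      \<le> (\<integral>\<^sup>+\<omega>. \<integral>\<^sup>+\<tau>. ennreal \<bar>h \<tau> * D n \<tau> \<omega>\<bar> \<partial>lborel \<partial>M)"
    proof (rule nn_integral_mono_AE)
      show "AE \<omega> in M. ennreal (?err n \<omega>)
        \<le> (\<integral>\<^sup>+\<tau>. ennreal \<bar>h \<tau> * D n \<tau> \<omega>\<bar> \<partial>lborel)"
        using AE_integrable_path[OF h]
      proof eventually_elim
        case (elim \<omega>)
        have s: "integrable lborel (\<lambda>\<tau>. h \<tau> * grid_step n (\<lambda>\<sigma>. \<Phi> \<sigma> \<omega>) \<tau>)"
          "(\<Sum>\<sigma>\<in>grid n. grid_weight h n \<sigma> * \<Phi> \<sigma> \<omega>) = (LINT \<tau>|lborel. h \<tau> * grid_step n (\<lambda>\<sigma>. \<Phi> \<sigma> \<omega>) \<tau>)"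
          using sum_grid_weight[OF h, of n "\<lambda>\<sigma>. \<Phi> \<sigma> \<omega>"] by simp_all
        have "integrable lborel (\<lambda>\<tau>. h \<tau> * D n \<tau> \<omega>)"
          unfolding D_def right_diff_distrib using elim s(1) by simp
        from integral_norm_bound_ennreal[OF this]
        have "ennreal \<bar>LINT \<tau>|lborel. h \<tau> * D n \<tau> \<omega>\<bar> \<le> (\<integral>\<^sup>+\<tau>. ennreal \<bar>h \<tau> * D n \<tau> \<omega>\<bar> \<partial>lborel)"
          by simp
        moreover have "(LINT \<tau>|lborel. h \<tau> * D n \<tau> \<omega>)
           = (LINT \<tau>|lborel. h \<tau> * \<Phi> \<tau> \<omega>) - (\<Sum>\<sigma>\<in>grid n. grid_weight h n \<sigma> * \<Phi> \<sigma> \<omega>)"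
          unfolding D_def right_diff_distrib s(2) using elim s(1) by simp
        ultimately show ?case by simp
      qed
    qed
    also have "\<dots> = (\<integral>\<^sup>+\<tau>. ennreal \<bar>h \<tau>\<bar> * (\<integral>\<^sup>+\<omega>. ennreal \<bar>D n \<tau> \<omega>\<bar> \<partial>M) \<partial>lborel)"
      by (rule nn_integral_weighted_path[OF _ D_meas]) measurable
    finally show "(\<integral>\<^sup>+\<omega>. ennreal (?err n \<omega>) \<partial>M) \<le> \<dots>" .
  qed
  have D_bound: "(\<integral>\<^sup>+\<omega>. ennreal \<bar>D n \<tau> \<omega>\<bar> \<partial>M) \<le> ennreal ?K + ennreal ?K" for n \<tau>
  proof -
    let ?g = "\<lambda>\<omega>. grid_step n (\<lambda>\<sigma>. \<Phi> \<sigma> \<omega>) \<tau>"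
    have [measurable]: "?g \<in> borel_measurable M" unfolding grid_step_def by measurable
    have "(\<integral>\<^sup>+\<omega>. ennreal \<bar>D n \<tau> \<omega>\<bar> \<partial>M) \<le> (\<integral>\<^sup>+\<omega>. ennreal \<bar>\<Phi> \<tau> \<omega>\<bar> + ennreal \<bar>?g \<omega>\<bar> \<partial>M)"
      by (intro nn_integral_mono) (simp add: D_def ennreal_plus[symmetric] del: ennreal_plus)
    also have "\<dots> = (\<integral>\<^sup>+\<omega>. ennreal \<bar>\<Phi> \<tau> \<omega>\<bar> \<partial>M) + (\<integral>\<^sup>+\<omega>. ennreal \<bar>?g \<omega>\<bar> \<partial>M)"
      by (rule nn_integral_add) measurable
    also have "\<dots> \<le> ennreal ?K + ennreal ?K"
    proof (intro add_mono nn_expectation_abs_\<Phi>)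
      show "(\<integral>\<^sup>+\<omega>. ennreal \<bar>?g \<omega>\<bar> \<partial>M) \<le> ennreal ?K"
        using nn_expectation_abs_\<Phi>[of "grid_round n \<tau>"]
        by (cases "grid_round n \<tau> \<in> grid n") (simp_all add: grid_step_def)
    qed
    finally show ?thesis .
  qed
  have D_lim: "(\<lambda>n. \<integral>\<^sup>+\<omega>. ennreal \<bar>D n \<tau> \<omega>\<bar> \<partial>M) \<longlonglongrightarrow> 0" for \<tau>
  proof (rule tendsto_sandwich[OF _ _ tendsto_const])
    show "\<forall>\<^sub>F n in sequentially. (\<integral>\<^sup>+\<omega>. ennreal \<bar>D n \<tau> \<omega>\<bar> \<partial>M) \<le> ennreal (sqrt (2 * (C 0 - C (\<tau> - grid_round n \<tau>))))"
      using eventually_grid_round_in_grid[of \<tau>]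
    proof eventually_elim
      case (elim n)
      then have "(\<integral>\<^sup>+\<omega>. ennreal \<bar>D n \<tau> \<omega>\<bar> \<partial>M) = (\<integral>\<^sup>+\<omega>. ennreal \<bar>\<Phi> \<tau> \<omega> - \<Phi> (grid_round n \<tau>) \<omega>\<bar> \<partial>M)"
        by (simp add: D_def grid_step_def)
      also have "\<dots> = ennreal (expectation (\<lambda>\<omega>. \<bar>\<Phi> \<tau> \<omega> - \<Phi> (grid_round n \<tau>) \<omega>\<bar>))"
        by (rule nn_integral_eq_integral) auto
      also have "\<dots> \<le> ennreal (sqrt (2 * (C 0 - C (\<tau> - grid_round n \<tau>))))"
        by (intro ennreal_leI expectation_abs_\<Phi>_diff)
      finally show ?case .
    qed
    have "(\<lambda>n. \<tau> - grid_round n \<tau>) \<longlonglongrightarrow> \<tau> - \<tau>"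
      by (intro tendsto_intros grid_round_tendsto)
    then have "(\<lambda>n. C (\<tau> - grid_round n \<tau>)) \<longlonglongrightarrow> C 0"
      by (intro C_tendsto_0) simp
    then have "(\<lambda>n. ennreal (sqrt (2 * (C 0 - C (\<tau> - grid_round n \<tau>))))) \<longlonglongrightarrow> ennreal (sqrt (2 * (C 0 - C 0)))"
      by (intro tendsto_intros tendsto_ennrealI)
    then show "(\<lambda>n. ennreal (sqrt (2 * (C 0 - C (\<tau> - grid_round n \<tau>))))) \<longlonglongrightarrow> 0" by simp
  qed simp
  have "(\<lambda>n. \<integral>\<^sup>+\<tau>. ennreal \<bar>h \<tau>\<bar> * (\<integral>\<^sup>+\<omega>. ennreal \<bar>D n \<tau> \<omega>\<bar> \<partial>M) \<partial>lborel) \<longlonglongrightarrow> (\<integral>\<^sup>+(\<tau>::real). 0 \<partial>lborel)"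
  proof (rule nn_integral_dominated_convergence[where w = "\<lambda>\<tau>. ennreal \<bar>h \<tau>\<bar> * (ennreal ?K + ennreal ?K)"])
    show "AE \<tau> in lborel. ennreal \<bar>h \<tau>\<bar> * (\<integral>\<^sup>+\<omega>. ennreal \<bar>D n \<tau> \<omega>\<bar> \<partial>M) \<le> ennreal \<bar>h \<tau>\<bar> * (ennreal ?K + ennreal ?K)" for n
      by (intro AE_I2 mult_left_mono D_bound) simp
    show "(\<integral>\<^sup>+\<tau>. ennreal \<bar>h \<tau>\<bar> * (ennreal ?K + ennreal ?K) \<partial>lborel) < \<infinity>"
      using h by (subst nn_integral_multc) (auto simp: integrable_iff_bounded ennreal_mult_less_top)
    show "AE \<tau> in lborel. (\<lambda>n. ennreal \<bar>h \<tau>\<bar> * (\<integral>\<^sup>+\<omega>. ennreal \<bar>D n \<tau> \<omega>\<bar> \<partial>M)) \<longlonglongrightarrow> 0"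
      using ennreal_tendsto_cmult[OF _ D_lim] by (intro AE_I2) (simp add: ennreal_less_top)
  qed measurable
  then show "(\<lambda>n. \<integral>\<^sup>+\<tau>. ennreal \<bar>h \<tau>\<bar> * (\<integral>\<^sup>+\<omega>. ennreal \<bar>D n \<tau> \<omega>\<bar> \<partial>M) \<partial>lborel) \<longlonglongrightarrow> 0" by simp
qed

text \<open>The finite sums of \<open>path_step_tendsto\<close> converge in mean, so their characteristic functions converge. On
the other side the sums of \<open>grid_weight h n \<sigma>\<close> times \<open>exp (\<i> * l * \<sigma>)\<close> converge to the Fourier
transform of \<open>h\<close> boundedly in \<open>l\<close>, and the spectral measure is finite.\<close>

theorem char_path_integral:
  assumes h: "integrable lborel h"
  shows "(CLINT \<omega>|M. iexp (LINT \<tau>|lborel. h \<tau> * \<Phi> \<tau> \<omega>))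
    = iexp (mean * (LINT \<tau>|lborel. h \<tau>)) *
      complex_of_real (exp (- (LINT l|F. (cmod (fourier_plus (\<lambda>\<tau>. complex_of_real (h \<tau>)) l))\<^sup>2) / 2))"
proof (rule LIMSEQ_unique)
  have [measurable]: "h \<in> borel_measurable borel" using h by auto
  let ?H = "fourier_plus (\<lambda>\<tau>. complex_of_real (h \<tau>))"
  let ?X = "\<lambda>\<omega>. LINT \<tau>|lborel. h \<tau> * \<Phi> \<tau> \<omega>"
  let ?S = "\<lambda>n \<omega>. \<Sum>\<sigma>\<in>grid n. grid_weight h n \<sigma> * \<Phi> \<sigma> \<omega>"
  let ?a = "\<lambda>n l. \<Sum>\<sigma>\<in>grid n. grid_weight h n \<sigma> *\<^sub>R iexp (l * \<sigma>)"
  have [measurable]: "?X \<in> borel_measurable M" by measurable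
  have lim: "(\<lambda>n. norm ((CLINT \<omega>|M. iexp (?S n \<omega>)) - (CLINT \<omega>|M. iexp (?X \<omega>)))) \<longlonglongrightarrow> 0"
  proof -
    have i: "integrable M (\<lambda>\<omega>. iexp (?X \<omega>))" "integrable M (\<lambda>\<omega>. iexp (?S n \<omega>))" for n
      by (rule integrable_const_bound[of _ 1]; simp)+
    have "ennreal (norm ((CLINT \<omega>|M. iexp (?S n \<omega>)) - (CLINT \<omega>|M. iexp (?X \<omega>))))
      \<le> (\<integral>\<^sup>+\<omega>. ennreal \<bar>?X \<omega> - ?S n \<omega>\<bar> \<partial>M)" for n
    proof -
      have "ennreal (norm ((CLINT \<omega>|M. iexp (?S n \<omega>)) - (CLINT \<omega>|M. iexp (?X \<omega>))))
        = ennreal (norm (CLINT \<omega>|M. iexp (?S n \<omega>) - iexp (?X \<omega>)))"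
        using i by simp
      also have "\<dots> \<le> (\<integral>\<^sup>+\<omega>. norm (iexp (?S n \<omega>) - iexp (?X \<omega>)) \<partial>M)"
        by (intro integral_norm_bound_ennreal Bochner_Integration.integrable_diff i)
      also have "\<dots> \<le> (\<integral>\<^sup>+\<omega>. ennreal \<bar>?X \<omega> - ?S n \<omega>\<bar> \<partial>M)"
        by (intro nn_integral_mono ennreal_leI) (subst abs_minus_commute, rule norm_iexp_diff)
      finally show ?thesis .
    qed
    then have "(\<lambda>n. ennreal (norm ((CLINT \<omega>|M. iexp (?S n \<omega>)) - (CLINT \<omega>|M. iexp (?X \<omega>))))) \<longlonglongrightarrow> 0"
      by (intro tendsto_sandwich[OF _ _ tendsto_const path_step_tendsto[OF h]] always_eventually allI) auto
    then show ?thesis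
      by (intro tendsto_ennrealD) (simp_all del: tendsto_ennreal_iff)
  qed
  then show "(\<lambda>n. CLINT \<omega>|M. iexp (?S n \<omega>)) \<longlonglongrightarrow> (CLINT \<omega>|M. iexp (?X \<omega>))"
    by (rule LIM_zero_cancel[OF tendsto_norm_zero_cancel])
  have cont: "continuous_on UNIV (\<lambda>\<tau>. iexp (l * \<tau>))" for l by (intro continuous_intros)
  have a_lim: "(\<lambda>n. ?a n l) \<longlonglongrightarrow> ?H l" for l
    using sum_grid_weight_tendsto(1)[OF h cont[of l]] by (simp add: fourier_plus_def scaleR_conv_of_real mult.commute)
  have a_bound: "norm (?a n l) \<le> (LINT \<tau>|lborel. \<bar>h \<tau>\<bar>)" for n l
    by (rule sum_grid_weight_tendsto(2)[OF h cont]) simp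
  have var: "(\<lambda>n. LINT l|F. (cmod (?a n l))\<^sup>2) \<longlonglongrightarrow> (LINT l|F. (cmod (?H l))\<^sup>2)"
  proof (rule integral_dominated_convergence[where w = "\<lambda>_. (LINT \<tau>|lborel. \<bar>h \<tau>\<bar>)\<^sup>2"])
    show "(\<lambda>l. (cmod (?H l))\<^sup>2) \<in> borel_measurable F"
      unfolding fourier_plus_def by measurable
    show "AE l in F. (\<lambda>n. (cmod (?a n l))\<^sup>2) \<longlonglongrightarrow> (cmod (?H l))\<^sup>2"
      by (intro AE_I2 tendsto_intros a_lim)
    show "AE l in F. norm ((cmod (?a n l))\<^sup>2) \<le> (LINT \<tau>|lborel. \<bar>h \<tau>\<bar>)\<^sup>2" for n
      using power_mono[OF a_bound norm_ge_zero] by (intro AE_I2) simp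
  qed auto
  have sum: "(\<lambda>n. \<Sum>\<sigma>\<in>grid n. grid_weight h n \<sigma>) \<longlonglongrightarrow> (LINT \<tau>|lborel. h \<tau>)"
    using sum_grid_weight_tendsto(1)[OF h, of "\<lambda>_. 1 :: real"] by simp
  show "(\<lambda>n. CLINT \<omega>|M. iexp (?S n \<omega>)) \<longlonglongrightarrow> iexp (mean * (LINT \<tau>|lborel. h \<tau>)) *
      complex_of_real (exp (- (LINT l|F. (cmod (?H l))\<^sup>2) / 2))"
    unfolding char_sum_\<Phi>[OF finite_grid]
    by (intro tendsto_intros tendsto_of_real var sum) simp_all
qed

end

section \<open>Kernels without nonpositive frequencies\<close>

text \<open>Uniqueness of characteristic functions identifies the law of \<open>X\<close>, either as a normal law or, for
\<open>S = 0\<close>, as a point mass; the moments are then known.\<close>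

lemma (in prob_space) gaussian_moments_of_char:
  assumes [measurable]: "X \<in> borel_measurable M" and S: "0 \<le> S"
    and char: "\<And>t. (CLINT \<omega>|M. iexp (t * X \<omega>)) = complex_of_real (exp (- t\<^sup>2 * S / 2))"
  shows "integrable M X" "expectation X = 0" "integrable M (\<lambda>\<omega>. (X \<omega>)\<^sup>2)" "expectation (\<lambda>\<omega>. (X \<omega>)\<^sup>2) = S"
proof -
  have rd: "real_distribution (distr M borel X)" by (rule real_distribution_distr) measurable
  have ch: "char (distr M borel X) = (\<lambda>t. complex_of_real (exp (- t\<^sup>2 * S / 2)))"
  proof (rule ext)
    fix t
    have "char (distr M borel X) t = (CLINT \<omega>|M. iexp (t * X \<omega>))"
      unfolding char_def by (rule integral_distr) measurable
    then show "char (distr M borel X) t = complex_of_real (exp (- t\<^sup>2 * S / 2))"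
      unfolding char .
  qed
  have "gaussian_variable M X \<and> expectation X = 0 \<and> variance X = S"
  proof (cases "S = 0")
    case True
    have "distr M borel X = distr M borel (\<lambda>_. 0)"
    proof (rule Levy_uniqueness[OF rd])
      show "real_distribution (distr M borel (\<lambda>_. 0))" by (rule real_distribution_distr) measurable
      show "char (distr M borel X) = char (distr M borel (\<lambda>_. 0))"
      proof (rule ext)
        fix t
        have "char (distr M borel (\<lambda>_. 0)) t = (CLINT \<omega>|M. iexp (t * 0))"
          unfolding char_def by (rule integral_distr) measurable
        then show "char (distr M borel X) t = char (distr M borel (\<lambda>_. 0)) t"
          unfolding ch by (simp add: True prob_space)
      qed
    qed
    moreover have "AE x in distr M borel (\<lambda>_. 0). x = (0::real)"
      by (subst AE_distr_iff) auto
      ultimately have "AE x in distr M borel X. x = 0" by (simp only:)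
    then have ae: "AE \<omega> in M. X \<omega> = 0" by (subst (asm) AE_distr_iff) auto
    then have "gaussian_variable M X" by (auto simp: gaussian_variable_def)
    moreover have e: "expectation X = 0"
      using ae by (subst integral_cong_AE[where g = "\<lambda>_. 0"]) auto
    moreover have "variance X = 0"
      unfolding e using ae by (subst integral_cong_AE[where g = "\<lambda>_. 0"]) auto
    ultimately show ?thesis using True by simp
  next
    case False
    then have sq: "0 < sqrt S" using S by simp
    let ?N = "density lborel (\<lambda>x. ennreal (normal_density 0 (sqrt S) x))"
    have "distr M borel X = ?N"
    proof (rule Levy_uniqueness[OF rd])
      show "real_distribution ?N"
        unfolding real_distribution_def real_distribution_axioms_def
        using prob_space_normal_density[OF sq] by auto
      have "char ?N t = complex_of_real (exp (- (sqrt S)\<^sup>2 * t\<^sup>2 / 2))" for t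
        unfolding char_def char_normal_density[OF sq, symmetric]
        by (subst integral_density) (auto simp: scaleR_conv_of_real)
      then show "char (distr M borel X) = char ?N"
        unfolding ch using S by (simp add: fun_eq_iff mult.commute)
    qed
    then have D: "distributed M lborel X (\<lambda>x. ennreal (normal_density 0 (sqrt S) x))"
      unfolding distributed_def by (auto cong: distr_cong)
    then have "gaussian_variable M X" unfolding gaussian_variable_def using sq by auto
    then show ?thesis
      using normal_distributed_expectation[OF sq D] normal_distributed_variance[OF sq D] S by simp
  qed
  then have g: "gaussian_variable M X" and e: "expectation X = 0" and v: "variance X = S" by auto
  show "integrable M X" "integrable M (\<lambda>\<omega>. (X \<omega>)\<^sup>2)" by (rule gaussian_variable_moments[OF g])+
  show "expectation X = 0" by (rule e)
  show "expectation (\<lambda>\<omega>. (X \<omega>)\<^sup>2) = S" using v unfolding e by simp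
qed

text \<open>The transform of the conjugate kernel at \<open>l\<close> is the conjugate of the transform at \<open>- l\<close>.\<close>

lemma fourier_plus_Re:
  assumes g: "integrable lborel g"
  shows "fourier_plus (\<lambda>\<tau>. complex_of_real (Re (g \<tau>))) l = (fourier_plus g l + cnj (fourier_plus g (- l))) / 2"
proof -
  have [measurable]: "g \<in> borel_measurable borel" using g by auto
  have i: "integrable lborel (\<lambda>\<tau>. iexp (l * \<tau>) * g \<tau>)" for l
    by (rule Bochner_Integration.integrable_bound[OF g]) (auto simp: norm_mult)
  have "cnj (fourier_plus g (- l)) = (CLINT \<tau>|lborel. cnj (iexp (- l * \<tau>) * g \<tau>))"
    unfolding fourier_plus_def by (rule Bochner_Integration.integral_cnj[symmetric])
  also have "\<dots> = (CLINT \<tau>|lborel. iexp (l * \<tau>) * cnj (g \<tau>))"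
    by (simp add: exp_cnj)
  finally have c: "cnj (fourier_plus g (- l)) = (CLINT \<tau>|lborel. iexp (l * \<tau>) * cnj (g \<tau>))" .
  have [measurable]: "(\<lambda>\<tau>. cnj (g \<tau>)) \<in> borel_measurable borel"
    using borel_measurable_integrable[OF integrable_cnj[OF g]] by simp
  have ic: "integrable lborel (\<lambda>\<tau>. iexp (l * \<tau>) * cnj (g \<tau>))"
    by (rule Bochner_Integration.integrable_bound[OF g]) (auto simp: norm_mult)
  have "fourier_plus g l + cnj (fourier_plus g (- l)) = (CLINT \<tau>|lborel. iexp (l * \<tau>) * g \<tau> + iexp (l * \<tau>) * cnj (g \<tau>))"
    unfolding c using i[of l] ic by (simp add: fourier_plus_def)
  also have "\<dots> = (CLINT \<tau>|lborel. 2 * (iexp (l * \<tau>) * complex_of_real (Re (g \<tau>))))"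
    by (simp only: distrib_left[symmetric] complex_add_cnj) (simp add: mult_ac)
  also have "\<dots> = 2 * fourier_plus (\<lambda>\<tau>. complex_of_real (Re (g \<tau>))) l"
    unfolding fourier_plus_def by (rule integral_mult_right_zero)
  finally show ?thesis by simp
qed

lemma fourier_plus_cmult: "fourier_plus (\<lambda>\<tau>. c * g \<tau>) l = c * fourier_plus g l"
  unfolding fourier_plus_def by (subst integral_mult_right_zero[symmetric]) (simp only: mult.left_commute)

text \<open>Vanishing at the frequency \<open>0\<close> is included: it removes the constant mean of the process.\<close>

definition analytic_kernel :: "(real \<Rightarrow> complex) \<Rightarrow> bool" where
  "analytic_kernel g \<longleftrightarrow> integrable lborel g \<and> (\<forall>l\<le>0. fourier_plus g l = 0)"

lemma analytic_kernel_cmult: "analytic_kernel g \<Longrightarrow> analytic_kernel (\<lambda>\<tau>. c * g \<tau>)"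
  by (auto simp: analytic_kernel_def fourier_plus_cmult)

lemma fourier_plus_add:
  assumes "integrable lborel g" "integrable lborel h"
  shows "fourier_plus (\<lambda>\<tau>. g \<tau> + h \<tau>) l = fourier_plus g l + fourier_plus h l"
proof -
  have i: "integrable lborel (\<lambda>\<tau>. iexp (l * \<tau>) * k \<tau>)" if k: "integrable lborel k" for k :: "real \<Rightarrow> complex"
    by (rule Bochner_Integration.integrable_bound[OF k])
      (use k in \<open>auto simp: norm_mult intro!: borel_measurable_times\<close>)
  show ?thesis
    unfolding fourier_plus_def distrib_left
    by (rule Bochner_Integration.integral_add) (intro i assms)+
qed

lemma analytic_kernel_sum:
  "finite I \<Longrightarrow> (\<And>i. i \<in> I \<Longrightarrow> analytic_kernel (g i)) \<Longrightarrow> analytic_kernel (\<lambda>\<tau>. \<Sum>i\<in>I. g i \<tau>)"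
proof (induction I rule: finite_induct)
  case empty
  show ?case by (simp add: analytic_kernel_def fourier_plus_def)
next
  case (insert i I)
  then have "analytic_kernel (g i)" "analytic_kernel (\<lambda>\<tau>. \<Sum>i\<in>I. g i \<tau>)" by auto
  then show ?case using insert.hyps by (auto simp: analytic_kernel_def fourier_plus_add)
qed

text \<open>One of the two frequencies \<open>l\<close> and \<open>- l\<close> is nonpositive, so the cross term of the square vanishes.\<close>

lemma norm_fourier_plus_Re:
  assumes "analytic_kernel g"
  shows "(cmod (fourier_plus (\<lambda>\<tau>. complex_of_real (Re (g \<tau>))) l))\<^sup>2 = ((cmod (fourier_plus g l))\<^sup>2 + (cmod (fourier_plus g (- l)))\<^sup>2) / 4"
proof -
  have g: "integrable lborel g" "\<And>l. l \<le> 0 \<Longrightarrow> fourier_plus g l = 0"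
    using assms by (auto simp: analytic_kernel_def)
  show ?thesis
    unfolding fourier_plus_Re[OF g(1)]
    by (cases "l \<le> 0") (simp_all add: g(2) norm_divide power_divide)
qed

lemma complex_integrable_iff:
  fixes f :: "'a \<Rightarrow> complex"
  shows "integrable M f \<longleftrightarrow> integrable M (\<lambda>x. Re (f x)) \<and> integrable M (\<lambda>x. Im (f x))"
proof
  assume "integrable M (\<lambda>x. Re (f x)) \<and> integrable M (\<lambda>x. Im (f x))"
  then have "integrable M (\<lambda>x. complex_of_real (Re (f x)) + \<i> * complex_of_real (Im (f x)))"
    by (intro Bochner_Integration.integrable_add integrable_mult_right integrable_of_real) auto
  then show "integrable M f" by (simp only: complex_eq[symmetric])
qed auto

context stationary_gaussian
begin

definition smear :: "(real \<Rightarrow> complex) \<Rightarrow> 'a \<Rightarrow> complex" where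
  "smear g \<omega> = (CLINT \<tau>|lborel. of_real (\<Phi> \<tau> \<omega>) * g \<tau>)"

lemma borel_measurable_smear [measurable]:
  assumes [measurable]: "g \<in> borel_measurable borel"
  shows "smear g \<in> borel_measurable M"
  unfolding smear_def[abs_def] by measurable

lemma AE_integrable_smear:
  fixes g :: "real \<Rightarrow> complex"
  assumes g: "integrable lborel g"
  shows "AE \<omega> in M. integrable lborel (\<lambda>\<tau>. of_real (\<Phi> \<tau> \<omega>) * g \<tau>)"
proof -
  have "integrable lborel (\<lambda>\<tau>. Re (g \<tau>))" "integrable lborel (\<lambda>\<tau>. Im (g \<tau>))"
    using g by simp_all
  from this[THEN AE_integrable_path] show ?thesis
    by eventually_elim (simp add: complex_integrable_iff mult.commute)
qed

lemma AE_Re_smear: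
  assumes g: "integrable lborel g"
  shows "AE \<omega> in M. Re (smear g \<omega>) = (LINT \<tau>|lborel. Re (g \<tau>) * \<Phi> \<tau> \<omega>)"
  using AE_integrable_smear[OF g]
  by eventually_elim (simp add: smear_def integral_Re[symmetric] mult.commute)

lemma smear_cmult: "smear (\<lambda>\<tau>. c * g \<tau>) \<omega> = c * smear g \<omega>"
  unfolding smear_def by (subst integral_mult_right_zero[symmetric]) (simp only: mult.left_commute)

lemma AE_smear_sum:
  assumes "finite I" "\<And>i. i \<in> I \<Longrightarrow> integrable lborel (g i)"
  shows "AE \<omega> in M. smear (\<lambda>\<tau>. \<Sum>i\<in>I. g i \<tau>) \<omega> = (\<Sum>i\<in>I. smear (g i) \<omega>)"
proof -
  have "AE \<omega> in M. \<forall>i\<in>I. integrable lborel (\<lambda>\<tau>. of_real (\<Phi> \<tau> \<omega>) * g i \<tau>)"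
    using assms by (intro AE_finite_allI AE_integrable_smear)
  then show ?thesis
    by eventually_elim (simp add: smear_def sum_distrib_left)
qed

definition spectral_variance :: "(real \<Rightarrow> complex) \<Rightarrow> real" where
  "spectral_variance g = (LINT l|F. (cmod (fourier_plus (\<lambda>\<tau>. complex_of_real (Re (g \<tau>))) l))\<^sup>2)"

text \<open>For a phase factor \<open>c\<close> this says that the variance of \<open>Re (smear g)\<close> is invariant under rotation of
\<open>smear g\<close>: the coefficient is circular.\<close>

lemma spectral_variance_cmult:
  assumes "analytic_kernel g"
  shows "spectral_variance (\<lambda>\<tau>. c * g \<tau>) = (cmod c)\<^sup>2 * spectral_variance g"
proof -
  have "(cmod (fourier_plus (\<lambda>\<tau>. complex_of_real (Re (c * g \<tau>))) l))\<^sup>2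
      = (cmod c)\<^sup>2 * (cmod (fourier_plus (\<lambda>\<tau>. complex_of_real (Re (g \<tau>))) l))\<^sup>2" for l
    unfolding norm_fourier_plus_Re[OF assms] norm_fourier_plus_Re[OF analytic_kernel_cmult[OF assms]] fourier_plus_cmult
    by (simp add: norm_mult power_mult_distrib algebra_simps)
  then show ?thesis unfolding spectral_variance_def by simp
qed

lemma char_Re_smear:
  assumes g: "analytic_kernel g"
  shows "(CLINT \<omega>|M. iexp (Re (smear g \<omega>))) = complex_of_real (exp (- spectral_variance g / 2))"
proof -
  have i: "integrable lborel g" and van: "\<And>l. l \<le> 0 \<Longrightarrow> fourier_plus g l = 0"
    using g by (auto simp: analytic_kernel_def)
  have [measurable]: "g \<in> borel_measurable borel" using i by auto
  have iR: "integrable lborel (\<lambda>\<tau>. Re (g \<tau>))" using i by simp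
  have "fourier_plus (\<lambda>\<tau>. complex_of_real (Re (g \<tau>))) 0 = 0"
    unfolding fourier_plus_Re[OF i] by (simp add: van)
  then have zero: "(LINT \<tau>|lborel. Re (g \<tau>)) = 0"
    by (simp add: fourier_plus_def)
  have "(CLINT \<omega>|M. iexp (Re (smear g \<omega>))) = (CLINT \<omega>|M. iexp (LINT \<tau>|lborel. Re (g \<tau>) * \<Phi> \<tau> \<omega>))"
    using AE_Re_smear[OF i] by (intro integral_cong_AE) auto
  also have "\<dots> = complex_of_real (exp (- spectral_variance g / 2))"
    unfolding char_path_integral[OF iR] zero spectral_variance_def by simp
  finally show ?thesis .
qed

lemma Re_smear_moments:
  assumes g: "analytic_kernel g"
  shows "integrable M (\<lambda>\<omega>. Re (smear g \<omega>))" "expectation (\<lambda>\<omega>. Re (smear g \<omega>)) = 0"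
    "integrable M (\<lambda>\<omega>. (Re (smear g \<omega>))\<^sup>2)" "expectation (\<lambda>\<omega>. (Re (smear g \<omega>))\<^sup>2) = spectral_variance g"
proof -
  have [measurable]: "g \<in> borel_measurable borel" using g by (auto simp: analytic_kernel_def)
  have m: "(\<lambda>\<omega>. Re (smear g \<omega>)) \<in> borel_measurable M" by measurable
  have nn: "0 \<le> spectral_variance g" unfolding spectral_variance_def by simp
  have char: "(CLINT \<omega>|M. iexp (t * Re (smear g \<omega>))) = complex_of_real (exp (- t\<^sup>2 * spectral_variance g / 2))" for t
    using char_Re_smear[OF analytic_kernel_cmult[OF g, of "of_real t"]]
    by (simp add: smear_cmult spectral_variance_cmult[OF g])
  show "integrable M (\<lambda>\<omega>. Re (smear g \<omega>))" "expectation (\<lambda>\<omega>. Re (smear g \<omega>)) = 0"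
    "integrable M (\<lambda>\<omega>. (Re (smear g \<omega>))\<^sup>2)" "expectation (\<lambda>\<omega>. (Re (smear g \<omega>))\<^sup>2) = spectral_variance g"
    by (rule gaussian_moments_of_char[OF m nn char])+
qed

text \<open>The imaginary part of \<open>smear g\<close> is the real part for the kernel \<open>- \<i> * g\<close>, which has the same
spectral variance.\<close>

lemma smear_moments:
  assumes g: "analytic_kernel g"
  shows "integrable M (smear g)" "(CLINT \<omega>|M. smear g \<omega>) = 0"
    "integrable M (\<lambda>\<omega>. (cmod (smear g \<omega>))\<^sup>2)" "expectation (\<lambda>\<omega>. (cmod (smear g \<omega>))\<^sup>2) = 2 * spectral_variance g"
proof -
  note R = Re_smear_moments[OF g]
  note I = Re_smear_moments[OF analytic_kernel_cmult[OF g, of "- \<i>"], unfolded smear_cmult spectral_variance_cmult[OF g], simplified]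
  show i: "integrable M (smear g)"
    unfolding complex_integrable_iff using R(1) I(1) by simp
  show "(CLINT \<omega>|M. smear g \<omega>) = 0"
    using R(2) I(2) i by (simp add: complex_eq_iff)
  show "integrable M (\<lambda>\<omega>. (cmod (smear g \<omega>))\<^sup>2)" "expectation (\<lambda>\<omega>. (cmod (smear g \<omega>))\<^sup>2) = 2 * spectral_variance g"
    using R(3,4) I(3,4) by (simp_all add: cmod_power2)
qed

text \<open>Eliminates the spectral measure: the second moment alone determines the characteristic function.\<close>

corollary circular_char_smear:
  assumes "analytic_kernel g"
  shows "(CLINT \<omega>|M. iexp (Re (smear g \<omega>))) = complex_of_real (exp (- expectation (\<lambda>\<omega>. (cmod (smear g \<omega>))\<^sup>2) / 4))"
  unfolding char_Re_smear[OF assms] smear_moments(4)[OF assms] by simp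

end

section \<open>The wavelet coefficients\<close>

definition wavelet_atom :: "(real \<Rightarrow> complex) \<Rightarrow> real \<Rightarrow> real \<Rightarrow> real \<Rightarrow> complex" where
  "wavelet_atom \<psi> t s \<tau> = of_real (1 / sqrt s) * cnj (\<psi> ((\<tau> - t) / s))"

lemma wavelet_transform_atom:
  "wavelet_transform \<psi> g t s = (CLINT \<tau>|lborel. of_real (g \<tau>) * wavelet_atom \<psi> t s \<tau>)"
  by (simp add: wavelet_transform_def wavelet_atom_def mult.assoc)

text \<open>Translation and dilation multiply the transform by a phase and rescale the frequency by \<open>s > 0\<close>.
Conjugation of the wavelet is compensated by the sign in \<open>fourier_plus\<close>, so nonpositive frequencies of the
kernel come from nonpositive frequencies of the wavelet.\<close>

lemma analytic_wavelet_atom: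
  assumes \<psi>: "analytic_mother_wavelet \<psi>" and s: "0 < s"
  shows "analytic_kernel (wavelet_atom \<psi> t s)"
proof -
  have i: "integrable lborel \<psi>" and van: "\<And>w. w \<le> 0 \<Longrightarrow> fourier \<psi> w = 0"
    using \<psi> by (auto simp: analytic_mother_wavelet_def)
  have [measurable]: "\<psi> \<in> borel_measurable borel" using i by auto
  let ?g = "\<lambda>\<tau>. cnj (\<psi> ((\<tau> - t) / s))"
  have ic: "integrable lborel (\<lambda>x. cnj (\<psi> x))" using i by simp
  have "integrable lborel (\<lambda>\<tau>. cnj (\<psi> (- t / s + 1 / s * \<tau>)))"
    using lborel_integrable_real_affine[OF ic, of "1 / s" "- t / s"] s by simp
  then have ig: "integrable lborel ?g" by (simp add: diff_divide_distrib)
  have "fourier_plus ?g l = 0" if l: "l \<le> 0" for l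
  proof -
    have "fourier_plus ?g l = \<bar>s\<bar> *\<^sub>R (CLINT x|lborel. iexp (l * (t + s * x)) * cnj (\<psi> ((t + s * x - t) / s)))"
      unfolding fourier_plus_def using s by (intro lborel_integral_real_affine) auto
    also have "(CLINT x|lborel. iexp (l * (t + s * x)) * cnj (\<psi> ((t + s * x - t) / s)))
        = (CLINT x|lborel. iexp (l * t) * cnj (exp (- \<i> * of_real (x * (l * s))) * \<psi> x))"
      using s by (intro Bochner_Integration.integral_cong refl)
        (simp add: exp_cnj distrib_left exp_add mult_ac)
    also have "\<dots> = iexp (l * t) * cnj (fourier \<psi> (l * s))"
      unfolding fourier_def by (simp only: integral_mult_right_zero Bochner_Integration.integral_cnj)
    also have "fourier \<psi> (l * s) = 0" using l s by (intro van) (simp add: mult_le_0_iff)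
    finally show ?thesis by simp
  qed
  with ig have "analytic_kernel ?g" by (simp add: analytic_kernel_def)
  from analytic_kernel_cmult[OF this, of "of_real (1 / sqrt s)"] show ?thesis
    unfolding wavelet_atom_def[abs_def] .
qed

text \<open>The form is a second moment, hence nonnegative. If it vanishes at \<open>v\<close>, then \<open>cdot v W = 0\<close> almost
everywhere, so \<open>\<Gamma> *v v\<close>, whose entries are the expectations of \<open>W $ i * cnj (cdot v W)\<close>, is zero and
invertibility forces \<open>v = 0\<close>.\<close>

lemma second_moment_matrix:
  fixes W :: "'a \<Rightarrow> complex ^ 'n" and \<Gamma> :: "complex ^ 'n ^ 'n"
  assumes W [measurable]: "W \<in> borel_measurable M"
    and sq: "\<And>i. integrable M (\<lambda>\<omega>. (cmod (W \<omega> $ i))\<^sup>2)"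
    and \<Gamma>: "\<And>i j. \<Gamma> $ i $ j = (CLINT \<omega>|M. W \<omega> $ i * cnj (W \<omega> $ j))"
  shows "conj_transpose \<Gamma> = \<Gamma>"
    and "hermitian_form \<Gamma> u = complex_of_real (LINT \<omega>|M. (cmod (cdot u (W \<omega>)))\<^sup>2)"
    and "invertible \<Gamma> \<Longrightarrow> v \<noteq> 0 \<Longrightarrow> 0 < Re (hermitian_form \<Gamma> v)"
proof -
  have i: "integrable M (\<lambda>\<omega>. W \<omega> $ i * cnj (W \<omega> $ j))" for i j
  proof (rule Bochner_Integration.integrable_bound)
    show "integrable M (\<lambda>\<omega>. (cmod (W \<omega> $ i))\<^sup>2 + (cmod (W \<omega> $ j))\<^sup>2)"
      by (intro Bochner_Integration.integrable_add sq)
    have "x * y \<le> x\<^sup>2 + y\<^sup>2" if "0 \<le> x" "0 \<le> y" for x y :: real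
    proof -
      have "0 \<le> x * y" using that by simp
      then show ?thesis using sum_squares_bound[of x y] by linarith
    qed
    then show "AE \<omega> in M. norm (W \<omega> $ i * cnj (W \<omega> $ j)) \<le> norm ((cmod (W \<omega> $ i))\<^sup>2 + (cmod (W \<omega> $ j))\<^sup>2)"
      by (intro AE_I2) (simp add: norm_mult)
  qed (simp add: borel_measurable_complex_iff)
  show "conj_transpose \<Gamma> = \<Gamma>"
    by (simp add: conj_transpose_def vec_eq_iff \<Gamma> Bochner_Integration.integral_cnj[symmetric] mult.commute
        del: Bochner_Integration.integral_cnj)
  have mv: "(\<Gamma> *v u) $ i = (CLINT \<omega>|M. W \<omega> $ i * cnj (cdot u (W \<omega>)))" for u i
  proof -
    have "(\<Gamma> *v u) $ i = (\<Sum>j\<in>UNIV. (CLINT \<omega>|M. W \<omega> $ i * cnj (W \<omega> $ j)) * u $ j)"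
      by (simp add: matrix_vector_mult_def \<Gamma>)
    also have "\<dots> = (CLINT \<omega>|M. (\<Sum>j\<in>UNIV. (W \<omega> $ i * cnj (W \<omega> $ j)) * u $ j))"
      by (simp only: Bochner_Integration.integral_sum Bochner_Integration.integrable_sum
          integrable_mult_left i integral_mult_left_zero)
    finally show ?thesis by (simp add: cdot_def sum_distrib_left mult_ac)
  qed
  have form: "hermitian_form \<Gamma> u = complex_of_real (LINT \<omega>|M. (cmod (cdot u (W \<omega>)))\<^sup>2)" for u
  proof -
    have im: "integrable M (\<lambda>\<omega>. W \<omega> $ i * cnj (cdot u (W \<omega>)))" for i
    proof -
      have "integrable M (\<lambda>\<omega>. \<Sum>j\<in>UNIV. (W \<omega> $ i * cnj (W \<omega> $ j)) * u $ j)"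
        by (intro Bochner_Integration.integrable_sum integrable_mult_left i)
      then show ?thesis by (simp add: cdot_def sum_distrib_left mult_ac)
    qed
    have "hermitian_form \<Gamma> u = (CLINT \<omega>|M. (\<Sum>i\<in>UNIV. cnj (u $ i) * (W \<omega> $ i * cnj (cdot u (W \<omega>)))))"
      unfolding hermitian_form_def mv
      by (simp only: Bochner_Integration.integral_sum Bochner_Integration.integrable_sum
          integrable_mult_right im integral_mult_right_zero)
    also have "\<dots> = (CLINT \<omega>|M. cdot u (W \<omega>) * cnj (cdot u (W \<omega>)))"
      by (simp add: cdot_def[of u] sum_distrib_right mult.assoc)
    also have "\<dots> = (CLINT \<omega>|M. complex_of_real ((cmod (cdot u (W \<omega>)))\<^sup>2))"
      by (simp only: complex_norm_square)
    finally show ?thesis by (simp only: integral_complex_of_real)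
  qed
  then show "hermitian_form \<Gamma> u = complex_of_real (LINT \<omega>|M. (cmod (cdot u (W \<omega>)))\<^sup>2)" .
  assume inv: "invertible \<Gamma>" and v: "v \<noteq> 0"
  have [measurable]: "(\<lambda>\<omega>. cdot u (W \<omega>)) \<in> borel_measurable M" for u
    unfolding cdot_def by measurable
  have [measurable]: "(\<lambda>\<omega>. cnj (cdot u (W \<omega>))) \<in> borel_measurable M" for u
    by (subst borel_measurable_complex_iff) simp
  show "0 < Re (hermitian_form \<Gamma> v)"
  proof (rule ccontr)
    assume "\<not> 0 < Re (hermitian_form \<Gamma> v)"
    then have "(LINT \<omega>|M. (cmod (cdot v (W \<omega>)))\<^sup>2) = 0"
      unfolding form by (simp add: order.antisym not_less)
    moreover have "integrable M (\<lambda>\<omega>. (cmod (cdot v (W \<omega>)))\<^sup>2)"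
    proof -
      have "integrable M (\<lambda>\<omega>. \<Sum>i\<in>UNIV. \<Sum>j\<in>UNIV. (cnj (v $ i) * v $ j) * (W \<omega> $ i * cnj (W \<omega> $ j)))"
        by (intro Bochner_Integration.integrable_sum integrable_mult_right i)
      moreover have "(\<Sum>i\<in>UNIV. \<Sum>j\<in>UNIV. (cnj (v $ i) * v $ j) * (W \<omega> $ i * cnj (W \<omega> $ j)))
          = complex_of_real ((cmod (cdot v (W \<omega>)))\<^sup>2)" for \<omega>
        unfolding complex_norm_square by (simp add: cdot_def sum_product mult_ac) (rule sum.swap)
      ultimately have "integrable M (\<lambda>\<omega>. complex_of_real ((cmod (cdot v (W \<omega>)))\<^sup>2))" by simp
      from integrable_Re[OF this] show ?thesis by simp
    qed
    ultimately have "AE \<omega> in M. (cmod (cdot v (W \<omega>)))\<^sup>2 = 0"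
      by (subst (asm) integral_nonneg_eq_0_iff_AE) auto
    then have ae: "AE \<omega> in M. cdot v (W \<omega>) = 0" by simp
    have "(\<Gamma> *v v) $ i = 0" for i
      unfolding mv using ae by (subst integral_cong_AE[where g = "\<lambda>_. 0"]) auto
    then have "\<Gamma> *v v = 0" by (simp add: vec_eq_iff)
    moreover have "\<forall>x. \<Gamma> *v x = 0 \<longrightarrow> x = 0"
      using inv unfolding matrix_left_invertible_ker[symmetric] invertible_left_inverse .
    ultimately show False using v by blast
  qed
qed

context stationary_gaussian
begin

text \<open>Splitting the transform of the sum requires integrability of both summands; for the noise this holds
only for almost every path.\<close>

lemma wavelet_noise:
  fixes f :: "real \<Rightarrow> real" and t s :: real
  assumes \<psi>: "analytic_mother_wavelet \<psi>"
    and f [measurable]: "f \<in> borel_measurable borel" and bdd: "bounded (range f)"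
    and s: "0 < s"
  defines "W \<equiv> \<lambda>\<omega>. wavelet_transform \<psi> (\<lambda>\<tau>. f \<tau> + \<Phi> \<tau> \<omega>) t s"
  shows "W \<in> borel_measurable M"
    and "AE \<omega> in M. W \<omega> - wavelet_transform \<psi> f t s = smear (wavelet_atom \<psi> t s) \<omega>"
    and "wavelet_transform \<psi> (\<lambda>\<tau>. \<Phi> \<tau> \<omega>) t s = smear (wavelet_atom \<psi> t s) \<omega>"
proof -
  let ?g = "wavelet_atom \<psi> t s"
  have g: "integrable lborel ?g"
    using analytic_wavelet_atom[OF \<psi> s] by (simp add: analytic_kernel_def)
  have [measurable]: "?g \<in> borel_measurable borel" using g by auto
  show "W \<in> borel_measurable M"
    unfolding W_def wavelet_transform_atom by measurable
  obtain b where b: "\<bar>f \<tau>\<bar> \<le> b" for \<tau> using bdd by (auto simp: bounded_iff)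
  have fg: "integrable lborel (\<lambda>\<tau>. of_real (f \<tau>) * ?g \<tau>)"
  proof (rule Bochner_Integration.integrable_bound)
    show "integrable lborel (\<lambda>\<tau>. of_real b * ?g \<tau>)" by (intro integrable_mult_right g)
    have "\<bar>f \<tau>\<bar> \<le> \<bar>b\<bar>" for \<tau> using b[of \<tau>] by simp
    then show "AE \<tau> in lborel. norm (of_real (f \<tau>) * ?g \<tau>) \<le> norm (of_real b * ?g \<tau>)"
      by (intro AE_I2) (simp add: norm_mult mult_right_mono)
  qed measurable
  show "AE \<omega> in M. W \<omega> - wavelet_transform \<psi> f t s = smear ?g \<omega>"
    using AE_integrable_smear[OF g]
  proof eventually_elim
    case (elim \<omega>)
    have "W \<omega> = wavelet_transform \<psi> f t s + smear ?g \<omega>"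
      unfolding W_def wavelet_transform_atom smear_def of_real_add distrib_right
      by (rule Bochner_Integration.integral_add[OF fg elim])
    then show ?case by simp
  qed
  show "wavelet_transform \<psi> (\<lambda>\<tau>. \<Phi> \<tau> \<omega>) t s = smear ?g \<omega>"
    by (simp add: wavelet_transform_atom smear_def)
qed

text \<open>A combination of the centred coefficients is almost surely the smeared process for the corresponding
combination of kernels. This combination is again analytic, so \<open>circular_char_smear\<close> gives the
characteristic function required by \<open>circular_gaussian_density\<close>.\<close>

lemma wavelet_vector_distributed:
  fixes f :: "real \<Rightarrow> real" and t s :: "real ^ 'n"
  assumes \<psi>: "analytic_mother_wavelet \<psi>"
    and f: "f \<in> borel_measurable borel" and bdd: "bounded (range f)"
    and s: "\<And>i. 0 < s $ i"
  defines "W \<equiv> \<lambda>\<omega>. wavelet_vector \<psi> (\<lambda>\<tau>. f \<tau> + \<Phi> \<tau> \<omega>) t s"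
    and "m \<equiv> wavelet_vector \<psi> f t s"
  defines "\<Gamma> \<equiv> covariance_matrix M W"
  shows "\<Gamma> $ i $ i = complex_of_real (expectation (\<lambda>\<omega>. (cmod (wavelet_transform \<psi> (\<lambda>\<tau>. \<Phi> \<tau> \<omega>) (t $ i) (s $ i)))\<^sup>2))"
    and "invertible \<Gamma> \<Longrightarrow> complex_gaussian_density m \<Gamma> w \<in> \<real>\<^sub>\<ge>\<^sub>0"
    and "invertible \<Gamma> \<Longrightarrow> distributed M lborel W (\<lambda>w. ennreal (Re (complex_gaussian_density m \<Gamma> w)))"
proof -
  define g where "g i = wavelet_atom \<psi> (t $ i) (s $ i)" for i
  have g: "analytic_kernel (g i)" for i
    unfolding g_def by (rule analytic_wavelet_atom[OF \<psi> s])
  then have gi: "integrable lborel (g i)" for i by (simp add: analytic_kernel_def)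
  have gm [measurable]: "g i \<in> borel_measurable borel" for i using gi[of i] by auto
  define Z where "Z \<omega> = W \<omega> - m" for \<omega>
  have comp: "(\<lambda>\<omega>. W \<omega> $ i) \<in> borel_measurable M" "AE \<omega> in M. Z \<omega> $ i = smear (g i) \<omega>" for i
    using wavelet_noise(1,2)[OF \<psi> f bdd s[of i], of "t $ i"]
    by (simp_all add: W_def Z_def m_def wavelet_vector_def g_def)
  have W [measurable]: "W \<in> borel_measurable M"
    unfolding borel_measurable_euclidean_space[where 'c = "complex ^ 'n"]
    using comp(1) by (auto simp: Basis_vec_def inner_axis)
  have Z [measurable]: "Z \<in> borel_measurable M" unfolding Z_def[abs_def] by measurable
  have all: "AE \<omega> in M. \<forall>i. Z \<omega> $ i = smear (g i) \<omega>"
    using comp(2) by (simp add: AE_all_countable)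
  have ZS: "integrable M (\<lambda>\<omega>. Z \<omega> $ i)" "(CLINT \<omega>|M. Z \<omega> $ i) = 0"
    "integrable M (\<lambda>\<omega>. (cmod (Z \<omega> $ i))\<^sup>2)"
    "expectation (\<lambda>\<omega>. (cmod (Z \<omega> $ i))\<^sup>2) = expectation (\<lambda>\<omega>. (cmod (smear (g i) \<omega>))\<^sup>2)" for i
  proof -
    note sm = smear_moments[OF g[of i]]
    have [measurable]: "smear (g i) \<in> borel_measurable M" by measurable
    show "integrable M (\<lambda>\<omega>. Z \<omega> $ i)"
      using comp(2)[of i] sm(1) by (subst integrable_cong_AE[where g = "smear (g i)"]) auto
    show "(CLINT \<omega>|M. Z \<omega> $ i) = 0"
      using comp(2)[of i] sm(2) by (subst integral_cong_AE[where g = "smear (g i)"]) auto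
    have ae: "AE \<omega> in M. (cmod (Z \<omega> $ i))\<^sup>2 = (cmod (smear (g i) \<omega>))\<^sup>2"
      using comp(2)[of i] by eventually_elim simp
    show "integrable M (\<lambda>\<omega>. (cmod (Z \<omega> $ i))\<^sup>2)"
      by (rule integrable_cong_AE_imp[OF sm(3)]) (use ae in \<open>auto elim: eventually_mono\<close>)
    show "expectation (\<lambda>\<omega>. (cmod (Z \<omega> $ i))\<^sup>2) = expectation (\<lambda>\<omega>. (cmod (smear (g i) \<omega>))\<^sup>2)"
      by (intro integral_cong_AE ae) measurable
  qed
  have mean_W: "(CLINT \<omega>|M. W \<omega> $ i) = m $ i" for i
  proof -
    have "(CLINT \<omega>|M. W \<omega> $ i) = (CLINT \<omega>|M. m $ i + Z \<omega> $ i)" by (simp add: Z_def)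
    also have "\<dots> = m $ i" using ZS(1,2)[of i] by (simp add: prob_space)
    finally show ?thesis .
  qed
  have \<Gamma>: "\<Gamma> $ i $ j = (CLINT \<omega>|M. Z \<omega> $ i * cnj (Z \<omega> $ j))" for i j
    by (simp add: \<Gamma>_def covariance_matrix_def mean_W Z_def)
  show "\<Gamma> $ i $ i = complex_of_real (expectation (\<lambda>\<omega>. (cmod (wavelet_transform \<psi> (\<lambda>\<tau>. \<Phi> \<tau> \<omega>) (t $ i) (s $ i)))\<^sup>2))"
  proof -
    have "\<Gamma> $ i $ i = complex_of_real (expectation (\<lambda>\<omega>. (cmod (Z \<omega> $ i))\<^sup>2))"
      unfolding \<Gamma> complex_norm_square[symmetric] by (rule integral_complex_of_real)
    also have "\<dots> = complex_of_real (expectation (\<lambda>\<omega>. (cmod (smear (g i) \<omega>))\<^sup>2))"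
      by (simp only: ZS(4))
    finally show ?thesis
      unfolding g_def wavelet_noise(3)[OF \<psi> f bdd s[of i], where t = "t $ i", symmetric] .
  qed
  note mom = second_moment_matrix[OF Z ZS(3) \<Gamma>]
  have char: "(CLINT \<omega>|M. iexp (u \<bullet> Z \<omega>)) = complex_of_real (exp (- Re (hermitian_form \<Gamma> u) / 4))" for u
  proof -
    let ?G = "\<lambda>\<tau>. \<Sum>i\<in>UNIV. cnj (u $ i) * g i \<tau>"
    have G: "analytic_kernel ?G"
      by (intro analytic_kernel_sum analytic_kernel_cmult g) simp
    have [measurable]: "smear ?G \<in> borel_measurable M" by measurable
    have "AE \<omega> in M. smear ?G \<omega> = (\<Sum>i\<in>UNIV. smear (\<lambda>\<tau>. cnj (u $ i) * g i \<tau>) \<omega>)"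
      by (intro AE_smear_sum integrable_mult_right gi) simp
    then have ae: "AE \<omega> in M. cdot u (Z \<omega>) = smear ?G \<omega>"
      using all by eventually_elim (simp add: cdot_def smear_cmult)
    have [measurable]: "(\<lambda>\<omega>. cdot u (Z \<omega>)) \<in> borel_measurable M"
      unfolding cdot_def by measurable
    have "(CLINT \<omega>|M. iexp (u \<bullet> Z \<omega>)) = (CLINT \<omega>|M. iexp (Re (smear ?G \<omega>)))"
      unfolding inner_eq_Re_cdot using ae by (intro integral_cong_AE) auto
    also have "\<dots> = complex_of_real (exp (- expectation (\<lambda>\<omega>. (cmod (smear ?G \<omega>))\<^sup>2) / 4))"
      by (rule circular_char_smear[OF G])
    also have "expectation (\<lambda>\<omega>. (cmod (smear ?G \<omega>))\<^sup>2) = expectation (\<lambda>\<omega>. (cmod (cdot u (Z \<omega>)))\<^sup>2)"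
      using ae by (intro integral_cong_AE) auto
    finally show ?thesis unfolding mom(2) by simp
  qed
  assume inv: "invertible \<Gamma>"
  note cg = circular_gaussian_density[OF prob_space_axioms Z mom(1) mom(3)[OF inv] char, of m]
  show "complex_gaussian_density m \<Gamma> w \<in> \<real>\<^sub>\<ge>\<^sub>0" by (rule cg(1))
  have "(\<lambda>\<omega>. m + Z \<omega>) = W" by (simp add: Z_def)
  with cg(2) show "distributed M lborel W (\<lambda>w. ennreal (Re (complex_gaussian_density m \<Gamma> w)))"
    by simp
qed

end

text \<open>The weight excludes the radius \<open>0\<close>, while the right-hand side admits it; there the product of the radii
vanishes.\<close>

lemma prod_polar_weight:
  fixes \<theta> r :: "real ^ 'n"
  assumes "0 \<le> y"
  shows "(\<Prod>i\<in>UNIV. polar_weight (\<theta> $ i) (r $ i)) * ennreal y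
    = indicator {\<theta>. \<forall>i. 0 \<le> \<theta> $ i \<and> \<theta> $ i < 2 * pi} \<theta> *
      (ennreal ((\<Prod>i\<in>UNIV. r $ i) * y) * indicator {r. \<forall>i. 0 \<le> r $ i} r)"
proof (cases "\<forall>i. (0 \<le> \<theta> $ i \<and> \<theta> $ i < 2 * pi) \<and> 0 < r $ i")
  case True
  then have r: "0 \<le> r $ i" for i by (simp add: less_imp_le)
  have "(\<Prod>i\<in>UNIV. polar_weight (\<theta> $ i) (r $ i)) = (\<Prod>i\<in>UNIV. ennreal (r $ i))"
    using True by (intro prod.cong refl) (simp add: polar_weight_def)
  also have "\<dots> = ennreal (\<Prod>i\<in>UNIV. r $ i)" using r by (intro prod_ennreal) simp
  finally show ?thesis
    using True r assms by (simp add: ennreal_mult prod_nonneg)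
next
  case False
  then obtain i where "\<not> (0 \<le> \<theta> $ i \<and> \<theta> $ i < 2 * pi) \<or> r $ i \<le> 0" by (auto simp: not_less)
  then have "polar_weight (\<theta> $ i) (r $ i) = 0" by (auto simp: polar_weight_def indicator_def)
  then have L: "(\<Prod>i\<in>UNIV. polar_weight (\<theta> $ i) (r $ i)) = 0" by (intro prod_zero) auto
  show ?thesis
  proof (cases "(\<forall>i. 0 \<le> \<theta> $ i \<and> \<theta> $ i < 2 * pi) \<and> (\<forall>i. 0 \<le> r $ i)")
    case True
    with False obtain i where "\<not> 0 < r $ i" by blast
    with True have "r $ i = 0" by (simp add: order.antisym not_less)
    then have P: "(\<Prod>i\<in>UNIV. r $ i) = 0" by (intro prod_zero) auto
    show ?thesis unfolding L P by simp
  next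
    case False
    then have "\<theta> \<notin> {\<theta>. \<forall>i. 0 \<le> \<theta> $ i \<and> \<theta> $ i < 2 * pi} \<or> r \<notin> {r. \<forall>i. 0 \<le> r $ i}" by blast
    then show ?thesis
      unfolding L by (elim disjE) (simp_all del: mem_Collect_eq)
  qed
qed

theorem proposition5:
  fixes M :: "'a measure"
    and \<psi> :: "real \<Rightarrow> complex"
    and f :: "real \<Rightarrow> real"
    and \<Phi> :: "real \<Rightarrow> 'a \<Rightarrow> real"
    and C :: "real \<Rightarrow> real"
    and F :: "real measure"
  defines "Y \<equiv> \<lambda>\<omega> \<tau>. f \<tau> + \<Phi> \<tau> \<omega>"
  assumes "prob_space M"
    and "analytic_mother_wavelet \<psi>"
    and "f \<in> borel_measurable borel" and "bounded (range f)"
    and "(\<lambda>(\<tau>, \<omega>). \<Phi> \<tau> \<omega>) \<in> borel_measurable (borel \<Otimes>\<^sub>M M)"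
    and "gaussian_process M \<Phi>"
    and "stationary_with_covariance M C \<Phi>"
    and "spectral_measure F C"
  shows "(\<forall>(t :: real ^ 'n) (s :: real ^ 'n).
            let W\<^sub>Y = (\<lambda>\<omega>. wavelet_vector \<psi> (Y \<omega>) t s);
                W\<^sub>f = wavelet_vector \<psi> f t s;
                \<Gamma> = covariance_matrix M W\<^sub>Y;
                p = complex_gaussian_density W\<^sub>f \<Gamma>
            in (\<forall>i. 0 < s $ i) \<longrightarrow> invertible \<Gamma> \<longrightarrow>
               (\<forall>w. p w \<in> \<real>\<^sub>\<ge>\<^sub>0) \<and>
               distributed M lborel W\<^sub>Y (\<lambda>w. ennreal (Re (p w))) \<and>
               distributed M lborel (\<lambda>\<omega>. phase_vector (W\<^sub>Y \<omega>))
                 (\<lambda>\<theta>. indicator {\<theta>. \<forall>i. 0 \<le> \<theta> $ i \<and> \<theta> $ i < 2 * pi} \<theta> *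
                   (\<integral>\<^sup>+ r \<in> {r. \<forall>i. 0 \<le> r $ i}.
                      ennreal ((\<Prod>i\<in>UNIV. r $ i) * Re (p (polar_vector r \<theta>))) \<partial>lborel)))
       \<and> (\<forall>t s \<theta>\<^sub>f.
            let W\<^sub>f = wavelet_transform \<psi> f t s;
                v = (LINT \<omega>|M. (cmod (wavelet_transform \<psi> (\<lambda>\<tau>. \<Phi> \<tau> \<omega>) t s))\<^sup>2);
                q = (cmod W\<^sub>f)\<^sup>2 / v
            in 0 < s \<longrightarrow> 0 < v \<longrightarrow> is_Arg W\<^sub>f \<theta>\<^sub>f \<longrightarrow>
               (\<forall>\<theta>. 0 \<le> phase_density q \<theta>\<^sub>f \<theta>) \<and>
               distributed M lborel (\<lambda>\<omega>. Arg2pi (wavelet_transform \<psi> (Y \<omega>) t s))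
                 (\<lambda>\<theta>. indicator {0..<2 * pi} \<theta> * ennreal (phase_density q \<theta>\<^sub>f \<theta>)))"
proof -
  interpret stationary_gaussian M \<Phi> C F
    using assms by (simp add: stationary_gaussian_def stationary_gaussian_axioms_def)
  note \<psi> = assms(3) and f = assms(4,5)
  have Y: "Y \<omega> = (\<lambda>\<tau>. f \<tau> + \<Phi> \<tau> \<omega>)" for \<omega>
    by (simp add: Y_def)
  have a: "(\<forall>w. p w \<in> \<real>\<^sub>\<ge>\<^sub>0) \<and>
      distributed M lborel W\<^sub>Y (\<lambda>w. ennreal (Re (p w))) \<and>
      distributed M lborel (\<lambda>\<omega>. phase_vector (W\<^sub>Y \<omega>))
        (\<lambda>\<theta>. indicator {\<theta>. \<forall>i. 0 \<le> \<theta> $ i \<and> \<theta> $ i < 2 * pi} \<theta> *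
          (\<integral>\<^sup>+ r \<in> {r. \<forall>i. 0 \<le> r $ i}. ennreal ((\<Prod>i\<in>UNIV. r $ i) * Re (p (polar_vector r \<theta>))) \<partial>lborel))"
    if s: "\<forall>i. 0 < s $ i" and inv: "invertible (covariance_matrix M W\<^sub>Y)"
      and W\<^sub>Y: "W\<^sub>Y = (\<lambda>\<omega>. wavelet_vector \<psi> (Y \<omega>) t s)"
      and p: "p = complex_gaussian_density (wavelet_vector \<psi> f t s) (covariance_matrix M W\<^sub>Y)"
    for t s :: "real ^ 'n" and W\<^sub>Y p
  proof -
    have s': "0 < s $ i" for i using s by simp
    note D = wavelet_vector_distributed(2,3)[OF \<psi> f s', of t, folded Y, folded W\<^sub>Y, OF inv, folded p]
    have nn: "0 \<le> Re (p w)" for w using D(1)[of w] by (auto elim: nonneg_Reals_cases)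
    have eq: "(\<integral>\<^sup>+r. (\<Prod>i\<in>UNIV. polar_weight (\<theta> $ i) (r $ i)) * ennreal (Re (p (polar_vector r \<theta>))) \<partial>lborel)
      = indicator {\<theta>. \<forall>i. 0 \<le> \<theta> $ i \<and> \<theta> $ i < 2 * pi} \<theta> *
          (\<integral>\<^sup>+ r \<in> {r. \<forall>i. 0 \<le> r $ i}. ennreal ((\<Prod>i\<in>UNIV. r $ i) * Re (p (polar_vector r \<theta>))) \<partial>lborel)"
      for \<theta>
      unfolding prod_polar_weight[OF nn] by (cases "\<theta> \<in> {\<theta>. \<forall>i. 0 \<le> \<theta> $ i \<and> \<theta> $ i < 2 * pi}") simp_all
    show ?thesis using D distributed_phase_vector[OF D(2)] unfolding eq by blast
  qed
  have b: "(\<forall>\<theta>. 0 \<le> phase_density q \<theta>\<^sub>f \<theta>) \<and>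
      distributed M lborel (\<lambda>\<omega>. Arg2pi (wavelet_transform \<psi> (Y \<omega>) t s))
        (\<lambda>\<theta>. indicator {0..<2 * pi} \<theta> * ennreal (phase_density q \<theta>\<^sub>f \<theta>))"
    if s: "0 < s" and v: "0 < v" and arg: "is_Arg (wavelet_transform \<psi> f t s) \<theta>\<^sub>f"
      and v_def: "v = (LINT \<omega>|M. (cmod (wavelet_transform \<psi> (\<lambda>\<tau>. \<Phi> \<tau> \<omega>) t s))\<^sup>2)"
      and q: "q = (cmod (wavelet_transform \<psi> f t s))\<^sup>2 / v"
    for t s \<theta>\<^sub>f v q
  proof -
    \<comment> \<open>A single coefficient is treated as a vector with one coordinate.\<close>
  define W where "W \<omega> = wavelet_vector \<psi> (Y \<omega>) (vec t :: real ^ 1) (vec s)" for \<omega>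
    define m where "m = wavelet_vector \<psi> f (vec t :: real ^ 1) (vec s)"
    define \<Gamma> where "\<Gamma> = covariance_matrix M W"
    have s': "0 < (vec s :: real ^ 1) $ i" for i using s by simp
    note D = wavelet_vector_distributed[OF \<psi> f s', of "vec t", folded Y, folded W_def, folded m_def \<Gamma>_def]
    have \<Gamma>: "\<Gamma> $ 1 $ 1 = complex_of_real v" using D(1)[of 1] by (simp add: v_def)
    then have "invertible \<Gamma>" using v by (simp add: invertible_det_nz det_1)
    from distributed_Arg2pi[OF D(3)[OF this]]
    have "distributed M lborel (\<lambda>\<omega>. Arg2pi (wavelet_transform \<psi> (Y \<omega>) t s))
      (\<lambda>\<theta>. \<integral>\<^sup>+r. polar_weight \<theta> r * ennreal (1 / (pi * v) * exp (- (cmod (of_real r * iexp \<theta> - wavelet_transform \<psi> f t s))\<^sup>2 / v)) \<partial>lborel)"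
      unfolding complex_gaussian_density_1[OF v \<Gamma>] by (simp add: W_def m_def wavelet_vector_def)
    then show ?thesis
      using phase_density_radial[OF v arg] unfolding q by simp
  qed
  show ?thesis
    unfolding Let_def using a b by blast
qed

end
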